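(* Let $V$ be a finite-dimensional real vector space, let $g$ be a non-degenerate symmetric bilinear form on $V$ of arbitrary signature, and let $L:V\to V$ be a $g$-symmetric linear operator. Let $$G_L=\{X\in \mathrm{O}(g)\mid XL=LX\}$$ be the centraliser of $L$ in $\mathrm{O}(g)$, and let $G_L^0$ be its identity connected component. Then $G_L^0$ is a holonomy group for a certain (pseudo-)Riemannian metric: there exist a smooth connected manifold $M$ with a (pseudo-)Riemannian metric $h$, a point $x\in M$ and a linear isomorphism $\varphi:V\to T_xM$ such that the holonomy group of the Levi-Civita connection $\nabla$ of $h$ at $x$ is $\mathrm{Hol}_x(\nabla)=\varphi\, G_L^0\,\varphi^{-1}$.
   Context: $\mathrm{O}(g)=\{A\in \mathrm{GL}(V)\mid g(Au,Av)=g(u,v)\ \text{for all } u,v\in V\}$. A linear operator $L:V\to V$ is $g$-symmetric if $g(Lu,v)=g(u,Lv)$ for all $u,v\in V$. For an affine symmetric (i.e. torsion-free) connection $\nabla$ on a manifold $M$, the holonomy group $\mathrm{Hol}_x(\nabla)\subset \mathrm{GL}(T_xM)$ consists of the parallel transport operators $T_xM\to T_xM$ along closed loops $\gamma$ with $\gamma(0)=\gamma(1)=x$. *)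

theory Defs
  imports "HOL-Analysis.Analysis"
begin

text \<open>
  A finite-dimensional real vector space of arbitrary dimension, \<open>0\<close> included, is a type of class
  \<open>banach\<close> that is spanned by a finite set.  All norms on it are equivalent and complete, so the
  norm only serves to name the canonical topology and differential calculus.
\<close>

section \<open>Linear algebra\<close>

definition nondegenerate :: "('v::real_vector \<Rightarrow> 'v \<Rightarrow> real) \<Rightarrow> bool" where
  "nondegenerate g \<longleftrightarrow> (\<forall>u. (\<forall>v. g u v = 0) \<longrightarrow> u = 0)"

definition form_symmetric :: "('v \<Rightarrow> 'v \<Rightarrow> real) \<Rightarrow> ('v \<Rightarrow> 'v) \<Rightarrow> bool" where
  "form_symmetric g L \<longleftrightarrow> (\<forall>u v. g (L u) v = g u (L v))"

text \<open>
  On a finite-dimensional space every linear operator is bounded, so the type of bounded linear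
  operators is the full algebra of endomorphisms, and its operator norm induces the
  usual topology of \<open>GL(V)\<close>.
\<close>

definition orthogonal_group :: "('v::real_normed_vector \<Rightarrow> 'v \<Rightarrow> real) \<Rightarrow> ('v \<Rightarrow>\<^sub>L 'v) set" where
  "orthogonal_group g = {A. bij (blinfun_apply A) \<and> (\<forall>u v. g (A u) (A v) = g u v)}"

definition centraliser ::
    "('v::real_normed_vector \<Rightarrow> 'v \<Rightarrow> real) \<Rightarrow> ('v \<Rightarrow> 'v) \<Rightarrow> ('v \<Rightarrow>\<^sub>L 'v) set" where
  "centraliser g L = {A \<in> orthogonal_group g. blinfun_apply A \<circ> L = L \<circ> blinfun_apply A}"

definition identity_component :: "('v::real_normed_vector \<Rightarrow>\<^sub>L 'v) set \<Rightarrow> ('v \<Rightarrow>\<^sub>L 'v) set" where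
  "identity_component G = connected_component_set G id_blinfun"


section \<open>Smooth manifolds\<close>

text \<open>
  A manifold is a topology on a set of points of type \<open>'m\<close> with an atlas of charts into \<open>'e\<close>.
  A nonempty connected manifold modelled on \<open>'e\<close> has the cardinality of \<open>'e\<close>, so taking \<open>'m = 'e\<close>
  loses no manifold up to diffeomorphism.
\<close>

text \<open>
  \<open>Ck_on k S f\<close> is meant for open \<open>S\<close> and a finite-dimensional domain, where the existence and
  continuity of all iterated directional derivatives up to order \<open>k\<close> is the usual \<open>C\<^sup>k\<close>.
\<close>

primrec Ck_on ::
    "nat \<Rightarrow> 'a::real_normed_vector set \<Rightarrow> ('a \<Rightarrow> 'b::real_normed_vector) \<Rightarrow> bool" where
  "Ck_on 0 S f \<longleftrightarrow> continuous_on S f"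
| "Ck_on (Suc k) S f \<longleftrightarrow>
     (\<forall>x\<in>S. f differentiable (at x)) \<and> (\<forall>v. Ck_on k S (\<lambda>x. frechet_derivative f (at x) v))"

definition smooth_on :: "'a::real_normed_vector set \<Rightarrow> ('a \<Rightarrow> 'b::real_normed_vector) \<Rightarrow> bool" where
  "smooth_on S f \<longleftrightarrow> (\<forall>k. Ck_on k S f)"

text \<open>
  A chart is a pair of its domain and its coordinate map; the values of the coordinate map outside
  the domain are irrelevant.
\<close>

type_synonym ('m, 'e) chart = "'m set \<times> ('m \<Rightarrow> 'e)"

abbreviation chart_dom :: "('m, 'e) chart \<Rightarrow> 'm set" where
  "chart_dom c \<equiv> fst c"

abbreviation coord :: "('m, 'e) chart \<Rightarrow> 'm \<Rightarrow> 'e" where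
  "coord c \<equiv> snd c"

definition chart_inv :: "('m, 'e) chart \<Rightarrow> 'e \<Rightarrow> 'm" where
  "chart_inv c = inv_into (chart_dom c) (coord c)"

definition transition :: "('m, 'e) chart \<Rightarrow> ('m, 'e) chart \<Rightarrow> 'e \<Rightarrow> 'e" where
  "transition c d = coord d \<circ> chart_inv c"

definition smooth_manifold ::
    "'m topology \<Rightarrow> ('m, 'e::real_normed_vector) chart set \<Rightarrow> bool" where
  "smooth_manifold X \<A> \<longleftrightarrow>
     Hausdorff_space X \<and> second_countable X \<and>
     \<Union> (chart_dom ` \<A>) = topspace X \<and>
     (\<forall>c\<in>\<A>. openin X (chart_dom c) \<and> open (coord c ` chart_dom c) \<and>
        homeomorphic_map (subtopology X (chart_dom c)) (top_of_set (coord c ` chart_dom c))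
          (coord c)) \<and>
     (\<forall>c\<in>\<A>. \<forall>d\<in>\<A>. smooth_on (coord c ` (chart_dom c \<inter> chart_dom d)) (transition c d))"


section \<open>Tangent spaces\<close>

text \<open>
  A tangent vector at \<open>p\<close> is the family of its coordinate vectors in all charts around \<open>p\<close>, related
  by the derivatives of the chart transitions, and set to \<open>0\<close> at the remaining indices.  The
  vector space operations are pointwise.
\<close>

type_synonym ('m, 'e) tangent = "('m, 'e) chart \<Rightarrow> 'e"

definition charts_at :: "('m, 'e) chart set \<Rightarrow> 'm \<Rightarrow> ('m, 'e) chart set" where
  "charts_at \<A> p = {c \<in> \<A>. p \<in> chart_dom c}"

definition coord_change ::
    "('m, 'e::real_normed_vector) chart \<Rightarrow> ('m, 'e) chart \<Rightarrow> 'm \<Rightarrow> 'e \<Rightarrow> 'e" where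
  "coord_change c d p = frechet_derivative (transition c d) (at (coord c p))"

definition tangent_space ::
    "('m, 'e::real_normed_vector) chart set \<Rightarrow> 'm \<Rightarrow> ('m, 'e) tangent set" where
  "tangent_space \<A> p =
     {\<xi>. (\<forall>c. c \<notin> charts_at \<A> p \<longrightarrow> \<xi> c = 0) \<and>
         (\<forall>c\<in>charts_at \<A> p. \<forall>d\<in>charts_at \<A> p. \<xi> d = coord_change c d p (\<xi> c))}"

text \<open>The tangent vector at \<open>p\<close> with coordinate vector \<open>u\<close> in the chart \<open>c\<close>:\<close>

definition tangent_vec ::
    "('m, 'e::real_normed_vector) chart set \<Rightarrow> 'm \<Rightarrow> ('m, 'e) chart \<Rightarrow> 'e \<Rightarrow> ('m, 'e) tangent" where
  "tangent_vec \<A> p c u = (\<lambda>d. if d \<in> charts_at \<A> p then coord_change c d p u else 0)"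

definition tangent_iso ::
    "('m, 'e::real_normed_vector) chart set \<Rightarrow> 'm \<Rightarrow> ('v::real_vector \<Rightarrow> ('m, 'e) tangent) \<Rightarrow> bool"
  where
  "tangent_iso \<A> p \<phi> \<longleftrightarrow>
     bij_betw \<phi> UNIV (tangent_space \<A> p) \<and> (\<forall>c. linear (\<lambda>v. \<phi> v c))"


section \<open>Pseudo-Riemannian metrics and the Levi-Civita connection\<close>

text \<open>The components of \<open>h\<close> in the chart \<open>c\<close>, as a function of the coordinates \<open>y\<close>:\<close>

definition metric_in ::
    "('m, 'e::real_normed_vector) chart set \<Rightarrow> ('m \<Rightarrow> ('m, 'e) tangent \<Rightarrow> ('m, 'e) tangent \<Rightarrow> real) \<Rightarrow>
     ('m, 'e) chart \<Rightarrow> 'e \<Rightarrow> 'e \<Rightarrow> 'e \<Rightarrow> real" where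
  "metric_in \<A> h c y u v =
     h (chart_inv c y) (tangent_vec \<A> (chart_inv c y) c u) (tangent_vec \<A> (chart_inv c y) c v)"

definition pseudo_riemannian_metric ::
    "'m topology \<Rightarrow> ('m, 'e::real_normed_vector) chart set \<Rightarrow>
     ('m \<Rightarrow> ('m, 'e) tangent \<Rightarrow> ('m, 'e) tangent \<Rightarrow> real) \<Rightarrow> bool" where
  "pseudo_riemannian_metric X \<A> h \<longleftrightarrow>
     (\<forall>p\<in>topspace X.
        (\<forall>\<xi>\<in>tangent_space \<A> p. \<forall>\<eta>\<in>tangent_space \<A> p. h p \<xi> \<eta> = h p \<eta> \<xi>) \<and>
        (\<forall>\<xi>\<in>tangent_space \<A> p.
           (\<forall>\<eta>\<in>tangent_space \<A> p. h p \<xi> \<eta> = 0) \<longrightarrow> \<xi> = (\<lambda>c. 0))) \<and>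
     (\<forall>c\<in>\<A>.
        (\<forall>y\<in>coord c ` chart_dom c. bilinear (metric_in \<A> h c y)) \<and>
        (\<forall>u v. smooth_on (coord c ` chart_dom c) (\<lambda>y. metric_in \<A> h c y u v)))"

text \<open>
  An affine connection is given by its Christoffel symbols: in the chart \<open>c\<close>, the covariant
  derivative of a vector field \<open>V\<close> in direction \<open>u\<close> at \<open>y\<close> is \<open>DV(y) u + \<Gamma> c y u (V y)\<close>.  The last
  clause says that these local expressions agree on chart overlaps; it is the usual
  inhomogeneous transformation law, where \<open>\<tau>\<close> is the transition map.
\<close>

type_synonym ('m, 'e) christoffel = "('m, 'e) chart \<Rightarrow> 'e \<Rightarrow> 'e \<Rightarrow> 'e \<Rightarrow> 'e"

definition affine_connection ::
    "('m, 'e::real_normed_vector) chart set \<Rightarrow> ('m, 'e) christoffel \<Rightarrow> bool" where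
  "affine_connection \<A> \<Gamma> \<longleftrightarrow>
     (\<forall>c\<in>\<A>.
        (\<forall>y\<in>coord c ` chart_dom c. bilinear (\<Gamma> c y)) \<and>
        (\<forall>u v. smooth_on (coord c ` chart_dom c) (\<lambda>y. \<Gamma> c y u v))) \<and>
     (\<forall>c\<in>\<A>. \<forall>d\<in>\<A>. \<forall>y\<in>coord c ` (chart_dom c \<inter> chart_dom d). \<forall>u v.
        let \<tau> = transition c d; D = frechet_derivative \<tau> (at y) in
          D (\<Gamma> c y u v) =
            \<Gamma> d (\<tau> y) (D u) (D v) + frechet_derivative (\<lambda>z. frechet_derivative \<tau> (at z) v) (at y) u)"

definition torsion_free ::
    "('m, 'e::real_normed_vector) chart set \<Rightarrow> ('m, 'e) christoffel \<Rightarrow> bool" where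
  "torsion_free \<A> \<Gamma> \<longleftrightarrow>
     (\<forall>c\<in>\<A>. \<forall>y\<in>coord c ` chart_dom c. \<forall>u v. \<Gamma> c y u v = \<Gamma> c y v u)"

definition metric_compatible ::
    "('m, 'e::real_normed_vector) chart set \<Rightarrow> ('m \<Rightarrow> ('m, 'e) tangent \<Rightarrow> ('m, 'e) tangent \<Rightarrow> real) \<Rightarrow>
     ('m, 'e) christoffel \<Rightarrow> bool" where
  "metric_compatible \<A> h \<Gamma> \<longleftrightarrow>
     (\<forall>c\<in>\<A>. \<forall>y\<in>coord c ` chart_dom c. \<forall>u v w.
        frechet_derivative (\<lambda>z. metric_in \<A> h c z u v) (at y) w =
          metric_in \<A> h c y (\<Gamma> c y w u) v + metric_in \<A> h c y u (\<Gamma> c y w v))"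

definition levi_civita ::
    "('m, 'e::real_normed_vector) chart set \<Rightarrow> ('m \<Rightarrow> ('m, 'e) tangent \<Rightarrow> ('m, 'e) tangent \<Rightarrow> real) \<Rightarrow>
     ('m, 'e) christoffel \<Rightarrow> bool" where
  "levi_civita \<A> h \<Gamma> \<longleftrightarrow>
     affine_connection \<A> \<Gamma> \<and> torsion_free \<A> \<Gamma> \<and> metric_compatible \<A> h \<Gamma>"


section \<open>Parallel transport and holonomy\<close>

definition C1_arc ::
    "'m topology \<Rightarrow> ('m, 'e::real_normed_vector) chart set \<Rightarrow> (real \<Rightarrow> 'm) \<Rightarrow> real \<Rightarrow> real \<Rightarrow> bool"
  where
  "C1_arc X \<A> \<gamma> a b \<longleftrightarrow>
     continuous_map (top_of_set {a..b}) X \<gamma> \<and>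
     (\<forall>c\<in>\<A>. \<exists>\<gamma>'.
        (\<forall>t\<in>{a..b}. \<gamma> t \<in> chart_dom c \<longrightarrow>
           ((coord c \<circ> \<gamma>) has_vector_derivative \<gamma>' t) (at t within {a..b})) \<and>
        continuous_on {t\<in>{a..b}. \<gamma> t \<in> chart_dom c} \<gamma>')"

definition parallel_on_arc ::
    "('m, 'e::real_normed_vector) chart set \<Rightarrow> ('m, 'e) christoffel \<Rightarrow> (real \<Rightarrow> 'm) \<Rightarrow>
     (real \<Rightarrow> ('m, 'e) tangent) \<Rightarrow> real \<Rightarrow> real \<Rightarrow> bool" where
  "parallel_on_arc \<A> \<Gamma> \<gamma> \<xi> a b \<longleftrightarrow>
     (\<forall>t\<in>{a..b}. \<xi> t \<in> tangent_space \<A> (\<gamma> t) \<and>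
        (\<forall>c\<in>charts_at \<A> (\<gamma> t).
           ((\<lambda>s. \<xi> s c) has_vector_derivative
              - \<Gamma> c (coord c (\<gamma> t)) (vector_derivative (coord c \<circ> \<gamma>) (at t within {a..b})) (\<xi> t c))
             (at t within {a..b})))"

definition subdivision :: "nat \<Rightarrow> (nat \<Rightarrow> real) \<Rightarrow> bool" where
  "subdivision n t \<longleftrightarrow> t 0 = 0 \<and> t n = 1 \<and> (\<forall>i<n. t i < t (Suc i))"

definition piecewise_C1_path ::
    "'m topology \<Rightarrow> ('m, 'e::real_normed_vector) chart set \<Rightarrow> (real \<Rightarrow> 'm) \<Rightarrow> bool" where
  "piecewise_C1_path X \<A> \<gamma> \<longleftrightarrow>
     (\<exists>n t. subdivision n t \<and> (\<forall>i<n. C1_arc X \<A> \<gamma> (t i) (t (Suc i))))"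

definition parallel_along ::
    "'m topology \<Rightarrow> ('m, 'e::real_normed_vector) chart set \<Rightarrow> ('m, 'e) christoffel \<Rightarrow> (real \<Rightarrow> 'm) \<Rightarrow>
     (real \<Rightarrow> ('m, 'e) tangent) \<Rightarrow> bool" where
  "parallel_along X \<A> \<Gamma> \<gamma> \<xi> \<longleftrightarrow>
     (\<exists>n t. subdivision n t \<and>
        (\<forall>i<n. C1_arc X \<A> \<gamma> (t i) (t (Suc i)) \<and>
               parallel_on_arc \<A> \<Gamma> \<gamma> \<xi> (t i) (t (Suc i))))"

definition is_parallel_transport ::
    "'m topology \<Rightarrow> ('m, 'e::real_normed_vector) chart set \<Rightarrow> ('m, 'e) christoffel \<Rightarrow> (real \<Rightarrow> 'm) \<Rightarrow>
     (('m, 'e) tangent \<Rightarrow> ('m, 'e) tangent) \<Rightarrow> bool" where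
  "is_parallel_transport X \<A> \<Gamma> \<gamma> P \<longleftrightarrow>
     (\<forall>v\<in>tangent_space \<A> (\<gamma> 0). \<exists>\<xi>. parallel_along X \<A> \<Gamma> \<gamma> \<xi> \<and> \<xi> 0 = v \<and> \<xi> 1 = P v)"

text \<open>
  Operators on the tangent space are represented by functions that are \<open>undefined\<close> outside it, so
  that equality of sets of operators is equality of sets of functions.
\<close>

definition holonomy_group ::
    "'m topology \<Rightarrow> ('m, 'e::real_normed_vector) chart set \<Rightarrow> ('m, 'e) christoffel \<Rightarrow> 'm \<Rightarrow>
     (('m, 'e) tangent \<Rightarrow> ('m, 'e) tangent) set" where
  "holonomy_group X \<A> \<Gamma> x =
     {P \<in> extensional (tangent_space \<A> x).
        \<exists>\<gamma>. piecewise_C1_path X \<A> \<gamma> \<and> \<gamma> 0 = x \<and> \<gamma> 1 = x \<and> is_parallel_transport X \<A> \<Gamma> \<gamma> P}"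

definition conjugate_to_tangent ::
    "('m, 'e::real_normed_vector) chart set \<Rightarrow> 'm \<Rightarrow> ('v::real_normed_vector \<Rightarrow> ('m, 'e) tangent) \<Rightarrow>
     ('v \<Rightarrow>\<^sub>L 'v) \<Rightarrow> ('m, 'e) tangent \<Rightarrow> ('m, 'e) tangent" where
  "conjugate_to_tangent \<A> x \<phi> A =
     restrict (\<phi> \<circ> blinfun_apply A \<circ> inv \<phi>) (tangent_space \<A> x)"

end

theory Submission
  imports Defs "HOL-Computational_Algebra.Polynomial_Factorial" "HOL-Computational_Algebra.Field_as_Ring"
begin

text \<open>
  Let \<open>F\<close> be a 4-tensor with \<open>F a b c d = F b a c d = F a b d c = F c d a b\<close> in which \<open>L\<close> can be moved from
  any argument to any other, and write \<open>F a b c d = g (E a b c) d\<close>.  On a small ball the metric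
  \<open>h\<^sub>x u v = g (S x u) (S x v)\<close> with \<open>S x = id + E x x\<close> has Christoffel symbols that commute with \<open>L\<close>.  Hence
  parallel transport, read in the frame \<open>S\<close>, is a path in the centraliser, and the holonomy group lies in its
  identity component.

  The curvature of \<open>h\<close> at \<open>0\<close> is a multiple of \<open>F u w v z - F v w u z\<close>.  To make these operators span the Lie
  algebra of the centraliser, split off cyclic subspaces: if \<open>v\<close> generates a nondegenerate cyclic subspace with
  the full minimal polynomial, then an operator \<open>X\<close> in the Lie algebra maps \<open>v\<close> to some \<open>y\<close> in the orthogonal
  complement, and the tensor can be chosen so that the curvature operator of \<open>v, y\<close> also maps \<open>v\<close> to \<open>y\<close>; the
  difference lives on the complement.

  Finally, small trigonometric loops realise every curvature operator to first order, and a contraction argument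
  turns this into a neighbourhood of the identity of the centraliser inside the holonomy group.
\<close>

text \<open>The obstacle is that for an indefinite \<open>g\<close> the operator \<open>L\<close>
  need not be diagonalisable and eigenvectors may be null, so there is no orthogonal eigenbasis to
  work with. Cyclic subspaces replace a normal form. Full minimal polynomial matters: a polynomial
  that represents a vector of the cyclic subspace is then determined as an operator on the
  complement as well, so that cyclic vectors can multiply complementary ones. Writing
  \<open>h\<close> through \<open>S x\<close>, rather than adding a quadratic term to
  \<open>g\<close>, makes an orthonormalising frame explicit that commutes with \<open>L\<close> and
  is the identity at \<open>0\<close>. Therefore transport read in this frame ends in the holonomy
  operator itself. In the spanning formula the vectors \<open>w k\<close> are fixed and only
  \<open>T k X\<close> depends on \<open>X\<close>, linearly; so the area enclosed by a loop is
  linear in \<open>X\<close>. As curvature at the one point \<open>0\<close> already fills the Lie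
  algebra, no derivatives of curvature enter. To invert the map from \<open>X\<close> to transport
  it is not enough that the error be small: it must be Lipschitz with a small constant, which is why
  the Christoffel symbols are expanded in \<open>C^1\<close> sense. The skew part
  \<open>(A - A^-1)/2\<close> serves in place of a logarithm.\<close>

section \<open>Topology of a Banach space spanned by a finite set\<close>

lemma norm_add_off_subspace:
  fixes b :: "'a::real_normed_vector"
  assumes "subspace S" "closed S" "b \<notin> S"
  obtains d where "d > 0" "\<And>a y. y \<in> S \<Longrightarrow> d * \<bar>a\<bar> \<le> norm (a *\<^sub>R b + y)"
proof
  have ne: "S \<noteq> {}" using subspace_0[OF assms(1)] by auto
  show pos: "infdist b S > 0" using infdist_pos_not_in_closed[OF assms(2) ne assms(3)] .
  fix a :: real and y assume y: "y \<in> S"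
  show "infdist b S * \<bar>a\<bar> \<le> norm (a *\<^sub>R b + y)"
  proof (cases "a = 0")
    case False
    have m: "- (inverse a *\<^sub>R y) \<in> S"
      using y assms(1) by (simp add: subspace_neg subspace_scale)
    have "infdist b S \<le> norm (b + inverse a *\<^sub>R y)"
      using infdist_le[OF m, of b] by (simp add: dist_norm)
    then have "infdist b S * \<bar>a\<bar> \<le> norm (b + inverse a *\<^sub>R y) * \<bar>a\<bar>"
      by (intro mult_right_mono) auto
    also have "\<dots> = norm (a *\<^sub>R (b + inverse a *\<^sub>R y))" by simp
    also have "\<dots> = norm (a *\<^sub>R b + y)" using False by (simp add: scaleR_add_right)
    finally show ?thesis .
  qed simp
qed

text \<open>Adding one vector \<open>b\<close> at a time: the distance from \<open>b\<close> to the
  old span bounds the coefficient of \<open>b\<close>, so the coefficients of a Cauchy sequence are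
  Cauchy, and the rest converges in the old span.\<close>

lemma closed_span_finite:
  fixes B :: "'a::banach set"
  assumes "finite B"
  shows "closed (span B)"
  using assms
proof (induction B)
  case (insert b B)
  show ?case
  proof (cases "b \<in> span B")
    case True
    then show ?thesis using insert by (simp add: span_redundant)
  next
    case False
    obtain d where d: "d > 0" "\<And>a y. y \<in> span B \<Longrightarrow> d * \<bar>a\<bar> \<le> norm (a *\<^sub>R b + y)"
      using norm_add_off_subspace[OF subspace_span insert.IH False] by blast
    have "complete (span (insert b B))"
    proof (rule completeI)
      fix f :: "nat \<Rightarrow> 'a"
      assume f: "\<forall>n. f n \<in> span (insert b B)" and "Cauchy f"
      have "\<forall>n. \<exists>k. f n - k *\<^sub>R b \<in> span B" using f by (simp add: span_breakdown_eq)
      then obtain k where k: "\<And>n. f n - k n *\<^sub>R b \<in> span B" by metis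
      have "Cauchy k"
      proof (rule metric_CauchyI)
        fix e :: real assume "e > 0"
        then obtain N where N: "\<And>m n. m \<ge> N \<Longrightarrow> n \<ge> N \<Longrightarrow> dist (f m) (f n) < d * e"
          using \<open>Cauchy f\<close> d(1) unfolding Cauchy_def by (meson mult_pos_pos)
        show "\<exists>M. \<forall>m\<ge>M. \<forall>n\<ge>M. dist (k m) (k n) < e"
        proof (intro exI allI impI)
          fix m n assume mn: "m \<ge> N" "n \<ge> N"
          have "(f m - k m *\<^sub>R b) - (f n - k n *\<^sub>R b) \<in> span B" by (intro span_diff k)
          from d(2)[OF this, of "k m - k n"]
          have "d * \<bar>k m - k n\<bar> \<le> norm (f m - f n)" by (simp add: algebra_simps)
          also have "\<dots> < d * e" using N[OF mn] by (simp add: dist_norm)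
          finally show "dist (k m) (k n) < e" using d(1) by (simp add: dist_real_def)
        qed
      qed
      then obtain l where l: "k \<longlonglongrightarrow> l" using Cauchy_convergent convergent_def by blast
      obtain x where x: "f \<longlonglongrightarrow> x" using \<open>Cauchy f\<close> Cauchy_convergent convergent_def by blast
      have "(\<lambda>n. f n - k n *\<^sub>R b) \<longlonglongrightarrow> x - l *\<^sub>R b" by (intro tendsto_intros l x)
      with insert.IH k have "x - l *\<^sub>R b \<in> span B" by (metis (no_types, lifting) closed_sequentially)
      then have "x \<in> span (insert b B)" by (auto simp: span_breakdown_eq)
      with x show "\<exists>l\<in>span (insert b B). f \<longlonglongrightarrow> l" by blast
    qed
    then show ?thesis by (rule complete_imp_closed)
  qed
qed simp

text \<open>The basis is a parameter and may be empty, so dimension 0 is covered. The topology is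
  that of the given complete norm, with no inner product chosen.\<close>

locale finite_dim =
  fixes B :: "'v::banach set"
  assumes finite_B: "finite B" and independent_B: "independent B" and span_B: "span B = UNIV"
begin

sublocale fd: finite_dimensional_vector_space "scaleR :: real \<Rightarrow> 'v \<Rightarrow> 'v" B
  rewrites "module.dependent (*\<^sub>R) = dependent"
    and "module.subspace (*\<^sub>R) = subspace"
    and "module.span (*\<^sub>R) = span"
    and "vector_space.dim (*\<^sub>R) = dim"
proof -
  show "finite_dimensional_vector_space ((*\<^sub>R) :: real \<Rightarrow> 'v \<Rightarrow> 'v) B"
    by unfold_locales
      (simp_all only: finite_B independent_B span_B dependent_raw_def[symmetric] span_raw_def[symmetric] not_False_eq_True)
qed (simp_all only: dependent_raw_def subspace_raw_def span_raw_def dim_raw_def)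

definition crd :: "'v \<Rightarrow> 'v \<Rightarrow> real" where
  "crd b x = representation B x b"

lemma sum_crd: "(\<Sum>b\<in>B. crd b x *\<^sub>R b) = x"
  unfolding crd_def
  by (rule real_vector.sum_representation_eq) (auto simp: independent_B span_B finite_B)

lemma linear_crd: "linear (crd b)"
  unfolding crd_def
  using real_vector.linear_representation[OF independent_B span_B, of b]
  by (simp add: linear_def real_scaleR_def[abs_def])

lemma bounded_linear_crd: "bounded_linear (crd b)"
proof (cases "b \<in> B")
  case False
  then have "crd b = (\<lambda>x. 0)" using representation_ne_zero[of B _ b] by (auto simp: crd_def fun_eq_iff)
  then show ?thesis by simp
next
  case True
  have "b \<notin> span (B - {b})" using independent_B True by (auto simp: dependent_def)
  then obtain d where d: "d > 0" "\<And>a y. y \<in> span (B - {b}) \<Longrightarrow> d * \<bar>a\<bar> \<le> norm (a *\<^sub>R b + y)"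
    using norm_add_off_subspace[OF subspace_span closed_span_finite] finite_B by (metis finite_Diff)
  have "norm (crd b x) \<le> norm x * (1 / d)" for x
  proof -
    have "(\<Sum>c\<in>B - {b}. crd c x *\<^sub>R c) \<in> span (B - {b})"
      by (intro span_sum span_scale span_base)
    from d(2)[OF this, of "crd b x"] have "d * \<bar>crd b x\<bar> \<le> norm x"
      using sum.remove[OF finite_B True, of "\<lambda>b. crd b x *\<^sub>R b"] by (simp add: sum_crd)
    then show ?thesis using d(1) by (simp add: field_simps)
  qed
  then show ?thesis
    by (meson bounded_linear_intro linear_crd linear_add linear_scale)
qed

lemma bounded_linear_finite_dim:
  fixes f :: "'v \<Rightarrow> 'b::real_normed_vector"
  assumes "linear f"
  shows "bounded_linear f"
proof -
  have "f = (\<lambda>x. \<Sum>b\<in>B. crd b x *\<^sub>R f b)"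
  proof
    fix x
    have "f x = f (\<Sum>b\<in>B. crd b x *\<^sub>R b)" by (simp add: sum_crd)
    then show "f x = (\<Sum>b\<in>B. crd b x *\<^sub>R f b)"
      by (simp add: linear_sum[OF assms] linear_scale[OF assms])
  qed
  moreover have "bounded_linear (\<lambda>x. \<Sum>b\<in>B. crd b x *\<^sub>R f b)"
    by (intro bounded_linear_sum bounded_linear_scaleR_const bounded_linear_crd)
  ultimately show ?thesis by simp
qed

lemma bounded_bilinear_finite_dim:
  fixes f :: "'v \<Rightarrow> 'a::real_normed_vector \<Rightarrow> 'b::real_normed_vector"
  assumes "\<And>y. linear (\<lambda>x. f x y)" "\<And>x. bounded_linear (f x)"
  shows "bounded_bilinear f"
proof -
  have *: "f x y = (\<Sum>b\<in>B. crd b x *\<^sub>R f b y)" for x y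
  proof -
    have "f x y = f (\<Sum>b\<in>B. crd b x *\<^sub>R b) y" by (simp add: sum_crd)
    then show ?thesis
      using linear_sum[OF assms(1), of _ B y] by (simp add: linear_scale[OF assms(1)])
  qed
  obtain K where K: "\<And>b y. norm (f b y) \<le> norm y * K b" "\<And>b. K b \<ge> 0"
    using bounded_linear.nonneg_bounded[OF assms(2)] by metis
  obtain C where C: "\<And>b x. norm (crd b x) \<le> norm x * C b" "\<And>b. C b \<ge> 0"
    using bounded_linear.nonneg_bounded[OF bounded_linear_crd] by metis
  show ?thesis
  proof
    show "f (a + a') b = f a b + f a' b" for a a' b by (rule linear_add[OF assms(1)])
    show "f a (b + b') = f a b + f a b'" for a b b' 
      by (simp add: bounded_linear.linear[OF assms(2)] linear_add)
    show "f (r *\<^sub>R a) b = r *\<^sub>R f a b" for a b r by (rule linear_scale[OF assms(1)])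
    show "f a (r *\<^sub>R b) = r *\<^sub>R f a b" for a b r
      by (simp add: bounded_linear.linear[OF assms(2)] linear_scale)
    show "\<exists>K. \<forall>a b. norm (f a b) \<le> norm a * norm b * K"
    proof (intro exI allI)
      fix a b
      have "norm (f a b) \<le> (\<Sum>c\<in>B. (norm a * C c) * (norm b * K c))"
        unfolding *[of a b] using C K
        by (intro order_trans[OF norm_sum] sum_mono) (simp add: mult_mono)
      then show "norm (f a b) \<le> norm a * norm b * (\<Sum>c\<in>B. C c * K c)"
        by (simp add: sum_distrib_left algebra_simps)
    qed
  qed
qed

text \<open>Rational combinations of the basis are dense; balls of radius \<open>1 / Suc n\<close>
  around them form the countable base that \<open>smooth_manifold\<close> asks for.\<close>

lemma second_countable_finite_dim: "second_countable (euclidean :: 'v topology)"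
proof -
  define Q where "Q = (\<lambda>q. \<Sum>b\<in>B. q b *\<^sub>R b) ` (PiE B (\<lambda>_. \<rat> :: real set))"
  have cQ: "countable Q" unfolding Q_def
    by (intro countable_image countable_PiE finite_B countable_rat)
  have dense: "\<exists>q\<in>Q. norm (x - q) < e" if e: "e > 0" for x :: 'v and e
  proof -
    define c where "c = e / (1 + (\<Sum>b\<in>B. norm b))"
    have s: "(\<Sum>b\<in>B. norm b) \<ge> 0" by (intro sum_nonneg) auto
    have c: "c > 0" using e s by (simp add: c_def)
    have "\<exists>r\<in>\<rat>. \<bar>crd b x - r\<bar> < c" for b
    proof -
      have "crd b x - c < crd b x + c" using c by simp
      then obtain r where "r \<in> \<rat>" "crd b x - c < r" "r < crd b x + c"
        using Rats_dense_in_real by blast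
      then show ?thesis by (intro bexI[of _ r]) auto
    qed
    then obtain r where r: "\<And>b. r b \<in> \<rat>" "\<And>b. \<bar>crd b x - r b\<bar> < c" by metis
    define q where "q = restrict r B"
    have "norm (x - (\<Sum>b\<in>B. q b *\<^sub>R b)) = norm (\<Sum>b\<in>B. (crd b x - r b) *\<^sub>R b)"
      using sum_crd[of x] by (simp add: q_def algebra_simps sum_subtractf)
    also have "\<dots> \<le> (\<Sum>b\<in>B. c * norm b)"
      by (intro order_trans[OF norm_sum] sum_mono) (simp add: less_imp_le mult_right_mono r(2))
    also have "\<dots> = c * (\<Sum>b\<in>B. norm b)" by (simp add: sum_distrib_left)
    also have "\<dots> < e" using s e by (simp add: c_def field_simps)
    finally show ?thesis
      using r(1) by (intro bexI[of _ "\<Sum>b\<in>B. q b *\<^sub>R b"]) (auto simp: Q_def q_def simp del: restrict_apply intro!: imageI)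
  qed
  show ?thesis unfolding second_countable_def
  proof (intro exI[of _ "(\<lambda>(q, n). ball q (1 / real (Suc n))) ` (Q \<times> UNIV)"] conjI allI impI)
    show "countable ((\<lambda>(q, n). ball q (1 / real (Suc n))) ` (Q \<times> UNIV))"
      by (intro countable_image countable_SIGMA cQ) auto
    show "\<forall>V\<in>(\<lambda>(q, n). ball q (1 / real (Suc n))) ` (Q \<times> UNIV). openin euclidean V" by auto
    fix U :: "'v set" and x assume "openin euclidean U \<and> x \<in> U"
    then obtain e where e: "e > 0" "ball x e \<subseteq> U" by (auto simp: open_contains_ball)
    obtain n :: nat where n: "1 / real (Suc n) < e / 2"
      using e(1) nat_approx_posE[of "e/2"] by auto
    obtain q where q: "q \<in> Q" "norm (x - q) < 1 / real (Suc n)" using dense[of "1 / real (Suc n)"] by auto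
    have "ball q (1 / real (Suc n)) \<subseteq> ball x e"
    proof
      fix y assume "y \<in> ball q (1 / real (Suc n))"
      then show "y \<in> ball x e" using q n dist_triangle[of x y q] by (simp add: dist_norm)
    qed
    with e(2) q show "\<exists>V\<in>(\<lambda>(q, n). ball q (1 / real (Suc n))) ` (Q \<times> UNIV). x \<in> V \<and> V \<subseteq> U"
      by (intro bexI[of _ "ball q (1 / real (Suc n))"]) (auto simp: dist_norm norm_minus_commute)
  qed
qed

end

section \<open>Quadratic forms without common failure, dimension counts, representation of
  functionals\<close>

text \<open>On the line \<open>v + t w\<close> every form is a polynomial in \<open>t\<close> of
  degree at most 2. It is nonzero through its constant term for the old indices and through its
  \<open>t^2\<close> coefficient for the new one, so all but finitely many \<open>t\<close>
  work.\<close>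

lemma common_nonzero_of_quadratic_forms:
  fixes q :: "'i \<Rightarrow> 'v::real_vector \<Rightarrow> 'v \<Rightarrow> real"
  assumes "finite I" "subspace W" "\<And>i. i \<in> I \<Longrightarrow> bilinear (q i)"
    and "\<And>i. i \<in> I \<Longrightarrow> \<exists>w\<in>W. q i w w \<noteq> 0"
  shows "\<exists>v\<in>W. \<forall>i\<in>I. q i v v \<noteq> 0"
  using assms(1,3,4)
proof (induction I)
  case empty
  then show ?case using subspace_0[OF assms(2)] by blast
next
  case (insert j I)
  then obtain v where v: "v \<in> W" "\<And>i. i \<in> I \<Longrightarrow> q i v v \<noteq> 0" by auto
  obtain w where w: "w \<in> W" "q j w w \<noteq> 0" using insert.prems by blast
  define r where "r i = [:q i v v, q i v w + q i w v, q i w w:]" for i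
  have "finite {t. poly (r i) t = 0}" if "i \<in> insert j I" for i
    using that v(2) w(2) by (intro poly_roots_finite) (auto simp: r_def)
  then have "finite (\<Union>i\<in>insert j I. {t. poly (r i) t = 0})" using insert.hyps by blast
  then obtain t where t: "t \<notin> (\<Union>i\<in>insert j I. {t. poly (r i) t = 0})"
    using ex_new_if_finite[OF infinite_UNIV_char_0] by blast
  have "q i (v + t *\<^sub>R w) (v + t *\<^sub>R w) = poly (r i) t" if "i \<in> insert j I" for i
    using insert.prems(1)[OF that]
    by (simp add: r_def bilinear_ladd bilinear_radd bilinear_lmul bilinear_rmul algebra_simps)
  then show ?case using t v(1) w(1) assms(2)
    by (intro bexI[of _ "v + t *\<^sub>R w"]) (auto simp: subspace_add subspace_scale)
qed

context finite_dim
begin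

lemma finite_subspace_basis:
  fixes W :: "'v set"
  assumes "subspace W"
  obtains C where "finite C" "C \<subseteq> W" "independent C" "span C = W" "card C = dim W"
  using fd.basis_subspace_exists[OF assms] by (metis)

lemma inj_imp_onto_subspace:
  fixes f :: "'v \<Rightarrow> 'v"
  assumes "subspace W" "linear f" "f ` W \<subseteq> W" "\<And>x. x \<in> W \<Longrightarrow> f x = 0 \<Longrightarrow> x = 0"
  shows "f ` W = W"
proof -
  obtain C where C: "finite C" "C \<subseteq> W" "independent C" "span C = W" "card C = dim W"
    using finite_subspace_basis[OF assms(1)] .
  have inj: "inj_on f W"
    using assms(4) linear_inj_on_iff_eq_0[OF assms(2) assms(1)] by blast
  have "independent (f ` C)"
    using linear_independent_injective_image[OF assms(2)] C(3,4) inj by metis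
  moreover have "card (f ` C) = dim W" using C inj inj_on_subset card_image by metis
  moreover have "f ` C \<subseteq> W" using C(2) assms(3) by blast
  ultimately have "W \<subseteq> span (f ` C)" using fd.card_eq_dim C(1) by (metis finite_imageI)
  also have "\<dots> = f ` W" using linear_span_image[OF assms(2)] C(4) by metis
  finally show ?thesis using assms(3) by blast
qed

text \<open>The map \<open>h\<close> packs the values of \<open>g y\<close> on a basis of
  \<open>W\<close> into a vector of \<open>W\<close>. Representing functionals thus becomes
  surjectivity of an endomorphism of \<open>W\<close>, which follows from injectivity, that is, from
  nondegeneracy on \<open>W\<close>.\<close>

lemma riesz_subspace:
  fixes g :: "'v \<Rightarrow> 'v \<Rightarrow> real"
  assumes "bilinear g" "subspace W" "\<And>u. u \<in> W \<Longrightarrow> (\<And>w. w \<in> W \<Longrightarrow> g u w = 0) \<Longrightarrow> u = 0"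
    and "linear f"
  shows "\<exists>y\<in>W. \<forall>w\<in>W. g y w = f w"
proof -
  obtain C where C: "finite C" "C \<subseteq> W" "independent C" "span C = W"
    using finite_subspace_basis[OF assms(2)] .
  define h where "h y = (\<Sum>c\<in>C. g y c *\<^sub>R c)" for y
  have lin: "linear h" unfolding h_def
    by (intro linearI)
       (auto simp: bilinear_ladd[OF assms(1)] bilinear_lmul[OF assms(1)] scaleR_add_left sum.distrib scaleR_sum_right)
  have indep: "\<And>u. (\<Sum>c\<in>C. u c *\<^sub>R c) = 0 \<Longrightarrow> \<forall>c\<in>C. u c = 0"
    using C(1,3) independentD by blast
  have ext: "\<forall>w\<in>W. k w = l w" if "linear k" "linear l" "\<forall>c\<in>C. k c = l c" for k l :: "'v \<Rightarrow> real"
    using linear_eq_on[OF that(1,2), of _ C] that(3) C(4) by blast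
  have lg: "linear (g y)" for y using assms(1) by (simp add: bilinear_def)
  have "h ` W = W"
  proof (rule inj_imp_onto_subspace[OF assms(2) lin])
    show "h ` W \<subseteq> W" unfolding h_def using C(2) assms(2)
      by (auto intro!: subspace_sum subspace_scale)
    fix x assume x: "x \<in> W" "h x = 0"
    then have "\<forall>c\<in>C. g x c = 0" using indep[of "g x"] by (simp add: h_def)
    then have "\<forall>w\<in>W. g x w = 0" using ext[OF lg, of "\<lambda>_. 0" x] by (simp add: linear_zero)
    then show "x = 0" using assms(3) x by blast
  qed
  moreover have "(\<Sum>c\<in>C. f c *\<^sub>R c) \<in> W" using C(2) assms(2) by (auto intro!: subspace_sum subspace_scale)
  ultimately obtain y where y: "y \<in> W" "h y = (\<Sum>c\<in>C. f c *\<^sub>R c)" by (metis (no_types, lifting) imageE)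
  then have "(\<Sum>c\<in>C. (g y c - f c) *\<^sub>R c) = 0" by (simp add: h_def algebra_simps sum_subtractf)
  then have "\<forall>c\<in>C. g y c = f c" using indep[of "\<lambda>c. g y c - f c"] by simp
  then show ?thesis using ext[OF lg assms(4)] y(1) by blast
qed

end

locale self_adjoint = finite_dim B for B :: "'v::banach set" +
  fixes g :: "'v \<Rightarrow> 'v \<Rightarrow> real" and L :: "'v \<Rightarrow> 'v"
  assumes bil_g: "bilinear g" and sym_g: "g u v = g v u" and nondeg_g: "(\<And>v. g u v = 0) \<Longrightarrow> u = 0"
    and lin_L: "linear L" and sym_L: "g (L u) v = g u (L v)"
begin

lemmas g_simps = bilinear_ladd[OF bil_g] bilinear_radd[OF bil_g] bilinear_lmul[OF bil_g]
  bilinear_rmul[OF bil_g] bilinear_lzero[OF bil_g] bilinear_rzero[OF bil_g]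
  bilinear_lsub[OF bil_g] bilinear_rsub[OF bil_g] bilinear_lneg[OF bil_g] bilinear_rneg[OF bil_g]

lemma linear_g: "linear (g u)" "linear (\<lambda>u. g u v)"
  using bil_g by (simp_all add: bilinear_def)

lemma g_eqI: "(\<And>v. g u v = g w v) \<Longrightarrow> u = w"
  using nondeg_g[of "u - w"] by (simp add: g_simps)

section \<open>Polynomials in the operator\<close>

text \<open>This is \<open>p(L) v\<close> by Horner's scheme. It makes the space a module over the
  real polynomials, with \<open>L\<close>-invariant subspaces as submodules.\<close>

definition pact :: "real poly \<Rightarrow> 'v \<Rightarrow> 'v" where
  "pact p v = fold_coeffs (\<lambda>a w. a *\<^sub>R v + L w) p 0"

lemma L_simps: "L (u + v) = L u + L v" "L (r *\<^sub>R v) = r *\<^sub>R L v" "L 0 = 0" "L (u - v) = L u - L v"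
  using lin_L by (simp_all add: linear_add linear_scale linear_0 linear_diff)

lemma pact_0 [simp]: "pact 0 v = 0"
  by (simp add: pact_def)

lemma pact_pCons [simp]: "pact (pCons a p) v = a *\<^sub>R v + L (pact p v)"
  by (cases "p = 0 \<and> a = 0") (auto simp: pact_def L_simps)

lemma pact_1 [simp]: "pact 1 v = v"
  by (simp add: one_pCons L_simps)

lemma pact_add: "pact (p + q) v = pact p v + pact q v"
  by (induction p q rule: poly_induct2) (auto simp: algebra_simps L_simps)

lemma pact_smult: "pact (smult a p) v = a *\<^sub>R pact p v"
  by (induction p) (auto simp: algebra_simps L_simps)

lemma pact_minus: "pact (- p) v = - pact p v"
  using pact_smult[of "-1" p v] by simp

lemma pact_diff: "pact (p - q) v = pact p v - pact q v"
  using pact_add[of p "- q" v] by (simp add: pact_minus)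

lemma pact_mult: "pact (p * q) v = pact p (pact q v)"
  by (induction p) (auto simp: pact_add pact_smult L_simps)

lemma pact_sum: "pact (sum f I) v = (\<Sum>i\<in>I. pact (f i) v)"
  by (induction I rule: infinite_finite_induct) (auto simp: pact_add)

lemma linear_pact: "linear (pact p)"
  by (induction p) (auto intro!: linearI simp: algebra_simps linear_add linear_scale L_simps)

lemmas pact_simps = linear_add[OF linear_pact] linear_scale[OF linear_pact] linear_0[OF linear_pact]
  linear_diff[OF linear_pact]

lemma pact_commute:
  assumes "linear X" "\<And>v. X (L v) = L (X v)"
  shows "X (pact p v) = pact p (X v)"
  by (induction p) (auto simp: linear_0 linear_add linear_scale assms)

lemma pact_L: "pact p (L v) = L (pact p v)"
  by (rule pact_commute[symmetric, OF lin_L]) simp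

lemma pact_self_adjoint: "g (pact p u) v = g u (pact p v)"
  by (induction p arbitrary: u v) (auto simp: g_simps sym_L pact_L)

text \<open>More iterates \<open>L^i b\<close> than the dimension are dependent, which gives a
  polynomial for each basis vector \<open>b\<close>; polynomials in \<open>L\<close> commute, so the
  product of these kills the whole basis.\<close>

lemma ex_annihilating_poly: "\<exists>p. p \<noteq> 0 \<and> (\<forall>v. pact p v = 0)"
proof -
  have one: "\<exists>p. p \<noteq> 0 \<and> pact p b = 0" for b
  proof -
    define f where "f i = pact (monom 1 i) b" for i :: nat
    define N where "N = Suc (card B)"
    show ?thesis
    \<comment> \<open>Dependence is stated for sets of vectors, so a repetition among the iterates
      has to be treated apart.\<close>
    proof (cases "inj_on f {..<N}")
      case False
      then obtain i j where "i \<noteq> j" "f i = f j" by (auto simp: inj_on_def)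
      then show ?thesis
        by (intro exI[of _ "monom 1 i - monom 1 j"]) (auto simp: f_def pact_diff monom_eq_iff')
    next
      case True
      then have "card (f ` {..<N}) = N" by (simp add: card_image)
      then have "dependent (f ` {..<N})"
        using fd.independent_card_le_dim[of "f ` {..<N}" UNIV] by (auto simp: N_def fd.dimension_def)
      then obtain u v0 where u: "(\<Sum>v\<in>f ` {..<N}. u v *\<^sub>R v) = 0" "v0 \<in> f ` {..<N}" "u v0 \<noteq> 0"
        by (auto simp: dependent_finite)
      then obtain i where i: "i < N" "v0 = f i" by auto
      define p where "p = (\<Sum>i<N. monom (u (f i)) i)"
      have "pact p b = (\<Sum>i<N. u (f i) *\<^sub>R f i)"
        unfolding p_def pact_sum f_def
        by (intro sum.cong) (auto simp: pact_smult[symmetric] smult_monom)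
      also have "\<dots> = 0" using u(1) by (simp add: sum.reindex[OF True])
      finally have "pact p b = 0" .
      moreover have "coeff p i = u v0" using i by (simp add: p_def coeff_sum)
      ultimately show ?thesis using u(3) by (intro exI[of _ p]) auto
    qed
  qed
  then obtain q where q: "\<And>b. q b \<noteq> 0" "\<And>b. pact (q b) b = 0" by metis
  define p where "p = prod q B"
  have "pact p b = 0" if "b \<in> B" for b
  proof -
    have "p = prod q (B - {b}) * q b" using prod.remove[OF finite_B that, of q] by (simp add: p_def)
    then show ?thesis by (simp add: pact_mult q pact_simps)
  qed
  then have "pact p v = 0" for v
    using linear_eq_0_on_span[OF linear_pact, of B p v] by (simp add: span_B)
  moreover have "p \<noteq> 0" using q(1) finite_B by (simp add: p_def)
  ultimately show ?thesis by blast
qed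

text \<open>
  The quotients \<open>p div \<pi>\<close> are the maximal proper divisors of the minimal polynomial \<open>p\<close>, so a vector on
  which none of their quadratic forms vanishes generates a nondegenerate cyclic subspace with annihilator \<open>(p)\<close>.
\<close>

lemma ex_nondegenerate_cyclic_vector:
  assumes W: "subspace W" "L ` W \<subseteq> W" "\<And>u. u \<in> W \<Longrightarrow> (\<And>w. w \<in> W \<Longrightarrow> g u w = 0) \<Longrightarrow> u = 0"
  shows "\<exists>v\<in>W. \<forall>f. (\<forall>h. g (pact (f * h) v) v = 0) \<longrightarrow> (\<forall>w\<in>W. pact f w = 0)"
proof -
  define Ann where "Ann = {p. \<forall>w\<in>W. pact p w = 0}"
  have pW: "pact p w \<in> W" if "w \<in> W" for p w
    using that by (induction p) (use W in \<open>auto simp: subspace_0 subspace_add subspace_scale\<close>)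
  have Ann_mult: "p * q \<in> Ann" if "q \<in> Ann" for p q
    using that by (auto simp: Ann_def pact_mult pact_simps)
  have Ann_diff: "p - q \<in> Ann" if "p \<in> Ann" "q \<in> Ann" for p q
    using that by (auto simp: Ann_def pact_diff)
  have "\<exists>p. p \<in> Ann \<and> p \<noteq> 0" using ex_annihilating_poly by (auto simp: Ann_def)
  \<comment> \<open>An annihilating polynomial of least degree is a minimal polynomial of
    \<open>L\<close> on \<open>W\<close>; division with remainder shows that it generates
    \<open>Ann\<close>.\<close>
  then obtain p where p: "p \<in> Ann" "p \<noteq> 0" "\<And>q. q \<in> Ann \<Longrightarrow> q \<noteq> 0 \<Longrightarrow> degree p \<le> degree q"
    using ex_has_least_nat[of "\<lambda>p. p \<in> Ann \<and> p \<noteq> 0" _ degree] by (metis)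
  have p_dvd: "p dvd q" if "q \<in> Ann" for q
  proof (rule ccontr)
    assume "\<not> p dvd q"
    then have "q mod p \<noteq> 0" by (simp add: mod_eq_0_iff_dvd)
    moreover have "q mod p \<in> Ann"
      using Ann_diff[OF that Ann_mult[OF p(1), of "q div p"]] by (simp add: minus_div_mult_eq_mod)
    ultimately show False using p(3)[of "q mod p"] degree_mod_less[OF p(2), of q] by auto
  qed
  \<comment> \<open>By polarisation a vanishing quadratic form of the self-adjoint
    \<open>q(L)\<close> makes the bilinear form vanish on \<open>W\<close>, and nondegeneracy then
    gives \<open>q(L) = 0\<close> on \<open>W\<close>.\<close>
  have ex: "\<exists>w\<in>W. g (pact q w) w \<noteq> 0" if "q \<notin> Ann" for q
  proof (rule ccontr)
    assume a: "\<not> ?thesis"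
    have "g (pact q u) w = 0" if "u \<in> W" "w \<in> W" for u w
    proof -
      have "g (pact q (u + w)) (u + w) = 0" "g (pact q u) u = 0" "g (pact q w) w = 0"
        using a that W(1) by (auto simp: subspace_add)
      then show ?thesis
        using sym_g[of "pact q w" u] by (simp add: pact_simps g_simps pact_self_adjoint)
    qed
    then have "\<forall>u\<in>W. pact q u = 0" using W(3) pW by blast
    with that show False by (simp add: Ann_def)
  qed
  have "\<exists>v\<in>W. \<forall>\<pi>\<in>prime_factors p. g (pact (p div \<pi>) v) v \<noteq> 0"
  proof (rule common_nonzero_of_quadratic_forms[OF _ W(1), where q = "\<lambda>\<pi> u. g (pact (p div \<pi>) u)"])
    show "finite (prime_factors p)" by simp
    fix \<pi> assume \<pi>: "\<pi> \<in> prime_factors p"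
    show "bilinear (\<lambda>u. g (pact (p div \<pi>) u))"
      unfolding bilinear_def using linear_compose[OF linear_pact linear_g(2)] linear_g(1)
      by (auto simp: o_def)
    have \<pi>': "prime \<pi>" "\<pi> dvd p" using \<pi> by (auto simp: prime_factors_dvd p(2))
    then have eq: "p = \<pi> * (p div \<pi>)" by simp
    show "\<exists>w\<in>W. g (pact (p div \<pi>) w) w \<noteq> 0"
    proof (rule ex, rule)
      assume "p div \<pi> \<in> Ann"
      then have "p dvd p div \<pi>" by (rule p_dvd)
      then have "\<pi> * (p div \<pi>) dvd 1 * (p div \<pi>)" using eq by simp
      moreover have "p div \<pi> \<noteq> 0" using eq p(2) by auto
      ultimately have "\<pi> dvd 1" by (subst (asm) dvd_mult_cancel_right) auto
      then show False using \<pi>'(1) by (simp add: not_prime_unit)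
    qed
  qed
  then obtain v where v: "v \<in> W" "\<And>\<pi>. \<pi> \<in> prime_factors p \<Longrightarrow> g (pact (p div \<pi>) v) v \<noteq> 0" by blast
  \<comment> \<open>By self-adjointness \<open>J\<close> is the ideal of those \<open>f\<close> for
    which \<open>f(L) v\<close> is orthogonal to the cyclic subspace of \<open>v\<close>.\<close>
  define J where "J = {f. \<forall>h. g (pact (f * h) v) v = 0}"
  have J_mult: "f * k \<in> J" if "f \<in> J" for f k
    using that by (auto simp: J_def mult.assoc)
  have J_add: "f + k \<in> J" if "f \<in> J" "k \<in> J" for f k
    using that by (auto simp: J_def algebra_simps pact_add g_simps)
  have pJ: "p \<in> J" using Ann_mult[OF p(1)] v(1) by (auto simp: J_def Ann_def mult.commute g_simps)
  have "f \<in> Ann" if "f \<in> J" for f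
  proof (rule ccontr)
    assume f: "f \<notin> Ann"
    \<comment> \<open>By Bezout \<open>d\<close> lies in \<open>J\<close>. If \<open>f\<close> is
      not in \<open>Ann\<close>, then \<open>d\<close> is a proper divisor of \<open>p\<close> and
      so divides some \<open>p div \<pi>\<close>, which thereby lands in \<open>J\<close>; taking
      the multiplier \<open>1\<close> contradicts the choice of \<open>v\<close>.\<close>
    define d where "d = gcd f p"
    have dJ: "d \<in> J"
    proof -
      have "f * fst (bezout_coefficients f p) + p * snd (bezout_coefficients f p) = d"
        using bezout_coefficients_fst_snd[of f p] by (simp add: d_def mult.commute)
      then show ?thesis using J_add[OF J_mult[OF that] J_mult[OF pJ]] by metis
    qed
    obtain e where e: "p = d * e" unfolding d_def by (meson dvdE gcd_dvd2)
    have "\<not> is_unit e"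
    proof
      assume "is_unit e"
      then have "p dvd d" using e by (simp add: mult_unit_dvd_iff)
      then have "p dvd f" unfolding d_def by (meson dvd_trans gcd_dvd1)
      then show False using f Ann_mult[OF p(1)] by (metis dvdE mult.commute)
    qed
    then obtain \<pi> where \<pi>: "prime \<pi>" "\<pi> dvd e" using prime_divisor_exists e p(2) by (metis mult_zero_right)
    then have "\<pi> \<in> prime_factors p" using e p(2) by (simp add: prime_factors_dvd)
    moreover have "p div \<pi> = d * (e div \<pi>)" using e \<pi> by (simp add: div_mult_swap)
    then have "p div \<pi> \<in> J" using J_mult[OF dJ] by simp
    then have "g (pact (p div \<pi>) v) v = 0" by (auto simp: J_def dest: spec[of _ 1])
    ultimately show False using v(2) by blast
  qed
  then show ?thesis using v(1) by (auto simp: J_def Ann_def)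
qed

end

context self_adjoint
begin

section \<open>Operators from bilinear forms\<close>

definition op_of :: "('v \<Rightarrow> 'v \<Rightarrow> real) \<Rightarrow> 'v \<Rightarrow>\<^sub>L 'v" where
  "op_of \<beta> = Blinfun (\<lambda>y. SOME x. \<forall>z. g x z = \<beta> y z)"

lemma op_of:
  assumes "bilinear \<beta>"
  shows "g (op_of \<beta> y) z = \<beta> y z"
proof -
  define r where "r y = (SOME x. \<forall>z. g x z = \<beta> y z)" for y
  have "\<exists>x. \<forall>z. g x z = \<beta> y z" for y
    using riesz_subspace[OF bil_g subspace_UNIV, of "\<beta> y"] nondeg_g assms
    by (auto simp: bilinear_def)
  then have r: "g (r y) z = \<beta> y z" for y z
    unfolding r_def by (rule someI2_ex) simp
  have "linear r"
    by (intro linearI g_eqI)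
       (simp_all add: g_simps r bilinear_ladd[OF assms] bilinear_lmul[OF assms])
  then show ?thesis
    by (simp add: op_of_def r_def[symmetric, abs_def] bounded_linear_Blinfun_apply bounded_linear_finite_dim r)
qed

text \<open>These projections stand for nondegenerate \<open>L\<close>-invariant subspaces. In the
  later induction, restriction of a tensor or an operator to such a subspace is expressed by
  composition with \<open>P\<close>.\<close>

definition orth_proj :: "('v \<Rightarrow> 'v) \<Rightarrow> bool" where
  "orth_proj P \<longleftrightarrow> linear P \<and> (\<forall>v. P (P v) = P v) \<and> (\<forall>u v. g (P u) v = g u (P v)) \<and>
     (\<forall>v. P (L v) = L (P v))"

text \<open>\<open>P x\<close> represents \<open>g x\<close> on \<open>W\<close>. Uniqueness of the
  representing vector in \<open>W\<close> yields linearity, idempotence and commutation with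
  \<open>L\<close> alike.\<close>

lemma ex_orth_proj:
  assumes W: "subspace W" "L ` W \<subseteq> W" "\<And>u. u \<in> W \<Longrightarrow> (\<And>w. w \<in> W \<Longrightarrow> g u w = 0) \<Longrightarrow> u = 0"
  obtains P where "orth_proj P" "range P = W"
proof -
  have "\<exists>y\<in>W. \<forall>w\<in>W. g y w = g x w" for x
    using riesz_subspace[OF bil_g W(1) _ linear_g(1)] W(3) by blast
  then obtain P where P: "\<And>x. P x \<in> W" "\<And>x w. w \<in> W \<Longrightarrow> g (P x) w = g x w" by metis
  have uniq: "P x = y" if "y \<in> W" "\<And>w. w \<in> W \<Longrightarrow> g x w = g y w" for x y
    using W(3)[of "P x - y"] that P W(1) by (simp add: subspace_diff g_simps)
  have "linear P"
    by (intro linearI uniq) (simp_all add: P W(1) subspace_add subspace_scale g_simps)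
  moreover have "P (P v) = P v" for v by (intro uniq P) simp
  moreover have "g (P u) v = g u (P v)" for u v
    using P(2)[OF P(1)[of v], of u] P(2)[OF P(1)[of u], of v] sym_g[of u "P v"] sym_g[of v "P u"]
      sym_g[of "P v" "P u"] by simp
  moreover have "P (L v) = L (P v)" for v
    by (rule uniq) (use P W(2) in \<open>auto simp: sym_L\<close>)
  moreover have "range P = W"
  proof
    show "range P \<subseteq> W" using P(1) by blast
    have "w = P w" if "w \<in> W" for w using uniq[of w w] that by simp
    then show "W \<subseteq> range P" by blast
  qed
  ultimately show thesis by (intro that[of P]) (simp_all add: orth_proj_def)
qed

text \<open>The Lie algebra of \<open>centraliser g L\<close>.\<close>

definition skew_centraliser :: "('v \<Rightarrow>\<^sub>L 'v) set" where
  "skew_centraliser = {X :: 'v \<Rightarrow>\<^sub>L 'v. (\<forall>u v. g (X u) v = - g u (X v)) \<and> (\<forall>v. X (L v) = L (X v))}"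

section \<open>Metric tensors with values in the centraliser\<close>

text \<open>Up to a constant factor, \<open>curv F\<close> is the curvature at \<open>0\<close> of a metric \<open>g u v + F x x u v + \<dots>\<close>\<close>

definition curv_tensor :: "('v \<Rightarrow> 'v \<Rightarrow> 'v \<Rightarrow> 'v \<Rightarrow> real) \<Rightarrow> bool" where
  "curv_tensor F \<longleftrightarrow> (\<forall>b c d. linear (\<lambda>a. F a b c d)) \<and> (\<forall>a b c d. F a b c d = F b a c d) \<and>
     (\<forall>a b c d. F a b c d = F a b d c) \<and> (\<forall>a b c d. F a b c d = F c d a b) \<and>
     (\<forall>a b c d. F (L a) b c d = F a b (L c) d)"

definition curv :: "('v \<Rightarrow> 'v \<Rightarrow> 'v \<Rightarrow> 'v \<Rightarrow> real) \<Rightarrow> 'v \<Rightarrow> 'v \<Rightarrow> 'v \<Rightarrow>\<^sub>L 'v" where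
  "curv F u v = op_of (\<lambda>y z. F u y v z - F v y u z)"

context
  fixes F
  assumes F: "curv_tensor F"
begin

lemma tensor_sym: "F a b c d = F b a c d" "F a b c d = F a b d c" "F a b c d = F c d a b"
  using F unfolding curv_tensor_def by blast+

lemma tensor_linear:
  "linear (\<lambda>a. F a b c d)" "linear (\<lambda>b. F a b c d)" "linear (\<lambda>c. F a b c d)" "linear (\<lambda>d. F a b c d)"
proof -
  show *: "linear (\<lambda>a. F a b c d)" for b c d
    using F unfolding curv_tensor_def by blast
  show **: "linear (\<lambda>b. F a b c d)" for a c d
    using *[of a c d] tensor_sym(1)[of _ a c d] by simp
  show "linear (\<lambda>c. F a b c d)" for a b d
    using *[of d a b] tensor_sym(3)[of _ d a b] by simp
  show "linear (\<lambda>d. F a b c d)" for a b c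
    using **[of c a b] tensor_sym(3)[of c _ a b] by simp
qed

lemmas tensor_simps =
  tensor_linear[THEN linear_add] tensor_linear[THEN linear_scale] tensor_linear[THEN linear_0]
  tensor_linear[THEN linear_diff] tensor_linear[THEN linear_neg]

lemma tensor_L: "F a b (L c) d = F (L a) b c d" "F a (L b) c d = F (L a) b c d"
  "F a b c (L d) = F (L a) b c d"
proof -
  show *: "F a b (L c) d = F (L a) b c d" for a b c d
    using F unfolding curv_tensor_def by metis
  show "F a (L b) c d = F (L a) b c d" for a b c d
    by (metis * tensor_sym(1))
  show "F a b c (L d) = F (L a) b c d" for a b c d
    by (metis * tensor_sym(2))
qed

lemma curv: "g (curv F u v y) z = F u y v z - F v y u z"
  unfolding curv_def
  by (subst op_of) (auto simp: bilinear_def tensor_simps algebra_simps intro!: linearI)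

lemma curv_in: "curv F u v \<in> skew_centraliser"
proof -
  have "g (curv F u v a) b = - g a (curv F u v b)" for a b
    using tensor_sym by (subst sym_g[of a]) (simp add: curv)
  moreover have "curv F u v (L a) = L (curv F u v a)" for a
    by (rule g_eqI) (simp add: curv sym_L tensor_L)
  ultimately show ?thesis by (simp add: skew_centraliser_def)
qed

lemma curv_linear: "curv F u (v + w) = curv F u v + curv F u w" "curv F u (r *\<^sub>R v) = r *\<^sub>R curv F u v"
  by (intro blinfun_eqI g_eqI; simp add: curv g_simps plus_blinfun.rep_eq scaleR_blinfun.rep_eq tensor_simps algebra_simps)+

end

text \<open>
  The summand of \<open>F\<close> that involves a cyclic subspace with projection \<open>P\<^sub>1\<close> multiplies on the
  complement by the polynomials that represent vectors of the cyclic subspace.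
\<close>

lemma ex_curv_tensor_proj:
  assumes "orth_proj P"
  shows "\<exists>F n w T. curv_tensor F \<and> (\<forall>a b c d. F (P a) b c d = F a b c d) \<and>
    (\<forall>k::nat. linear (T k :: ('v \<Rightarrow>\<^sub>L 'v) \<Rightarrow> 'v)) \<and>
    (\<forall>X\<in>skew_centraliser. (\<forall>y. blinfun_apply X (P y) = X y) \<longrightarrow>
       (\<forall>y z. g (blinfun_apply X y) z = (\<Sum>k<(n::nat). F (w k) y (T k X) z - F (T k X) y (w k) z)))"
  using assms
proof (induction "dim (range P)" arbitrary: P rule: less_induct)
  case (less P)
  have P: "linear P" "\<And>v. P (P v) = P v" "\<And>u v. g (P u) v = g u (P v)" "\<And>v. P (L v) = L (P v)"
    using less.prems by (auto simp: orth_proj_def)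
  note P_lin = linear_add[OF P(1)] linear_scale[OF P(1)] linear_0[OF P(1)] linear_diff[OF P(1)]
  have P_pact: "P (pact f x) = pact f (P x)" for f x by (rule pact_commute[OF P(1) P(4)])
  show ?case
  proof (cases "\<forall>x. P x = 0")
    case True
    have "g (X y) z = 0" if "\<forall>y. X (P y) = X y" for X :: "'v \<Rightarrow>\<^sub>L 'v" and y z
    proof -
      have "X y = X (P y)" by (rule that[rule_format, symmetric])
      also have "P y = 0" using True by blast
      finally show ?thesis by (simp add: blinfun.zero_right g_simps)
    qed
    then show ?thesis
      by (rule_tac x = "\<lambda>_ _ _ _. 0" in exI, rule_tac x = 0 in exI, rule_tac x = "\<lambda>_. 0" in exI,
          rule_tac x = "\<lambda>_ _. 0" in exI) (unfold curv_tensor_def lessThan_0 sum.empty, intro conjI allI ballI impI, simp_all only: linear_zero)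
  next
    case False
    have W: "subspace (range P)" "L ` range P \<subseteq> range P"
      using linear_subspace_image[OF P(1) subspace_UNIV] P(4) by (auto simp: image_iff, metis)
    have Wnd: "u = 0" if "u \<in> range P" "\<And>w. w \<in> range P \<Longrightarrow> g u w = 0" for u
    proof (rule nondeg_g)
      fix z
      have "P u = u" using that(1) P(2) by auto
      then show "g u z = 0" using P(3)[of u z] that(2)[of "P z"] by simp
    qed
    \<comment> \<open>The generator of the cyclic subspace to be split off. By \<open>vf\<close>, a
      polynomial that sends \<open>v\<close> to a vector orthogonal to that subspace kills all of
      \<open>range P\<close>.\<close>
    obtain v where v: "P v = v"
      and vf: "\<And>f. (\<forall>h. g (pact (f * h) v) v = 0) \<Longrightarrow> \<forall>w. pact f (P w) = 0"
      using ex_nondegenerate_cyclic_vector[OF W Wnd] P(2) by (metis rangeE rangeI)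
    have vf': "pact f (P w) = 0" if "\<And>h. g (pact f v) (pact h v) = 0" for f w
      using vf[of f] that by (metis mult.commute pact_mult pact_self_adjoint)
    have v0: "v \<noteq> 0"
    proof
      assume "v = 0"
      then have "pact 1 (P w) = 0" for w by (intro vf') (simp add: pact_simps g_simps)
      with False show False by simp
    qed
    define V1 where "V1 = range (\<lambda>f. pact f v)"
    obtain P1 where "orth_proj P1" and V1: "range P1 = V1"
    proof (rule ex_orth_proj)
      show "subspace V1"
        unfolding subspace_def V1_def
      proof (intro conjI ballI allI)
        show "0 \<in> range (\<lambda>f. pact f v)" by (rule range_eqI[of _ _ 0]) simp
        fix x assume "x \<in> range (\<lambda>f. pact f v)"
        then obtain f where f: "x = pact f v" by auto
        show "c *\<^sub>R x \<in> range (\<lambda>f. pact f v)" for c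
          by (rule range_eqI[of _ _ "smult c f"]) (simp add: f pact_smult)
        fix y assume "y \<in> range (\<lambda>f. pact f v)"
        then obtain h where "y = pact h v" by auto
        then show "x + y \<in> range (\<lambda>f. pact f v)"
          by (intro range_eqI[of _ _ "f + h"]) (simp add: f pact_add)
      qed
      show "L ` V1 \<subseteq> V1"
      proof
        fix y assume "y \<in> L ` V1"
        then obtain f where "y = L (pact f v)" by (auto simp: V1_def)
        then show "y \<in> V1" unfolding V1_def by (intro range_eqI[of _ _ "pCons 0 f"]) simp
      qed
      fix u assume "u \<in> V1" and u: "\<And>w. w \<in> V1 \<Longrightarrow> g u w = 0"
      then obtain f where f: "u = pact f v" by (auto simp: V1_def)
      have "pact f (P v) = 0" by (rule vf') (use u in \<open>auto simp: f V1_def\<close>)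
      then show "u = 0" by (simp add: f v)
    qed blast
    then have P1: "linear P1" "\<And>v. P1 (P1 v) = P1 v" "\<And>u v. g (P1 u) v = g u (P1 v)"
      "\<And>v. P1 (L v) = L (P1 v)"
      by (auto simp: orth_proj_def)
    note P1_lin = linear_add[OF P1(1)] linear_scale[OF P1(1)] linear_0[OF P1(1)] linear_diff[OF P1(1)]
    have ex_f: "\<exists>f. pact f v = P1 x" for x using V1 unfolding V1_def by (metis rangeE rangeI)
    have PP1: "P (P1 x) = P1 x" for x using ex_f[of x] P_pact v by metis
    have P1P: "P1 (P x) = P1 x" for x
      by (rule g_eqI) (simp add: P1(3) P(3) PP1)
    have P1_id: "P1 (pact f v) = pact f v" for f using V1 P1(2) unfolding V1_def by (metis rangeE rangeI)
    have P1v: "P1 v = v" using P1_id[of 1] by simp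
    \<comment> \<open>The projection onto the complement of the cyclic subspace inside
      \<open>range P\<close>; its range misses \<open>v\<close>, so the induction applies to
      it.\<close>
    define P' where "P' x = P x - P1 x" for x
    have P'_lin: "linear P'" unfolding P'_def by (intro linear_compose_sub P(1) P1(1))
    note P'_lins = linear_add[OF P'_lin] linear_scale[OF P'_lin] linear_0[OF P'_lin] linear_diff[OF P'_lin]
    have P'L: "P' (L x) = L (P' x)" for x by (simp add: P'_def P(4) P1(4) L_simps)
    have P'g: "g (P' u) w = g u (P' w)" for u w by (simp add: P'_def P(3) P1(3) g_simps)
    have P'P': "P' (P' x) = P' x" for x by (simp add: P'_def P_lin P1_lin PP1 P1P P(2) P1(2))
    have P'P: "P' (P x) = P' x" for x by (simp add: P'_def P1P P(2))
    have PP': "P (P' x) = P' x" for x by (simp add: P'_def P_lin PP1 P(2))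
    have P1P': "P1 (P' x) = 0" for x by (simp add: P'_def P1_lin P1P P1(2))
    have P'v: "P' v = 0" by (simp add: P'_def v P1v)
    have P'op: "orth_proj P'" using P'_lin P'P' P'g P'L by (simp add: orth_proj_def)
    have "dim (range P') < dim (range P)"
    proof (rule fd.dim_psubset)
      have "range P' \<subseteq> range P" using PP' by (metis image_subsetI rangeI)
      moreover have "v \<notin> range P'" using P'P' P'v v0 by (metis rangeE)
      moreover have "v \<in> range P" using v by (metis rangeI)
      ultimately have "range P' \<subset> range P" by blast
      moreover have "span (range P') = range P'" "span (range P) = range P"
        using W(1) linear_subspace_image[OF P'_lin subspace_UNIV] span_eq_iff by blast+
      ultimately show "span (range P') \<subset> span (range P)" by (simp only:)
    qed
    from less.hyps[OF this P'op] obtain F' n w T where F': "curv_tensor F'"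
      "\<And>a b c d. F' (P' a) b c d = F' a b c d" "\<And>k::nat. linear (T k :: ('v \<Rightarrow>\<^sub>L 'v) \<Rightarrow> 'v)"
      and IH: "\<And>X y z. X \<in> skew_centraliser \<Longrightarrow> (\<And>y. blinfun_apply X (P' y) = X y) \<Longrightarrow>
       g (blinfun_apply X y) z = (\<Sum>k<(n::nat). F' (w k) y (T k X) z - F' (T k X) y (w k) z)"
      by blast

    \<comment> \<open>Multiplication by the polynomial \<open>f\<close> with
      \<open>f(L) v = P1 a\<close>. Two choices of \<open>f\<close> differ by a polynomial that
      kills \<open>v\<close>, hence all of \<open>range P\<close>, so \<open>M\<close> does not
      depend on the choice and is linear in \<open>a\<close>.\<close>
    define M where "M a x = pact (SOME f. pact f v = P1 a) (P x)" for a x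
    have M: "M a x = pact f (P x)" if "pact f v = P1 a" for a x f
    proof -
      define h where "h = (SOME f. pact f v = P1 a)"
      have "pact h v = P1 a" unfolding h_def by (rule someI_ex[OF ex_f])
      then have "pact (h - f) (P x) = 0"
        by (intro vf') (simp add: that pact_diff g_simps)
      then show ?thesis by (simp add: M_def h_def pact_diff)
    qed
    have M_add: "M (a + b) x = M a x + M b x" for a b x
    proof -
      obtain f h where "pact f v = P1 a" "pact h v = P1 b" using ex_f by metis
      then show ?thesis using M[of f a x] M[of h b x] M[of "f + h" "a + b" x] by (simp add: pact_add P1_lin)
    qed
    have M_scale: "M (r *\<^sub>R a) x = r *\<^sub>R M a x" for r a x
    proof -
      obtain f where "pact f v = P1 a" using ex_f by metis
      then show ?thesis using M[of f a x] M[of "smult r f" "r *\<^sub>R a" x] by (simp add: pact_smult P1_lin)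
    qed
    have M_L: "M (L a) x = L (M a x)" for a x
    proof -
      obtain f where "pact f v = P1 a" using ex_f by metis
      then show ?thesis using M[of f a x] M[of "pCons 0 f" "L a" x] by (simp add: P1(4))
    qed
    have M_lin: "M a (x + y) = M a x + M a y" "M a (r *\<^sub>R x) = r *\<^sub>R M a x" "M a 0 = 0" for a x y r
      by (simp_all add: M_def P_lin pact_simps)
    have M_Lr: "M a (L x) = L (M a x)" for a x by (simp add: M_def P(4) pact_L)
    have M_g: "g (M a x) y = g x (M a y)" for a x y
      by (simp add: M_def pact_self_adjoint P(3) P_pact)
    have M_comm: "M a (M b x) = M b (M a x)" for a b x
      unfolding M_def P_pact P(2) pact_mult[symmetric] by (simp add: mult.commute)
    have M_P': "M a (P' x) = P' (M a x)" for a x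
      by (simp add: M_def pact_commute[OF P'_lin P'L] PP' P'P)
    have M_v: "M v x = P x" for x using M[of 1 v x] by (simp add: P1v)
    have M_0: "M a x = 0" if "P1 a = 0" for a x using M[of 0 a x] that by simp
    have M_P: "M (P a) x = M a x" for a x by (simp add: M_def P1P)

    \<comment> \<open>The first summand multiplies the complement parts of \<open>c\<close> and
      \<open>d\<close> by the cyclic parts of \<open>a\<close> and \<open>b\<close>; the second
      restores symmetry under exchange of the two pairs. \<open>L\<close> passes freely because
      \<open>M\<close> is built from polynomials in \<open>L\<close>.\<close>
    define F0 where "F0 a b c d = g (M a (M b (P' c))) (P' d) + g (M c (M d (P' a))) (P' b)" for a b c d
    define F where "F a b c d = F0 a b c d + F' a b c d" for a b c d
    have F0: "curv_tensor F0"
      unfolding curv_tensor_def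
    proof (intro conjI allI)
      have *: "g (M a (M b (P' c))) (P' d) = g (M a (M b (P' d))) (P' c)" for a b c d
        by (metis M_g M_comm sym_g)
      fix a b c d
      show "linear (\<lambda>a. F0 a b c d)" unfolding F0_def
        by (intro linearI) (simp_all add: M_add M_scale M_lin P'_lins g_simps algebra_simps)
      show "F0 a b c d = F0 b a c d" unfolding F0_def using *[of c d a b] by (simp add: M_comm)
      show "F0 a b c d = F0 a b d c" unfolding F0_def using *[of a b c d] by (simp add: M_comm)
      show "F0 a b c d = F0 c d a b" unfolding F0_def by simp
      show "F0 (L a) b c d = F0 a b (L c) d" unfolding F0_def by (simp add: M_L M_Lr P'L)
    qed
    have F: "curv_tensor F"
      unfolding curv_tensor_def F_def
    proof (intro conjI allI)
      show "linear (\<lambda>a. F0 a b c d + F' a b c d)" for b c d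
        by (intro linear_compose_add tensor_linear F0 F'(1))
    qed (use F0 F'(1) in \<open>unfold curv_tensor_def, metis+\<close>)
    have FP: "F (P a) b c d = F a b c d" for a b c d
      using F'(2)[of "P a"] F'(2)[of a] by (simp add: F_def F0_def M_P P'P)
    have F'P: "F' a b (P' c) d = F' a b c d" for a b c d
      using tensor_sym(3)[OF F'(1)] F'(2) by metis
    have F'v: "F' v b c d = 0" for b c d
      using F'(2)[of v] P'v tensor_simps[OF F'(1)] by simp
    have F0P': "F0 (P' a) b (P' c) d = 0" for a b c d
      by (simp add: F0_def M_0 P1P' g_simps)
    \<comment> \<open>The new index \<open>0\<close> carries the pair \<open>v\<close>,
      \<open>X v\<close>; the old pairs are shifted by one and use the difference left after
      subtracting \<open>curv F v (X v)\<close>. Applying \<open>P'\<close> to them makes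
      \<open>F0\<close> vanish there and leaves \<open>F'\<close> unchanged.\<close>
    define w' where "w' k = (case k of 0 \<Rightarrow> v | Suc k \<Rightarrow> P' (w k))" for k
    define T' where "T' k X = (case k of 0 \<Rightarrow> blinfun_apply X v
      | Suc k \<Rightarrow> P' (T k (X - curv F v (X v))))" for k X
    have "linear (T' k)" for k
    proof (cases k)
      case 0
      then show ?thesis by (intro linearI) (auto simp: T'_def blinfun.add_left blinfun.scaleR_left)
    next
      case (Suc k)
      have "linear (\<lambda>X. X - curv F v (blinfun_apply X v))"
        by (intro linearI)
           (simp_all add: curv_linear[OF F] blinfun.add_left blinfun.scaleR_left scaleR_diff_right)
      from linear_compose[OF linear_compose[OF this F'(3)] P'_lin]
      show ?thesis by (simp add: T'_def[abs_def] Suc o_def)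
    qed
    moreover have "g (blinfun_apply X y) z = (\<Sum>k<Suc n. F (w' k) y (T' k X) z - F (T' k X) y (w' k) z)"
      if X: "X \<in> skew_centraliser" and XP: "\<And>y. blinfun_apply X (P y) = X y" for X y z
    proof -
      have Xg: "g (X a) b = - g a (X b)" and XL: "X (L a) = L (X a)" for a b
        using X by (auto simp: skew_centraliser_def)
      have Xlin: "linear (blinfun_apply X)" by (simp add: blinfun.bounded_linear_right bounded_linear.linear)
      define x where "x = X v"
      \<comment> \<open>Skewness of \<open>X\<close> together with self-adjointness of
        \<open>h(L)\<close> makes this number equal to its own negative, so \<open>X v\<close> is
        orthogonal to the cyclic subspace.\<close>
      have "g x (pact h v) = 0" for h
      proof -
        have "g x (pact h v) = - g v (pact h x)"
          by (simp add: x_def Xg pact_commute[OF Xlin XL])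
        also have "\<dots> = - g x (pact h v)" by (metis pact_self_adjoint sym_g)
        finally show ?thesis by simp
      qed
      then have P1x: "P1 x = 0"
        by (intro g_eqI) (metis P1(3) ex_f g_simps(5))
      have Px: "P x = x"
        by (rule g_eqI) (simp add: P(3) x_def Xg XP)
      have P'x: "P' x = x" by (simp add: P'_def P1x Px)
      define Z where "Z = curv F v x"
      have Zsc: "Z \<in> skew_centraliser" unfolding Z_def by (rule curv_in[OF F])
      have Zlin: "linear (blinfun_apply Z)" by (simp add: blinfun.bounded_linear_right bounded_linear.linear)
      have "F' x v v z = 0" for z using F'v tensor_sym[OF F'(1)] by metis
      \<comment> \<open>\<open>F'\<close> contributes nothing because \<open>P' v = 0\<close>. In
        \<open>F0 v v x z\<close> the factor \<open>M v\<close> is the identity on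
        \<open>range P\<close>, leaving \<open>g x z\<close>; in \<open>F0 x v v z\<close> both
        summands contain \<open>P' v\<close>.\<close>
      then have Zv: "Z v = x"
        by (intro g_eqI) (simp add: Z_def curv[OF F] F_def F'v, simp add: F0_def M_v M_0 P1x P'v P'x Px P(2) g_simps M_lin P'_lins P'g[symmetric])
      have ZP: "Z (P y) = Z y" for y
        by (rule g_eqI) (simp add: Z_def curv[OF F], metis FP tensor_sym(1)[OF F])
      define Y where "Y = X - Z"
      have Ysc: "Y \<in> skew_centraliser"
        using X Zsc by (auto simp: Y_def skew_centraliser_def blinfun.diff_left g_simps L_simps)
      have Ylin: "linear (blinfun_apply Y)" by (simp add: blinfun.bounded_linear_right bounded_linear.linear)
      have "Y v = 0" by (simp add: Y_def blinfun.diff_left Zv x_def)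
      \<comment> \<open>\<open>Y\<close> commutes with \<open>L\<close> and kills the generator,
        hence the cyclic subspace, so it is determined by its action on
        \<open>range P'\<close>.\<close>
      then have "Y (P1 y) = 0" for y
        using ex_f[of y] pact_commute[OF Ylin] Ysc pact_simps(3)
        by (auto simp: skew_centraliser_def) metis
      then have YP': "Y (P' y) = Y y" for y
        by (simp add: P'_def linear_diff[OF Ylin]) (simp add: Y_def blinfun.diff_left XP ZP)
      have "g (Y y) z = (\<Sum>k<n. F' (w k) y (T k Y) z - F' (T k Y) y (w k) z)"
        by (rule IH[OF Ysc YP'])
      also have "\<dots> = (\<Sum>k<n. F (w' (Suc k)) y (T' (Suc k) X) z - F (T' (Suc k) X) y (w' (Suc k)) z)"
        by (intro sum.cong)
           (simp_all add: w'_def T'_def F_def F0P' F'(2) F'P x_def[symmetric] Z_def[symmetric] Y_def[symmetric])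
      finally have "g (Y y) z = \<dots>" .
      moreover have "g (Z y) z = F (w' 0) y (T' 0 X) z - F (T' 0 X) y (w' 0) z"
        by (simp add: Z_def curv[OF F] w'_def T'_def x_def)
      ultimately show ?thesis
        unfolding sum.lessThan_Suc_shift
        by (simp add: Y_def blinfun.diff_left g_simps)
    qed
    ultimately show ?thesis using F FP
      by (intro exI[of _ F] exI[of _ "Suc n"] exI[of _ w'] exI[of _ T']) blast
  qed
qed

lemma ex_curv_tensor:
  obtains F n w T where "curv_tensor F" "\<And>k::nat. linear (T k :: ('v \<Rightarrow>\<^sub>L 'v) \<Rightarrow> 'v)"
    "\<And>X. X \<in> skew_centraliser \<Longrightarrow> X = (\<Sum>k<(n::nat). curv F (w k) (T k X))"
proof -
  have "orth_proj (\<lambda>x. x)" by (simp add: orth_proj_def linear_ident)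
  from ex_curv_tensor_proj[OF this] obtain F n w T where F: "curv_tensor F"
    "\<And>k::nat. linear (T k :: ('v \<Rightarrow>\<^sub>L 'v) \<Rightarrow> 'v)"
    and *: "\<And>X y z. X \<in> skew_centraliser \<Longrightarrow>
       g (blinfun_apply X y) z = (\<Sum>k<(n::nat). F (w k) y (T k X) z - F (T k X) y (w k) z)"
    by blast
  have "X = (\<Sum>k<n. curv F (w k) (T k X))" if "X \<in> skew_centraliser" for X
    by (intro blinfun_eqI g_eqI)
       (simp add: *[OF that] blinfun.sum_left linear_sum[OF linear_g(2)] curv[OF F(1)])
  then show thesis using that F by blast
qed

end

section \<open>Calculus of \<open>Ck_on\<close>\<close>

lemma Ck_on_cong:
  assumes "open S" "\<And>x. x \<in> S \<Longrightarrow> f x = h x" "Ck_on k S f"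
  shows "Ck_on k S h"
  using assms(2,3)
proof (induction k arbitrary: f h)
  case 0
  then show ?case using continuous_on_cong[of S S f h] by simp
next
  case (Suc k)
  have *: "(f has_derivative D) (at x) \<longleftrightarrow> (h has_derivative D) (at x)" if "x \<in> S" for D x
  proof
    assume "(f has_derivative D) (at x)"
    then show "(h has_derivative D) (at x)"
      by (rule has_derivative_transform_within_open[OF _ assms(1) that]) (rule Suc.prems(1))
  next
    assume "(h has_derivative D) (at x)"
    then show "(f has_derivative D) (at x)"
      by (rule has_derivative_transform_within_open[OF _ assms(1) that]) (rule Suc.prems(1)[symmetric])
  qed
  then have fr: "frechet_derivative f (at x) = frechet_derivative h (at x)" if "x \<in> S" for x
    using that by (simp add: frechet_derivative_def)
  have "Ck_on k S (\<lambda>x. frechet_derivative h (at x) v)" for v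
  proof (rule Suc.IH[of "\<lambda>x. frechet_derivative f (at x) v"])
    show "frechet_derivative f (at x) v = frechet_derivative h (at x) v" if "x \<in> S" for x
      by (simp only: fr[OF that])
    show "Ck_on k S (\<lambda>x. frechet_derivative f (at x) v)" using Suc.prems(2) by simp
  qed
  moreover have "h differentiable (at x)" if "x \<in> S" for x
    using Suc.prems(2) *[OF that] that unfolding Ck_on.simps differentiable_def by blast
  ultimately show ?case by simp
qed

lemma Ck_on_SucI:
  assumes "open S" "\<And>x. x \<in> S \<Longrightarrow> (f has_derivative f' x) (at x)" "\<And>v. Ck_on k S (\<lambda>x. f' x v)"
  shows "Ck_on (Suc k) S f"
proof -
  have eq: "f' x v = frechet_derivative f (at x) v" if "x \<in> S" for x v
    using frechet_derivative_at[OF assms(2)[OF that]] by simp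
  have "Ck_on k S (\<lambda>x. frechet_derivative f (at x) v)" for v
    by (rule Ck_on_cong[OF assms(1) eq assms(3)])
  then show ?thesis using assms(2) by (auto simp: differentiable_def)
qed

lemma Ck_on_SucD:
  assumes "Ck_on (Suc k) S f"
  shows "Ck_on k S f"
  using assms
proof (induction k arbitrary: f)
  case 0
  then show ?case
    by (auto intro!: continuous_at_imp_continuous_on simp: differentiable_imp_continuous_within)
next
  case (Suc k)
  then have "\<forall>x\<in>S. f differentiable (at x)" "Ck_on k S (\<lambda>x. frechet_derivative f (at x) v)" for v
    by (auto intro!: Suc.IH simp del: Ck_on.simps(2)) (auto simp: Ck_on.simps(2))
  then show ?case by simp
qed

lemma Ck_on_SucE:
  assumes "Ck_on (Suc k) S f"
  obtains f' where "\<And>x. x \<in> S \<Longrightarrow> (f has_derivative f' x) (at x)" "\<And>v. Ck_on k S (\<lambda>x. f' x v)"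
  using assms by (intro that[of "\<lambda>x. frechet_derivative f (at x)"]) (auto simp: frechet_derivative_works)

lemma Ck_on_const: "Ck_on k S (\<lambda>x. c)"
proof (induction k arbitrary: c)
  case (Suc k)
  then show ?case by (simp add: frechet_derivative_const)
qed simp

lemma Ck_on_bounded_linear:
  assumes "bounded_linear f"
  shows "Ck_on k S f"
proof (cases k)
  case 0
  then show ?thesis using assms by (simp add: linear_continuous_on)
next
  case (Suc n)
  have "frechet_derivative f (at x) = f" for x
    using frechet_derivative_at[OF bounded_linear_imp_has_derivative[OF assms]] by simp
  then show ?thesis
    using bounded_linear_imp_differentiable[OF assms] by (simp add: Suc Ck_on_const)
qed

lemma Ck_on_add:
  assumes "open S" "Ck_on k S f" "Ck_on k S h"
  shows "Ck_on k S (\<lambda>x. f x + h x)"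
  using assms(2,3)
proof (induction k arbitrary: f h)
  case (Suc k)
  obtain f' where f': "\<And>x. x \<in> S \<Longrightarrow> (f has_derivative f' x) (at x)" "\<And>v. Ck_on k S (\<lambda>x. f' x v)"
    using Ck_on_SucE[OF Suc.prems(1)] by blast
  obtain h' where h': "\<And>x. x \<in> S \<Longrightarrow> (h has_derivative h' x) (at x)" "\<And>v. Ck_on k S (\<lambda>x. h' x v)"
    using Ck_on_SucE[OF Suc.prems(2)] by blast
  show ?case
    by (rule Ck_on_SucI[OF assms(1), of _ "\<lambda>x v. f' x v + h' x v"])
       (auto intro!: has_derivative_add f' h' Suc.IH)
qed (auto intro: continuous_on_add)

lemma (in bounded_bilinear) Ck_on_prod:
  assumes "open S" "Ck_on k S f" "Ck_on k S h"
  shows "Ck_on k S (\<lambda>x. prod (f x) (h x))"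
  using assms(2,3)
proof (induction k arbitrary: f h)
  case 0
  then show ?case by (auto intro: continuous_on)
next
  case (Suc k)
  obtain f' where f': "\<And>x. x \<in> S \<Longrightarrow> (f has_derivative f' x) (at x)" "\<And>v. Ck_on k S (\<lambda>x. f' x v)"
    using Ck_on_SucE[OF Suc.prems(1)] by blast
  obtain h' where h': "\<And>x. x \<in> S \<Longrightarrow> (h has_derivative h' x) (at x)" "\<And>v. Ck_on k S (\<lambda>x. h' x v)"
    using Ck_on_SucE[OF Suc.prems(2)] by blast
  show ?case
    by (rule Ck_on_SucI[OF assms(1), of _ "\<lambda>x v. prod (f x) (h' x v) + prod (f' x v) (h x)"])
       (auto intro!: FDERIV Ck_on_add[OF assms(1)] f' h' Suc.IH Suc.prems[THEN Ck_on_SucD])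
qed

lemma Ck_on_compose_bounded_linear:
  assumes "open S" "bounded_linear T" "Ck_on k S f"
  shows "Ck_on k S (\<lambda>x. T (f x))"
  using assms(3)
proof (induction k arbitrary: f)
  case 0
  then show ?case using bounded_linear.continuous_on[OF assms(2)] by simp
next
  case (Suc k)
  obtain f' where f': "\<And>x. x \<in> S \<Longrightarrow> (f has_derivative f' x) (at x)" "\<And>v. Ck_on k S (\<lambda>x. f' x v)"
    using Ck_on_SucE[OF Suc.prems] by blast
  show ?case
    by (rule Ck_on_SucI[OF assms(1), of _ "\<lambda>x v. T (f' x v)"])
       (auto intro!: bounded_linear.has_derivative[OF assms(2)] f' Suc.IH)
qed

lemma Ck_on_minus: "open S \<Longrightarrow> Ck_on k S f \<Longrightarrow> Ck_on k S (\<lambda>x. - f x)"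
  by (rule Ck_on_compose_bounded_linear[OF _ bounded_linear_minus[OF bounded_linear_ident]])

lemma Ck_on_diff: "open S \<Longrightarrow> Ck_on k S f \<Longrightarrow> Ck_on k S h \<Longrightarrow> Ck_on k S (\<lambda>x. f x - h x)"
  using Ck_on_add[of S k f "\<lambda>x. - h x"] Ck_on_minus[of S k h] by simp

lemma Ck_on_sum:
  assumes "open S" "\<And>i. i \<in> A \<Longrightarrow> Ck_on k S (f i)"
  shows "Ck_on k S (\<lambda>x. \<Sum>i\<in>A. f i x)"
  using assms(2) by (induction A rule: infinite_finite_induct) (auto intro!: Ck_on_const Ck_on_add assms(1))

section \<open>Inverses and regularity of operator-valued maps\<close>

text \<open>Everything rests on \<open>I y - I x = - I y (J y - J x) I x\<close>. The uniform bound
  \<open>K\<close> makes it a Lipschitz estimate for \<open>I\<close> in terms of \<open>J\<close>,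
  and a second use of it gives the derivative.\<close>

lemma has_derivative_inverse_blinfun:
  fixes J I :: "'a::real_normed_vector \<Rightarrow> 'b::real_normed_vector \<Rightarrow>\<^sub>L 'b"
  assumes S: "open S" "x \<in> S"
    and inv: "\<And>y. y \<in> S \<Longrightarrow> I y o\<^sub>L J y = id_blinfun" "\<And>y. y \<in> S \<Longrightarrow> J y o\<^sub>L I y = id_blinfun"
    and K: "\<And>y. y \<in> S \<Longrightarrow> norm (I y) \<le> K"
    and J': "(J has_derivative J') (at x)"
  shows "(I has_derivative (\<lambda>h. - (I x o\<^sub>L (J' h o\<^sub>L I x)))) (at x)"
proof -
  have lin: "bounded_linear J'" using J' by (rule has_derivative_bounded_linear)
  then obtain C where C: "\<And>h. norm (J' h) \<le> norm h * C" "C \<ge> 0"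
    using bounded_linear.nonneg_bounded by blast
  have K0: "K \<ge> 0" using K[OF S(2)] norm_ge_zero order_trans by blast
  obtain e where e: "e > 0" "\<And>y. dist y x < e \<Longrightarrow> y \<in> S" using S by (auto simp: open_dist)
  define r where "r y = J y - J x - J' (y - x)" for y
  have r0: "((\<lambda>y. norm (r y) / norm (y - x)) \<longlongrightarrow> 0) (at x)"
  proof -
    have "((\<lambda>y. r y /\<^sub>R norm (y - x)) \<longlongrightarrow> 0) (at x)"
      using J' by (simp add: has_derivative_at_within r_def)
    from tendsto_norm_zero[OF this] show ?thesis by (simp add: divide_inverse mult.commute)
  qed
  \<comment> \<open>\<open>H\<close> bounds the error divided by \<open>norm (y - x)\<close>: one
    summand for the product of the increments of \<open>I\<close> and \<open>J\<close>, one for the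
    remainder \<open>r\<close> of \<open>J\<close>.\<close>
  define H where "H y = K * K * norm (J y - J x) * (C + norm (r y) / norm (y - x)) * K
    + K * (norm (r y) / norm (y - x)) * K" for y
  note nc = norm_blinfun_compose
  show ?thesis
  proof (rule has_derivativeI_sandwich[where H = H and e = e])
    show "bounded_linear (\<lambda>h. - (I x o\<^sub>L (J' h o\<^sub>L I x)))"
      by (intro bounded_linear_minus bounded_linear_compose[OF bounded_bilinear.bounded_linear_right[OF bounded_bilinear_blinfun_compose]]
          bounded_linear_compose[OF bounded_bilinear.bounded_linear_left[OF bounded_bilinear_blinfun_compose]] lin)
    have "isCont J x" using has_derivative_continuous[OF J'] .
    then have "(J \<longlongrightarrow> J x) (at x)" by (simp add: isCont_def)
    then have "((\<lambda>y. norm (J y - J x)) \<longlongrightarrow> 0) (at x)" by (intro tendsto_norm_zero LIM_zero)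
    from tendsto_add[OF tendsto_mult_right[OF tendsto_mult[OF tendsto_mult_left[OF this, of "K*K"] tendsto_add[OF tendsto_const[of C] r0]], of K] tendsto_mult_right[OF tendsto_mult_left[OF r0, of K], of K]]
    show "(H \<longlongrightarrow> 0) (at x)" by (simp add: H_def[abs_def] mult.assoc)
    fix y assume y: "y \<in> UNIV" "y \<noteq> x" "dist y x < e"
    have yS: "y \<in> S" using e(2) y by simp
    have eq: "I y - I x = - (I y o\<^sub>L ((J y - J x) o\<^sub>L I x))"
    proof (rule blinfun_eqI)
      fix v
      have "I y (J y (I x v)) = I x v" using inv(1)[OF yS] by (metis blinfun_apply_blinfun_compose id_blinfun.rep_eq id_apply)
      moreover have "J x (I x v) = v" using inv(2)[OF S(2)] by (metis blinfun_apply_blinfun_compose id_blinfun.rep_eq id_apply)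
      ultimately show "(I y - I x) v = (- (I y o\<^sub>L ((J y - J x) o\<^sub>L I x))) v"
        by (simp add: blinfun.diff_left blinfun.minus_left blinfun.diff_right)
    qed
    \<comment> \<open>Replacing \<open>J' (y - x)\<close> by the increment of \<open>J\<close> minus
      \<open>r\<close> leaves exactly these two error terms.\<close>
    have eq2: "I y - I x - (- (I x o\<^sub>L (J' (y - x) o\<^sub>L I x))) =
        - ((I y - I x) o\<^sub>L ((J y - J x) o\<^sub>L I x)) - (I x o\<^sub>L (r y o\<^sub>L I x))"
      by (subst (1) eq) (rule blinfun_eqI, simp add: r_def blinfun.diff_left blinfun.minus_left blinfun.diff_right)
    have n1: "norm (I y - I x) \<le> K * (norm (J y - J x) * K)"
      unfolding eq norm_minus_cancel
      by (intro order_trans[OF nc] mult_mono order_trans[OF nc[of "J y - J x"]] K S yS)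
         (auto intro!: mult_nonneg_nonneg K0 order_trans[OF nc[of "J y - J x"]])
    have n2: "norm (J y - J x) \<le> norm (y - x) * C + norm (r y)"
    proof -
      have "norm (J y - J x) = norm (J' (y - x) + r y)" by (simp add: r_def)
      then show ?thesis using norm_triangle_ineq[of "J' (y - x)" "r y"] C(1)[of "y - x"] by simp
    qed
    have "norm (I y - I x - (- (I x o\<^sub>L (J' (y - x) o\<^sub>L I x))))
        \<le> norm (I y - I x) * (norm (J y - J x) * norm (I x)) + norm (I x) * (norm (r y) * norm (I x))"
    proof -
      have nc3: "norm (P o\<^sub>L (Q o\<^sub>L R)) \<le> norm P * (norm Q * norm R)" for P Q R :: "'b \<Rightarrow>\<^sub>L 'b"
        by (intro order_trans[OF nc] mult_left_mono nc norm_ge_zero)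
      show ?thesis
        unfolding eq2
        using norm_triangle_ineq4[of "- ((I y - I x) o\<^sub>L ((J y - J x) o\<^sub>L I x))" "I x o\<^sub>L (r y o\<^sub>L I x)"]
          nc3[of "I y - I x" "J y - J x" "I x"] nc3[of "I x" "r y" "I x"] by simp
    qed
    also have "\<dots> \<le> (K * (norm (J y - J x) * K)) * ((norm (y - x) * C + norm (r y)) * K) + K * (norm (r y) * K)"
    proof (intro add_mono)
      have "norm (J y - J x) * norm (I x) \<le> (norm (y - x) * C + norm (r y)) * K"
        by (rule mult_mono[OF n2 K[OF S(2)]]) (simp_all add: C)
      moreover have "0 \<le> K * (norm (J y - J x) * K)" using K0 by simp
      ultimately show "norm (I y - I x) * (norm (J y - J x) * norm (I x))
          \<le> (K * (norm (J y - J x) * K)) * ((norm (y - x) * C + norm (r y)) * K)"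
        by (intro mult_mono[OF n1]) simp_all
      show "norm (I x) * (norm (r y) * norm (I x)) \<le> K * (norm (r y) * K)"
        by (intro mult_mono K[OF S(2)] order_refl) (simp_all add: K0)
    qed
    also have "\<dots> = H y * norm (y - x)"
    proof -
      have *: "K * (d * K) * ((n * C + q) * K) + K * (q * K) = (K * K * d * (C + q / n) * K + K * (q / n) * K) * n"
        if "n \<noteq> 0" for d q n :: real
      proof -
        have "K * (d * K) * ((n * C + p * n) * K) + K * (p * n * K) = (K * K * d * (C + p) * K + K * p * K) * n" for p
          by (simp add: algebra_simps)
        from this[of "q / n"] show ?thesis using that by simp
      qed
      show ?thesis unfolding H_def by (rule *) (use y(2) in simp)
    qed
    finally show "norm (I y - I x - (- (I x o\<^sub>L (J' (y - x) o\<^sub>L I x)))) / norm (y - x) \<le> H y"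
      using y by (simp add: pos_divide_le_eq)
  qed (use e in auto)
qed

text \<open>The estimate \<open>norm x \<le> 2 * norm (f x)\<close> gives injectivity, hence
  bijectivity by dimension, and also the bound 2 on the inverse.\<close>

lemma (in finite_dim) ex_inverse_near_id:
  fixes A :: "'v \<Rightarrow>\<^sub>L 'v"
  assumes "norm A \<le> 1/2"
  shows "\<exists>C. C o\<^sub>L (id_blinfun + A) = id_blinfun \<and> (id_blinfun + A) o\<^sub>L C = id_blinfun \<and> norm C \<le> 2"
proof -
  define f where "f = blinfun_apply (id_blinfun + A)"
  have low: "norm x \<le> 2 * norm (f x)" for x
  proof -
    have "norm (blinfun_apply A x) \<le> 1/2 * norm x"
      using norm_blinfun[of A x] mult_right_mono[OF assms norm_ge_zero[of x]] by linarith
    moreover have "norm x \<le> norm (x + A x) + norm (blinfun_apply A x)"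
      using norm_triangle_ineq4[of "x + A x" "A x"] by simp
    ultimately show ?thesis by (simp add: f_def blinfun.add_left)
  qed
  have lin: "linear f" by (simp add: f_def blinfun.bounded_linear_right bounded_linear.linear)
  have inj0: "x = 0" if "f x = 0" for x using low[of x] that by simp
  then have "inj f" using linear_injective_0[OF lin] by blast
  moreover have "range f = UNIV"
    by (rule inj_imp_onto_subspace[OF subspace_UNIV lin]) (use inj0 in auto)
  ultimately have "bij f" by (simp add: bij_def)
  then have i: "f (inv f y) = y" "inv f (f y) = y" for y by (simp_all add: bij_def surj_f_inv_f)
  have "linear (inv f)"
    by (rule linearI; rule injD[OF \<open>inj f\<close>]; simp add: i linear_add[OF lin] linear_scale[OF lin])
  then have bl: "bounded_linear (inv f)" by (rule bounded_linear_finite_dim)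
  have "norm (Blinfun (inv f)) \<le> 2"
  proof (rule norm_blinfun_bound)
    fix y show "norm (Blinfun (inv f) y) \<le> 2 * norm y"
      using low[of "inv f y"] by (simp add: bounded_linear_Blinfun_apply[OF bl] i)
  qed simp
  then show ?thesis
    by (intro exI[of _ "Blinfun (inv f)"] conjI blinfun_eqI)
       (simp_all only: blinfun_apply_blinfun_compose bounded_linear_Blinfun_apply[OF bl] f_def[symmetric] i id_blinfun.rep_eq id_apply)
qed

context finite_dim
begin

text \<open>An operator is the sum of rank-one pieces \<open>crd b\<close> times its value at
  \<open>b\<close>. Regularity in operator norm thus reduces to regularity of finitely many
  values.\<close>

lemma bounded_linear_rank1: "bounded_linear (\<lambda>z :: 'b::real_normed_vector. Blinfun (\<lambda>x. crd b x *\<^sub>R z))"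
proof -
  have bl: "bounded_linear (\<lambda>x. crd b x *\<^sub>R z)" for z :: 'b
    by (intro bounded_linear_scaleR_const bounded_linear_crd)
  have ap: "Blinfun (\<lambda>x. crd b x *\<^sub>R z) x = crd b x *\<^sub>R z" for z :: 'b and x
    by (rule fun_cong[OF bounded_linear_Blinfun_apply[OF bl]])
  obtain C where C: "\<And>x. norm (crd b x) \<le> norm x * C" "C \<ge> 0"
    using bounded_linear.nonneg_bounded[OF bounded_linear_crd] by blast
  show ?thesis
  proof (rule bounded_linear_intro[where K = C])
    fix z :: 'b
    show "norm (Blinfun (\<lambda>x. crd b x *\<^sub>R z)) \<le> norm z * C"
    proof (rule norm_blinfun_bound)
      fix x
      show "norm (Blinfun (\<lambda>x. crd b x *\<^sub>R z) x) \<le> norm z * C * norm x"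
        using mult_right_mono[OF C(1)[of x] norm_ge_zero[of z]] unfolding ap by (simp add: mult_ac)
    qed (simp add: C(2))
  next
    show "Blinfun (\<lambda>x. crd b x *\<^sub>R (y + z)) = Blinfun (\<lambda>x. crd b x *\<^sub>R y) + Blinfun (\<lambda>x. crd b x *\<^sub>R z)"
      for y z :: 'b
      by (rule blinfun_eqI) (unfold blinfun.add_left ap, rule scaleR_add_right)
    show "Blinfun (\<lambda>x. crd b x *\<^sub>R (r *\<^sub>R z)) = r *\<^sub>R Blinfun (\<lambda>x. crd b x *\<^sub>R z)" for r and z :: 'b
      by (rule blinfun_eqI) (unfold blinfun.scaleR_left ap, rule scaleR_left_commute)
  qed
qed

lemma blinfun_eq_sum_rank1:
  fixes A :: "'v \<Rightarrow>\<^sub>L 'b::real_normed_vector"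
  shows "A = (\<Sum>b\<in>B. Blinfun (\<lambda>x. crd b x *\<^sub>R blinfun_apply A b))"
proof (rule blinfun_eqI)
  fix x
  have bl: "bounded_linear (\<lambda>x. crd b x *\<^sub>R z)" for b and z :: 'b
    by (intro bounded_linear_scaleR_const bounded_linear_crd)
  have "blinfun_apply A (\<Sum>b\<in>B. crd b x *\<^sub>R b) = blinfun_apply (\<Sum>b\<in>B. Blinfun (\<lambda>x. crd b x *\<^sub>R blinfun_apply A b)) x"
    by (simp add: blinfun.sum_left blinfun.sum_right blinfun.scaleR_right bounded_linear_Blinfun_apply[OF bl])
  then show "blinfun_apply A x = blinfun_apply (\<Sum>b\<in>B. Blinfun (\<lambda>x. crd b x *\<^sub>R blinfun_apply A b)) x"
    by (simp only: sum_crd)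
qed

lemma Ck_on_blinfunI:
  fixes A :: "'a::real_normed_vector \<Rightarrow> 'v \<Rightarrow>\<^sub>L 'b::real_normed_vector"
  assumes "open S" "\<And>v. Ck_on k S (\<lambda>x. blinfun_apply (A x) v)"
  shows "Ck_on k S A"
proof -
  have "Ck_on k S (\<lambda>y. \<Sum>b\<in>B. Blinfun (\<lambda>x. crd b x *\<^sub>R blinfun_apply (A y) b))"
    by (intro Ck_on_sum assms Ck_on_compose_bounded_linear[OF _ bounded_linear_rank1])
  then show ?thesis by (simp only: blinfun_eq_sum_rank1[symmetric])
qed

lemma continuous_on_blinfunI:
  fixes A :: "'a::topological_space \<Rightarrow> 'v \<Rightarrow>\<^sub>L 'b::real_normed_vector"
  assumes "\<And>v. continuous_on S (\<lambda>x. blinfun_apply (A x) v)"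
  shows "continuous_on S A"
proof -
  have "continuous_on S (\<lambda>y. \<Sum>b\<in>B. Blinfun (\<lambda>x. crd b x *\<^sub>R blinfun_apply (A y) b))"
    by (intro continuous_on_sum bounded_linear.continuous_on[OF bounded_linear_rank1] assms)
  then show ?thesis by (simp only: blinfun_eq_sum_rank1[symmetric])
qed

lemma bounded_linear_of_blinfun:
  fixes T :: "('v \<Rightarrow>\<^sub>L 'v) \<Rightarrow> 'b::real_normed_vector"
  assumes "linear T"
  shows "bounded_linear T"
proof -
  have lin: "linear (\<lambda>z. T (Blinfun (\<lambda>x. crd b x *\<^sub>R z)))" for b
    using linear_compose[OF bounded_linear.linear[OF bounded_linear_rank1] assms] by (simp add: o_def)
  have "bounded_linear (\<lambda>A. \<Sum>b\<in>B. T (Blinfun (\<lambda>x. crd b x *\<^sub>R blinfun_apply A b)))"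
    by (rule bounded_linear_sum)
       (rule bounded_linear_compose[OF bounded_linear_finite_dim[OF lin] blinfun.bounded_linear_left])
  also have "(\<lambda>A. \<Sum>b\<in>B. T (Blinfun (\<lambda>x. crd b x *\<^sub>R blinfun_apply A b))) = T"
  proof
    fix A
    have "(\<Sum>b\<in>B. T (Blinfun (\<lambda>x. crd b x *\<^sub>R blinfun_apply A b)))
        = T (\<Sum>b\<in>B. Blinfun (\<lambda>x. crd b x *\<^sub>R blinfun_apply A b))"
      by (rule linear_sum[OF assms, symmetric])
    also have "\<dots> = T A" by (rule arg_cong[OF blinfun_eq_sum_rank1[symmetric]])
    finally show "(\<Sum>b\<in>B. T (Blinfun (\<lambda>x. crd b x *\<^sub>R blinfun_apply A b))) = T A" .
  qed
  finally show ?thesis .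
qed

end

section \<open>The metric and its Christoffel symbols\<close>

locale quadratic_metric = self_adjoint B g L
  for B :: "'v::banach set" and g and L +
  fixes F :: "'v \<Rightarrow> 'v \<Rightarrow> 'v \<Rightarrow> 'v \<Rightarrow> real"
  assumes tensor: "curv_tensor F"
begin

lemma bounded_linear_g: "bounded_linear (g u)" "bounded_linear (\<lambda>u. g u v)"
  using bounded_linear_finite_dim linear_g by auto

lemma bounded_bilinear_g: "bounded_bilinear g"
  by (rule bounded_bilinear_finite_dim[OF linear_g(2) bounded_linear_g(1)])

lemma bounded_linear_L: "bounded_linear L"
  by (rule bounded_linear_finite_dim[OF lin_L])

definition E :: "'v \<Rightarrow> 'v \<Rightarrow> 'v \<Rightarrow>\<^sub>L 'v" where
  "E a b = op_of (F a b)"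

lemma g_E: "g (E a b c) d = F a b c d"
  unfolding E_def
  by (subst op_of) (auto simp: bilinear_def tensor_linear[OF tensor])

lemma E_sym: "E a b = E b a"
  by (intro blinfun_eqI g_eqI) (simp only: g_E tensor_sym(1)[OF tensor, of a])

lemma E_self_adjoint: "g (E a b c) d = g c (E a b d)"
  by (simp only: g_E sym_g[of c] tensor_sym(2)[OF tensor, of a b c])

lemma E_L: "E a b (L c) = L (E a b c)" "E (L a) b c = L (E a b c)" "E a (L b) c = L (E a b c)"
  by (intro g_eqI; simp add: g_E sym_L tensor_L[OF tensor])+

lemma bounded_bilinear_E: "bounded_bilinear E"
proof (rule bounded_bilinear_finite_dim)
  show *: "linear (\<lambda>a. E a b)" for b
    by (intro linearI blinfun_eqI g_eqI;
        simp add: g_E g_simps blinfun.add_left blinfun.scaleR_left tensor_simps[OF tensor])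
  show "bounded_linear (E a)" for a
  proof -
    have "(\<lambda>b. E b a) = E a" by (rule ext) (rule E_sym)
    then show ?thesis using bounded_linear_finite_dim[OF *[of a]] by simp
  qed
qed

lemmas E_simps = bounded_bilinear.add_left[OF bounded_bilinear_E] bounded_bilinear.add_right[OF bounded_bilinear_E]
  bounded_bilinear.scaleR_left[OF bounded_bilinear_E] bounded_bilinear.scaleR_right[OF bounded_bilinear_E]
  bounded_bilinear.zero_left[OF bounded_bilinear_E] bounded_bilinear.zero_right[OF bounded_bilinear_E]

text \<open>The bound 1/2 is what \<open>ex_inverse_near_id\<close> requires for \<open>S x\<close>
  to be invertible.\<close>

definition rad :: real where
  "rad = (SOME r. r > 0 \<and> (\<forall>x\<in>ball 0 r. norm (E x x) \<le> 1/2))"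

definition M :: "'v set" where
  "M = ball 0 rad"

lemma rad: "rad > 0" and norm_E: "x \<in> M \<Longrightarrow> norm (E x x) \<le> 1/2"
proof -
  obtain K where K: "K > 0" "\<And>a b. norm (E a b) \<le> norm a * norm b * K"
    using bounded_bilinear.pos_bounded[OF bounded_bilinear_E] by blast
  have "norm (E x x) \<le> 1/2" if "x \<in> ball 0 (min 1 (1 / (2 * K)))" for x
  proof -
    have x: "norm x \<le> 1" "norm x \<le> 1 / (2 * K)" using that by auto
    have "norm (E x x) \<le> norm x * norm x * K" by (rule K)
    also have "\<dots> \<le> 1 * (1 / (2 * K)) * K" using x K(1) by (intro mult_mono) auto
    finally show ?thesis using K(1) by simp
  qed
  then have "\<exists>r. r > 0 \<and> (\<forall>x\<in>ball 0 r. norm (E x x) \<le> 1/2)"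
    using K(1) by (intro exI[of _ "min 1 (1 / (2 * K))"]) auto
  from someI_ex[OF this] show "rad > 0" "x \<in> M \<Longrightarrow> norm (E x x) \<le> 1/2"
    unfolding rad_def[symmetric] by (auto simp: M_def)
qed

lemma open_M: "open M" and zero_M: "0 \<in> M"
  using rad by (auto simp: M_def)

definition S :: "'v \<Rightarrow> 'v \<Rightarrow>\<^sub>L 'v" where
  "S x = id_blinfun + E x x"

text \<open>The norm bound is chosen along with the inverse: it is the uniform bound required for
  differentiating \<open>Sinv\<close>.\<close>

definition Sinv :: "'v \<Rightarrow> 'v \<Rightarrow>\<^sub>L 'v" where
  "Sinv x = (SOME C. C o\<^sub>L S x = id_blinfun \<and> S x o\<^sub>L C = id_blinfun \<and> norm C \<le> 2)"

lemma S_apply: "S x v = v + E x x v"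
  by (simp add: S_def blinfun.add_left)

lemma S_0: "S 0 v = v"
  by (simp add: S_apply E_simps)

lemma Sinv:
  assumes "x \<in> M"
  shows "Sinv x o\<^sub>L S x = id_blinfun" "S x o\<^sub>L Sinv x = id_blinfun" "norm (Sinv x) \<le> 2"
  using someI_ex[OF ex_inverse_near_id[OF norm_E[OF assms]]]
  unfolding Sinv_def S_def by blast+

lemma Sinv_S: "x \<in> M \<Longrightarrow> Sinv x (S x v) = v" "x \<in> M \<Longrightarrow> S x (Sinv x v) = v"
  using Sinv by (metis blinfun_apply_blinfun_compose blinfun_apply_id_blinfun id_apply)+

lemma Sinv_0: "Sinv 0 v = v"
  using Sinv_S(1)[OF zero_M, of v] by (simp add: S_0)

lemma S_self_adjoint: "g (S x u) v = g u (S x v)"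
  by (simp add: S_apply g_simps E_self_adjoint)

lemma S_L: "S x (L v) = L (S x v)"
  by (simp add: S_apply E_L L_simps)

lemma Sinv_L:
  assumes "x \<in> M"
  shows "Sinv x (L v) = L (Sinv x v)"
  by (metis assms S_L Sinv_S)

text \<open>Koszul's formula for \<open>S x (S x (\<Gamma> u v))\<close>. The two subtracted terms
  come from the derivative of the metric in the direction of the test vector; symmetry of
  \<open>F\<close> under exchange of its pairs is what turns them into vectors independent of
  it.\<close>

definition N :: "'v \<Rightarrow> 'v \<Rightarrow> 'v \<Rightarrow> 'v" where
  "N x u v = E x u (S x v) + S x (E x u v) + E x v (S x u) + S x (E x v u)
    - E u (S x v) x - E (S x u) v x"

text \<open>The Christoffel symbols of \<open>hm\<close>.\<close>

definition G :: "'v \<Rightarrow> 'v \<Rightarrow> 'v \<Rightarrow> 'v" where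
  "G x u v = Sinv x (Sinv x (N x u v))"

definition hm :: "'v \<Rightarrow> 'v \<Rightarrow> 'v \<Rightarrow> real" where
  "hm x u v = g (S x u) (S x v)"

lemma N_sym: "N x u v = N x v u"
  by (simp add: N_def E_sym[of u] E_sym[of _ v])

lemma G_sym: "G x u v = G x v u"
  by (simp add: G_def N_sym[of x u])

lemma bilinear_N: "bilinear (N x)"
  unfolding bilinear_def N_def
  by (auto intro!: linearI simp: E_simps blinfun.add_right blinfun.add_left blinfun.scaleR_left
      blinfun.scaleR_right scaleR_add_right scaleR_diff_right)

lemma bilinear_G: "bilinear (G x)"
  unfolding bilinear_def G_def
  by (auto intro!: linearI simp: blinfun.add_right blinfun.scaleR_right
      bilinear_ladd[OF bilinear_N] bilinear_radd[OF bilinear_N] bilinear_lmul[OF bilinear_N] bilinear_rmul[OF bilinear_N])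

text \<open>In the subtracted terms \<open>v\<close> stands in a slot of \<open>E\<close> and not in
  its operand, so here the exchange of \<open>L\<close> between all slots of \<open>F\<close> is
  essential. The consequence is that \<open>L\<close> is parallel.\<close>

lemma N_L: "N x u (L v) = L (N x u v)"
  by (simp add: N_def S_L E_L L_simps)

lemma G_L:
  assumes "x \<in> M"
  shows "G x u (L v) = L (G x u v)"
  by (simp add: G_def N_L Sinv_L[OF assms])

lemma G_0: "G 0 u v = 0"
  by (simp add: G_def N_def E_simps blinfun.zero_left blinfun.zero_right)

lemma hm_0: "hm 0 u v = g u v"
  by (simp add: hm_def S_0)

lemma hm_sym: "hm x u v = hm x v u"
  by (simp add: hm_def sym_g)

lemma bilinear_hm: "bilinear (hm x)"
  unfolding bilinear_def hm_def
  by (auto intro!: linearI simp: g_simps blinfun.add_right blinfun.scaleR_right)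

lemma hm_nondegenerate:
  assumes "x \<in> M" "\<And>v. hm x u v = 0"
  shows "u = 0"
proof -
  have "S x u = 0"
    using assms(2)[of "Sinv x w" for w] by (intro nondeg_g) (simp add: hm_def Sinv_S[OF assms(1)])
  then show ?thesis using Sinv_S(1)[OF assms(1), of u] by (simp add: blinfun.zero_right)
qed

text \<open>Metric compatibility in algebraic form: the right side is the derivative of
  \<open>hm\<close> in direction \<open>w\<close>. All terms in other directions cancel by symmetry
  of \<open>F\<close>.\<close>

lemma hm_G:
  assumes "x \<in> M"
  shows "hm x (G x w u) v + hm x u (G x w v) = 2 * g (E x w u) (S x v) + 2 * g (S x u) (E x w v)"
proof -
  have *: "hm x (G x w u) v = g (N x w u) v" for u v
    unfolding hm_def G_def by (simp add: S_self_adjoint[symmetric] Sinv_S[OF assms])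
  have F1: "F a b c d = F b a c d" "F a b c d = F a b d c" "F a b c d = F c d a b" for a b c d
    using tensor_sym[OF tensor] by blast+
  have gS: "g (S x a) b = g a (S x b)" for a b by (rule S_self_adjoint)
  have "g (N x w u) v = F x w (S x u) v + F x w u (S x v) + F x u (S x w) v + F x u w (S x v)
      - F w (S x u) x v - F (S x w) u x v" for u v
    by (simp add: N_def g_simps g_E gS)
  moreover have "F w (S x v) x u = F x u w (S x v)" "F (S x w) v x u = F x u (S x w) v"
     "F w (S x u) x v = F x v w (S x u)" "F (S x w) u x v = F x v (S x w) u"
    using F1(3) by auto
  moreover have "hm x u (G x w v) = g (N x w v) u" using * hm_sym by simp
  moreover have "F x w (S x v) u = F x w u (S x v)" "F x w v (S x u) = F x w (S x u) v" using F1(2) by auto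
  ultimately show ?thesis by (simp add: * g_E sym_g[of "S x u"])
qed

lemma S_has_derivative: "(S has_derivative (\<lambda>w. 2 *\<^sub>R E x w)) (at x within A)"
proof -
  have "(S has_derivative (\<lambda>w. 0 + (E x w + E w x))) (at x within A)"
    unfolding S_def[abs_def]
    by (intro has_derivative_add has_derivative_const bounded_bilinear.FDERIV[OF bounded_bilinear_E] has_derivative_ident)
  then show ?thesis by (simp add: E_sym[of _ x] scaleR_2)
qed

lemma hm_has_derivative:
  assumes "x \<in> M"
  shows "((\<lambda>x. hm x u v) has_derivative (\<lambda>w. hm x (G x w u) v + hm x u (G x w v))) (at x)"
proof -
  have d: "((\<lambda>x. S x u) has_derivative (\<lambda>w. 2 *\<^sub>R E x w u)) (at x)" for u
    using bounded_linear.has_derivative[OF blinfun.bounded_linear_left S_has_derivative]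
    by (simp add: blinfun.scaleR_left)
  have "((\<lambda>x. hm x u v) has_derivative (\<lambda>w. g (S x u) (2 *\<^sub>R E x w v) + g (2 *\<^sub>R E x w u) (S x v))) (at x)"
    unfolding hm_def by (rule bounded_bilinear.FDERIV[OF bounded_bilinear_g d d])
  moreover have "(\<lambda>w. g (S x u) (2 *\<^sub>R E x w v) + g (2 *\<^sub>R E x w u) (S x v)) =
      (\<lambda>w. hm x (G x w u) v + hm x u (G x w v))"
    by (rule ext) (simp only: hm_G[OF assms], simp add: g_simps)
  ultimately show ?thesis by simp
qed

lemma Ck_on_E: "Ck_on k M f \<Longrightarrow> Ck_on k M h \<Longrightarrow> Ck_on k M (\<lambda>x. E (f x) (h x))"
  by (rule bounded_bilinear.Ck_on_prod[OF bounded_bilinear_E open_M])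

lemma Ck_on_apply:
  fixes f :: "'v \<Rightarrow> 'v \<Rightarrow>\<^sub>L 'v"
  shows "Ck_on k M f \<Longrightarrow> Ck_on k M h \<Longrightarrow> Ck_on k M (\<lambda>x. f x (h x))"
  by (rule bounded_bilinear.Ck_on_prod[OF bounded_bilinear_blinfun_apply open_M])

lemma Ck_on_ident: "Ck_on k M (\<lambda>x. x)"
  by (rule Ck_on_bounded_linear[OF bounded_linear_ident])

lemma Ck_on_S: "Ck_on k M S"
  unfolding S_def[abs_def] by (intro Ck_on_add open_M Ck_on_const Ck_on_E Ck_on_ident)

lemma Sinv_has_derivative:
  assumes "x \<in> M"
  shows "(Sinv has_derivative (\<lambda>w. - (Sinv x o\<^sub>L ((2 *\<^sub>R E x w) o\<^sub>L Sinv x)))) (at x)"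
  by (rule has_derivative_inverse_blinfun[OF open_M assms Sinv S_has_derivative])

text \<open>The derivative of \<open>Sinv\<close> is a polynomial expression in \<open>Sinv\<close>
  and \<open>E\<close>, so each order of regularity yields the next.\<close>

lemma Ck_on_Sinv: "Ck_on k M Sinv"
proof (induction k)
  case 0
  show ?case by (auto intro!: continuous_at_imp_continuous_on has_derivative_continuous[OF Sinv_has_derivative])
next
  case (Suc k)
  show ?case
    by (rule Ck_on_SucI[OF open_M Sinv_has_derivative], assumption)
       (intro Ck_on_minus open_M bounded_bilinear.Ck_on_prod[OF bounded_bilinear_blinfun_compose]
         Suc Ck_on_compose_bounded_linear[OF open_M bounded_linear_scaleR_right] Ck_on_E Ck_on_ident Ck_on_const)
qed

lemma Ck_on_G: "Ck_on k M (\<lambda>x. G x u v)"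
  unfolding G_def N_def
  by (intro Ck_on_apply Ck_on_Sinv Ck_on_add Ck_on_diff open_M Ck_on_S Ck_on_E Ck_on_ident Ck_on_const)

lemma Ck_on_hm: "Ck_on k M (\<lambda>x. hm x u v)"
  unfolding hm_def
  by (intro bounded_bilinear.Ck_on_prod[OF bounded_bilinear_g open_M] Ck_on_apply Ck_on_S Ck_on_const)

definition GG :: "'v \<Rightarrow> 'v \<Rightarrow>\<^sub>L 'v \<Rightarrow>\<^sub>L 'v" where
  "GG x = Blinfun (\<lambda>u. Blinfun (G x u))"

lemma GG_apply: "GG x u v = G x u v"
proof -
  have 1: "bounded_linear (G x u)" for u
    using bilinear_G by (intro bounded_linear_finite_dim) (simp add: bilinear_def)
  have "bounded_linear (\<lambda>u. Blinfun (G x u))"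
    by (intro bounded_linear_finite_dim linearI blinfun_eqI)
       (simp_all add: bounded_linear_Blinfun_apply[OF 1] blinfun.add_left blinfun.scaleR_left
          bilinear_ladd[OF bilinear_G] bilinear_lmul[OF bilinear_G])
  then show ?thesis by (simp add: GG_def bounded_linear_Blinfun_apply 1)
qed

lemma Ck_on_GG: "Ck_on k M GG"
  by (intro Ck_on_blinfunI open_M) (simp add: GG_apply Ck_on_G)

lemma continuous_on_GG: "continuous_on M GG"
  using Ck_on_GG[of 0] by simp

end

section \<open>Adjoints\<close>

context self_adjoint
begin

definition adj :: "('v \<Rightarrow>\<^sub>L 'v) \<Rightarrow> 'v \<Rightarrow>\<^sub>L 'v" where
  "adj A = op_of (\<lambda>u v. g u (A v))"

lemma adj: "g (adj A u) v = g u (A v)"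
  unfolding adj_def
  by (subst op_of) (auto simp: bilinear_def g_simps blinfun.add_right blinfun.scaleR_right intro!: linearI)

lemma bounded_linear_adj: "bounded_linear adj"
  by (intro bounded_linear_of_blinfun linearI blinfun_eqI g_eqI)
     (simp_all add: adj g_simps blinfun.add_left blinfun.scaleR_left)

lemma adj_id: "adj id_blinfun = id_blinfun"
  by (intro blinfun_eqI g_eqI) (simp add: adj)

text \<open>Preserving a nondegenerate form forces injectivity, and dimension gives
  bijectivity.\<close>

lemma centraliserI:
  fixes A :: "'v \<Rightarrow>\<^sub>L 'v"
  assumes "\<And>u v. g (A u) (A v) = g u v" "\<And>v. A (L v) = L (blinfun_apply A v)"
  shows "A \<in> centraliser g L"
proof -
  have lin: "linear (blinfun_apply A)" by (simp add: blinfun.bounded_linear_right bounded_linear.linear)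
  have *: "x = 0" if "A x = 0" for x
    using assms(1)[of x] that by (intro nondeg_g) (simp add: g_simps)
  then have "A ` UNIV = UNIV"
    by (intro inj_imp_onto_subspace lin) auto
  then have "bij (blinfun_apply A)" using * linear_injective_0[OF lin] by (auto simp: bij_def)
  then show ?thesis using assms by (auto simp: centraliser_def orthogonal_group_def)
qed

lemma centraliserD:
  assumes "A \<in> centraliser g L"
  shows "g (A u) (A v) = g u v" "A (L v) = L (A v)" "surj (blinfun_apply A)"
  using assms by (auto simp: centraliser_def orthogonal_group_def bij_def fun_eq_iff)

lemma adj_inverse:
  assumes "A \<in> centraliser g L"
  shows "adj A (A v) = v" "A (adj A v) = v"
proof -
  show *: "adj A (A v) = v" for v
    by (rule g_eqI) (simp add: adj centraliserD[OF assms])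
  obtain w where "v = A w" using centraliserD(3)[OF assms] by (metis surjD)
  then show "A (adj A v) = v" by (simp add: *)
qed

lemma adj_centraliser:
  assumes "A \<in> centraliser g L"
  shows "adj A \<in> centraliser g L"
proof (rule centraliserI)
  show "g (adj A u) (adj A v) = g u v" for u v
    by (simp add: adj adj_inverse[OF assms])
  show "adj A (L v) = L (adj A v)" for v
    by (rule g_eqI) (simp add: adj sym_L centraliserD[OF assms])
qed

lemma compose_centraliser: "A \<in> centraliser g L \<Longrightarrow> C \<in> centraliser g L \<Longrightarrow> (A o\<^sub>L C) \<in> centraliser g L"
  by (rule centraliserI) (simp_all add: centraliserD)

text \<open>On the centraliser \<open>adj A\<close> is the inverse of \<open>A\<close>, so this is
  \<open>(A - A^-1)/2\<close>, the hyperbolic sine of a logarithm. It is linear, maps the group into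
  its Lie algebra and serves as a chart near the identity.\<close>

definition skew_part :: "('v \<Rightarrow>\<^sub>L 'v) \<Rightarrow> 'v \<Rightarrow>\<^sub>L 'v" where
  "skew_part A = (1/2) *\<^sub>R (A - adj A)"

lemma bounded_linear_skew_part: "bounded_linear skew_part"
  unfolding skew_part_def[abs_def]
  by (intro bounded_linear_compose[OF bounded_linear_scaleR_right] bounded_linear_sub
      bounded_linear_ident bounded_linear_adj)

lemma skew_part_skew:
  assumes "X \<in> skew_centraliser"
  shows "skew_part X = X"
proof -
  have "adj X = - X"
    using assms by (intro blinfun_eqI g_eqI) (simp add: adj g_simps blinfun.minus_left skew_centraliser_def)
  then show ?thesis by (simp add: skew_part_def scaleR_2[symmetric])
qed

lemma skew_part_centraliser:
  assumes "A \<in> centraliser g L"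
  shows "skew_part A \<in> skew_centraliser"
  unfolding skew_centraliser_def mem_Collect_eq
proof (intro conjI allI)
  have *: "g u (adj A v) = g (A u) v" for u v
    using adj[of A v u] sym_g[of u "adj A v"] sym_g[of v "A u"] by simp
  show "g (skew_part A u) v = - g u (skew_part A v)" for u v
    by (simp add: skew_part_def blinfun.scaleR_left blinfun.diff_left g_simps adj *)
  show "skew_part A (L v) = L (skew_part A v)" for v
    using centraliserD(2)[OF assms] centraliserD(2)[OF adj_centraliser[OF assms]]
    by (simp add: skew_part_def blinfun.scaleR_left blinfun.diff_left L_simps)
qed

lemma skew_centraliser_closed:
  "closed skew_centraliser" "0 \<in> skew_centraliser"
  "X \<in> skew_centraliser \<Longrightarrow> Y \<in> skew_centraliser \<Longrightarrow> X + Y \<in> skew_centraliser"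
  "X \<in> skew_centraliser \<Longrightarrow> r *\<^sub>R X \<in> skew_centraliser"
proof -
  have bg: "bounded_linear (g u)" "bounded_linear (\<lambda>u. g u v)" for u v
    using bounded_linear_finite_dim linear_g by auto
  have eq: "skew_centraliser = (\<Inter>u v. {X. g (blinfun_apply X u) v = - g u (X v)}) \<inter> (\<Inter>v. {X. blinfun_apply X (L v) = L (blinfun_apply X v)})"
    by (auto simp: skew_centraliser_def)
  show "closed skew_centraliser" unfolding eq
    by (intro closed_Int closed_INT closed_Collect_eq ballI continuous_intros
        bounded_linear.continuous_on[OF bg(1)] bounded_linear.continuous_on[OF bg(2)]
        bounded_linear.continuous_on[OF bounded_linear_finite_dim[OF lin_L]])
  show "0 \<in> skew_centraliser" by (simp add: skew_centraliser_def g_simps L_simps)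
  show "X \<in> skew_centraliser \<Longrightarrow> Y \<in> skew_centraliser \<Longrightarrow> X + Y \<in> skew_centraliser"
    by (simp add: skew_centraliser_def g_simps L_simps blinfun.add_left)
  show "X \<in> skew_centraliser \<Longrightarrow> r *\<^sub>R X \<in> skew_centraliser"
    by (simp add: skew_centraliser_def g_simps L_simps blinfun.scaleR_left)
qed

text \<open>If the skew parts of \<open>A, C\<close> agree, then \<open>A - C = A\<^sup>-\<^sup>1 - C\<^sup>-\<^sup>1 = - A\<^sup>-\<^sup>1 (A - C) C\<^sup>-\<^sup>1\<close>, which is close to \<open>- (A - C)\<close>.\<close>

lemma skew_part_inj:
  obtains \<eta> where "\<eta> > 0" "\<And>A C. A \<in> centraliser g L \<Longrightarrow> C \<in> centraliser g L \<Longrightarrow>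
    norm (A - id_blinfun) \<le> \<eta> \<Longrightarrow> norm (C - id_blinfun) \<le> \<eta> \<Longrightarrow> skew_part A = skew_part C \<Longrightarrow> A = C"
proof -
  obtain K where K: "K > 0" "\<And>A. norm (adj A) \<le> norm A * K"
    using bounded_linear.pos_bounded[OF bounded_linear_adj] by blast
  have near: "norm (adj A - id_blinfun) \<le> 1/4" if "norm (A - id_blinfun) \<le> 1 / (4 * K)" for A
  proof -
    have "adj A - id_blinfun = adj (A - id_blinfun)"
      by (simp add: bounded_linear.linear[OF bounded_linear_adj] linear_diff adj_id)
    then have "norm (adj A - id_blinfun) \<le> norm (A - id_blinfun) * K" using K(2) by metis
    also have "\<dots> \<le> 1 / (4 * K) * K" using that K(1) by (intro mult_right_mono) auto
    finally show ?thesis using K(1) by simp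
  qed
  show thesis
  proof (rule that)
    show "1 / (4 * K) > 0" using K(1) by simp
    fix A C assume A: "A \<in> centraliser g L" "norm (A - id_blinfun) \<le> 1 / (4 * K)"
      and C: "C \<in> centraliser g L" "norm (C - id_blinfun) \<le> 1 / (4 * K)" and eq: "skew_part A = skew_part C"
    define D where "D = A - C"
    define P where "P = adj A - id_blinfun"
    define Q where "Q = adj C - id_blinfun"
    have PQ: "norm P \<le> 1/4" "norm Q \<le> 1/4" unfolding P_def Q_def using near A C by auto
    have "A - adj A = C - adj C"
      using eq by (simp add: skew_part_def)
    then have "D = adj A - adj C" by (simp add: D_def algebra_simps)
    also have "\<dots> = - (adj A o\<^sub>L (D o\<^sub>L adj C))"
      by (rule blinfun_eqI)
         (simp add: D_def blinfun.diff_left blinfun.diff_right blinfun.minus_left adj_inverse A C)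
    also have "\<dots> = - (D + (D o\<^sub>L Q) + (P o\<^sub>L (D + (D o\<^sub>L Q))))"
      by (rule blinfun_eqI)
         (simp add: P_def Q_def blinfun.diff_left blinfun.diff_right blinfun.add_left blinfun.add_right blinfun.minus_left)
    \<comment> \<open>The right side has norm at most 3/4 of \<open>norm D\<close>, the left side
      has norm \<open>2 * norm D\<close>; hence \<open>D = 0\<close>.\<close>
    finally have D2: "2 *\<^sub>R D = - ((D o\<^sub>L Q) + (P o\<^sub>L (D + (D o\<^sub>L Q))))"
      unfolding eq_neg_iff_add_eq_0 by (simp add: scaleR_2 add.assoc)
    have n1: "norm (D o\<^sub>L Q) \<le> norm D * (1/4)"
      by (rule order_trans[OF norm_blinfun_compose]) (rule mult_left_mono[OF PQ(2) norm_ge_zero])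
    then have n2: "norm (D + (D o\<^sub>L Q)) \<le> 2 * norm D"
      using norm_triangle_ineq[of D "D o\<^sub>L Q"] norm_ge_zero[of D] by linarith
    have "norm (P o\<^sub>L (D + (D o\<^sub>L Q))) \<le> 1/4 * (2 * norm D)"
      by (rule order_trans[OF norm_blinfun_compose]) (intro mult_mono PQ n2; simp)
    then have "norm (2 *\<^sub>R D) \<le> norm D * (1/4) + 1/4 * (2 * norm D)"
      unfolding D2 norm_minus_cancel using n1 norm_triangle_ineq[of "D o\<^sub>L Q"] by (smt (verit))
    then have "norm D = 0" using norm_ge_zero[of D] by simp
    then show "A = C" by (simp add: D_def)
  qed
qed

end

section \<open>Linear differential equations\<close>

lemma integral_norm_le_except_finite:
  fixes f :: "real \<Rightarrow> 'a::banach"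
  assumes "(f has_integral i) {a..b}" "(h has_integral j) {a..b}" "finite X"
    and "\<And>t. t \<in> {a..b} - X \<Longrightarrow> norm (f t) \<le> h t"
  shows "norm i \<le> j"
proof -
  define f' where "f' t = (if t \<in> X then 0 else f t)" for t
  define h' where "h' t = (if t \<in> X then 0 else h t)" for t
  have "(f' has_integral i) {a..b}" "(h' has_integral j) {a..b}"
    by (rule has_integral_spike_finite[OF assms(3) _ assms(1)], simp add: f'_def)
       (rule has_integral_spike_finite[OF assms(3) _ assms(2)], simp add: h'_def)
  moreover from this have "norm (integral {a..b} f') \<le> integral {a..b} h'"
    using assms(4) by (intro integral_norm_bound_integral) (auto simp: f'_def h'_def)
  ultimately show ?thesis by (metis integral_unique)
qed

text \<open>Gronwall by iteration: integrating the bound \<open>C (k t)^n / n!\<close> gives the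
  same bound for \<open>n + 1\<close>, and it tends to 0. The finite set \<open>X\<close>
  accommodates the break points of piecewise curves.\<close>

lemma ode_zero:
  fixes f :: "real \<Rightarrow> 'a::banach"
  assumes cont: "continuous_on {0..1} f" and "finite X" and "f 0 = 0"
    and deriv: "\<And>t. t \<in> {0..1} - X \<Longrightarrow> (f has_vector_derivative f' t) (at t)"
    and bound: "\<And>t. t \<in> {0..1} - X \<Longrightarrow> norm (f' t) \<le> K * norm (f t)"
    and "t \<in> {0..1}"
  shows "f t = 0"
proof -
  define k where "k = max K 0"
  have k: "k \<ge> 0" "norm (f' t) \<le> k * norm (f t)" if "t \<in> {0..1} - X" for t
    using bound[OF that] mult_right_mono[of K k "norm (f t)"] by (auto simp: k_def)
  have k0: "k \<ge> 0" by (simp add: k_def)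
  obtain C where C: "\<And>t. t \<in> {0..1} \<Longrightarrow> norm (f t) \<le> C"
    using compact_imp_bounded[OF compact_continuous_image[OF cont compact_Icc]]
    unfolding bounded_iff by blast
  have "norm (f t) \<le> C * (k * t) ^ n / fact n" if "t \<in> {0..1}" for n t
    using that
  proof (induction n arbitrary: t)
    case (Suc n)
    have "(f' has_integral (f t - f 0)) {0..t}"
      using Suc.prems by (intro fundamental_theorem_of_calculus_interior_strong[OF \<open>finite X\<close>] deriv
          continuous_on_subset[OF cont]) auto
    moreover have "((\<lambda>s. k * (C * (k * s) ^ n / fact n)) has_integral
        (C * (k * t) ^ Suc n / fact (Suc n) - C * (k * 0) ^ Suc n / fact (Suc n))) {0..t}"
    proof (rule fundamental_theorem_of_calculus)
      show "0 \<le> t" using Suc.prems by simp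
      fix s assume "s \<in> {0..t}"
      have "((\<lambda>s. (C / fact (Suc n)) * (k * s) ^ Suc n) has_real_derivative
          (C / fact (Suc n)) * (of_nat (Suc n) * (k * s) ^ n * k)) (at s within {0..t})"
        by (rule DERIV_cong[OF DERIV_cmult[OF DERIV_power_Suc[OF DERIV_cmult_Id]]]) simp
      also have "(C / fact (Suc n)) * (of_nat (Suc n) * (k * s) ^ n * k) = k * (C * (k * s) ^ n / fact n)"
        by (simp add: divide_simps del: of_nat_Suc)
      finally show "((\<lambda>s. C * (k * s) ^ Suc n / fact (Suc n)) has_vector_derivative
          k * (C * (k * s) ^ n / fact n)) (at s within {0..t})"
        by (simp add: has_real_derivative_iff_has_vector_derivative)
    qed
    ultimately have "norm (f t - f 0) \<le> C * (k * t) ^ Suc n / fact (Suc n) - C * (k * 0) ^ Suc n / fact (Suc n)"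
    proof (rule integral_norm_le_except_finite[OF _ _ \<open>finite X\<close>])
      fix s assume s: "s \<in> {0..t} - X"
      then have "s \<in> {0..1} - X" using Suc.prems by auto
      then show "norm (f' s) \<le> k * (C * (k * s) ^ n / fact n)"
        using k(2)[of s] mult_left_mono[OF Suc.IH[of s] k0] by auto
    qed
    then show ?case using \<open>f 0 = 0\<close> by simp
  qed (use C in simp)
  then have le: "norm (f t) \<le> C * ((k * t) ^ n / fact n)" for n using assms(6) by simp
  have "(\<lambda>n. C * ((k * t) ^ n / fact n)) \<longlonglongrightarrow> C * 0"
    using summable_LIMSEQ_zero[OF summable_exp[of "k * t"]]
    by (intro tendsto_mult_left) (simp add: field_simps)
  then have "norm (f t) \<le> C * 0" by (rule LIMSEQ_le_const) (use le in blast)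
  then show ?thesis by simp
qed

text \<open>The integral form of \<open>U' = - A U\<close> with \<open>U 0 = id\<close>; the sign is
  that of parallel transport.\<close>

definition solves_ode :: "(real \<Rightarrow> 'a::banach \<Rightarrow>\<^sub>L 'a) \<Rightarrow> (real \<Rightarrow> 'a \<Rightarrow>\<^sub>L 'a) \<Rightarrow> bool" where
  "solves_ode A U \<longleftrightarrow> continuous_on {0..1} U \<and>
     (\<forall>t\<in>{0..1}. U t = id_blinfun - integral {0..t} (\<lambda>s. (A s o\<^sub>L U s)))"

lemma continuous_on_blinfun_compose [continuous_intros]:
  "continuous_on S f \<Longrightarrow> continuous_on S h \<Longrightarrow> continuous_on S (\<lambda>x. f x o\<^sub>L h x)"
  by (rule bounded_bilinear.continuous_on[OF bounded_bilinear_blinfun_compose])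

lemma norm_integral_unit_le:
  fixes f :: "real \<Rightarrow> 'a::banach"
  assumes "continuous_on {0..1} f" "\<And>s. s \<in> {0..1} \<Longrightarrow> norm (f s) \<le> c" "t \<in> {0..1}"
  shows "norm (integral {0..t} f) \<le> c"
proof -
  have "norm (integral {0..t} f) \<le> c * (t - 0)"
    using assms by (intro integral_bound) (auto intro: continuous_on_subset)
  also have "\<dots> \<le> c" using order_trans[OF norm_ge_zero assms(2)[of 0]] assms(3)
    by (simp add: mult_left_le)
  finally show ?thesis .
qed

text \<open>The bound 1/2 makes the Picard map a contraction on the whole unit interval at
  once.\<close>

lemma ex_solves_ode:
  fixes A :: "real \<Rightarrow> 'a::banach \<Rightarrow>\<^sub>L 'a"
  assumes A: "continuous_on {0..1} A" "\<And>t. t \<in> {0..1} \<Longrightarrow> norm (A t) \<le> 1/2"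
  obtains U where "solves_ode A U"
proof -
  \<comment> \<open>Clamping the time extends the Picard map to functions on the whole line, so that
    it acts on the complete space of bounded continuous functions.\<close>
  define cl where "cl t = max 0 (min 1 t)" for t :: real
  have cl: "cl t \<in> {0..1}" "t \<in> {0..1} \<Longrightarrow> cl t = t" for t by (auto simp: cl_def)
  have cont_cl: "continuous_on UNIV cl" unfolding cl_def by (intro continuous_intros)
  define P where "P y t = id_blinfun - integral {0..cl t} (\<lambda>s. (A s o\<^sub>L apply_bcontfun y s))"
    for y :: "real \<Rightarrow>\<^sub>C 'a \<Rightarrow>\<^sub>L 'a" and t
  have cAy: "continuous_on {0..1} (\<lambda>s. (A s o\<^sub>L apply_bcontfun y s))" for y :: "real \<Rightarrow>\<^sub>C 'a \<Rightarrow>\<^sub>L 'a"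
    by (rule continuous_on_blinfun_compose[OF A(1) continuous_on_apply_bcontfun])
  have P: "P y \<in> bcontfun" for y
  proof -
    have "continuous_on {0..1} (\<lambda>u. integral {0..u} (\<lambda>s. (A s o\<^sub>L apply_bcontfun y s)))"
      by (intro indefinite_integral_continuous_1 integrable_continuous_interval cAy)
    then have c: "continuous_on {0..1} (\<lambda>u. id_blinfun - integral {0..u} (\<lambda>s. (A s o\<^sub>L apply_bcontfun y s)))"
      by (intro continuous_intros)
    have "continuous_on UNIV (P y)"
      unfolding P_def by (rule continuous_on_compose2[OF c cont_cl]) (use cl in auto)
    moreover have "bounded (range (P y))"
      unfolding P_def
      by (rule bounded_subset[OF compact_imp_bounded[OF compact_continuous_image[OF c compact_Icc]]])
         (use cl in auto)
    ultimately show ?thesis by (simp add: bcontfun_def)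
  qed
  define T where "T y = Bcontfun (P y)" for y
  have T: "apply_bcontfun (T y) t = P y t" for y t by (simp add: T_def Bcontfun_inverse[OF P])
  have "dist (T y) (T z) \<le> 1/2 * dist y z" for y z
  proof (rule dist_bound)
    fix t
    have "P y t - P z t = integral {0..cl t} (\<lambda>s. (A s o\<^sub>L apply_bcontfun z s))
        - integral {0..cl t} (\<lambda>s. (A s o\<^sub>L apply_bcontfun y s))" by (simp add: P_def)
    also have "\<dots> = integral {0..cl t} (\<lambda>s. (A s o\<^sub>L apply_bcontfun z s) - (A s o\<^sub>L apply_bcontfun y s))"
      using cl by (intro integral_diff[symmetric] integrable_continuous_interval continuous_on_subset[OF cAy]) auto
    also have "norm \<dots> \<le> 1/2 * dist y z"
    proof (rule norm_integral_unit_le)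
      fix s :: real assume s: "s \<in> {0..1}"
      have "norm ((A s o\<^sub>L apply_bcontfun z s) - (A s o\<^sub>L apply_bcontfun y s)) = norm (A s o\<^sub>L (apply_bcontfun z s - apply_bcontfun y s))"
        by (simp add: bounded_bilinear.diff_right[OF bounded_bilinear_blinfun_compose])
      also have "\<dots> \<le> norm (A s) * norm (apply_bcontfun z s - apply_bcontfun y s)" by (rule norm_blinfun_compose)
      also have "\<dots> \<le> 1/2 * dist y z"
        using dist_bounded[of y s z] by (intro mult_mono A(2) s) (auto simp: dist_norm norm_minus_commute)
      finally show "norm ((A s o\<^sub>L apply_bcontfun z s) - (A s o\<^sub>L apply_bcontfun y s)) \<le> 1/2 * dist y z" .
    qed (use cl in \<open>auto intro!: continuous_on_diff cAy\<close>)
    finally show "dist (apply_bcontfun (T y) t) (apply_bcontfun (T z) t) \<le> 1/2 * dist y z" by (simp add: T dist_norm)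
  qed
  then obtain y where y: "T y = y" using banach_fix_type[of "1/2" T] by auto
  have "apply_bcontfun y t = id_blinfun - integral {0..t} (\<lambda>s. (A s o\<^sub>L apply_bcontfun y s))" if "t \<in> {0..1}" for t
    using T[of y t] cl(2)[OF that] by (simp add: y P_def)
  moreover have "continuous_on {0..1} (apply_bcontfun y)" by (rule continuous_on_apply_bcontfun)
  ultimately show thesis by (intro that[of "apply_bcontfun y"]) (simp add: solves_ode_def)
qed

context
  fixes A :: "real \<Rightarrow> 'a::banach \<Rightarrow>\<^sub>L 'a" and U
  assumes A: "continuous_on {0..1} A" and U: "solves_ode A U"
begin

lemma solves_ode_continuous: "continuous_on {0..1} U" "continuous_on {0..1} (\<lambda>s. (A s o\<^sub>L U s))"
  using U A by (auto simp: solves_ode_def intro!: continuous_intros)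

lemma solves_ode_eq: "t \<in> {0..1} \<Longrightarrow> U t = id_blinfun - integral {0..t} (\<lambda>s. (A s o\<^sub>L U s))"
  using U by (simp add: solves_ode_def)

lemma solves_ode_0: "U 0 = id_blinfun"
  using solves_ode_eq[of 0] by simp

lemma solves_ode_derivative:
  assumes "t \<in> {0..1}"
  shows "(U has_vector_derivative - (A t o\<^sub>L U t)) (at t within {0..1})"
proof -
  have "((\<lambda>u. id_blinfun - integral {0..u} (\<lambda>s. (A s o\<^sub>L U s))) has_vector_derivative (0 - (A t o\<^sub>L U t))) (at t within {0..1})"
    by (intro has_vector_derivative_diff has_vector_derivative_const
        integral_has_vector_derivative solves_ode_continuous assms)
  then have "((\<lambda>u. id_blinfun - integral {0..u} (\<lambda>s. (A s o\<^sub>L U s))) has_vector_derivative - (A t o\<^sub>L U t)) (at t within {0..1})"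
    by simp
  then show ?thesis
    by (rule has_vector_derivative_transform[OF assms, rotated]) (rule solves_ode_eq)
qed

context
  fixes b :: real
  assumes b: "b \<le> 1/2" "\<And>t. t \<in> {0..1} \<Longrightarrow> norm (A t) \<le> b"
begin

lemma solves_ode_norm_le:
  assumes "t \<in> {0..1}"
  shows "norm (U t) \<le> 2" "norm (U t - id_blinfun) \<le> 2 * b"
proof -
  have b0: "0 \<le> b" using b(2)[of 0] norm_ge_zero[of "A 0"] by (simp add: order_trans del: norm_ge_zero)
  obtain m where m: "m \<in> {0..1}" "\<And>t. t \<in> {0..1} \<Longrightarrow> norm (U t) \<le> norm (U m)"
    using continuous_attains_sup[OF compact_Icc _ continuous_on_norm[OF solves_ode_continuous(1)]] by auto
  have AU: "norm ((A s o\<^sub>L U s)) \<le> b * norm (U m)" if "s \<in> {0..1}" for s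
    by (intro order_trans[OF norm_blinfun_compose] mult_mono b m that) (auto simp: b0)
  have le: "norm (U t - id_blinfun) \<le> b * norm (U m)" if "t \<in> {0..1}" for t
    using norm_integral_unit_le[OF solves_ode_continuous(2) AU that] by (simp add: solves_ode_eq[OF that])
  have "norm (U m) \<le> norm (U m - id_blinfun) + norm (id_blinfun :: 'a \<Rightarrow>\<^sub>L 'a)"
    by (metis diff_add_cancel norm_triangle_ineq)
  also have "\<dots> \<le> 1/2 * norm (U m) + 1"
    by (intro add_mono order_trans[OF le[OF m(1)]] mult_right_mono b norm_blinfun_id_le norm_ge_zero)
  finally have Um: "norm (U m) \<le> 2" by simp
  then show "norm (U t) \<le> 2" using m(2)[OF assms] by simp
  show "norm (U t - id_blinfun) \<le> 2 * b"
    using le[OF assms] mult_left_mono[OF Um b0] by simp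
qed

end

end

text \<open>Adding the integral of \<open>A\<close> removes the first-order term of the solution.
  What remains is of second order in \<open>A\<close>, so its variation carries the additional small
  factor \<open>b\<close>.\<close>

lemma solves_ode_lipschitz:
  fixes A1 A2 :: "real \<Rightarrow> 'a::banach \<Rightarrow>\<^sub>L 'a"
  assumes A: "continuous_on {0..1} A1" "continuous_on {0..1} A2"
    and U: "solves_ode A1 U1" "solves_ode A2 U2"
    and b: "b \<le> 1/2" "\<And>t. t \<in> {0..1} \<Longrightarrow> norm (A1 t) \<le> b" "\<And>t. t \<in> {0..1} \<Longrightarrow> norm (A2 t) \<le> b"
    and \<beta>: "\<And>t. t \<in> {0..1} \<Longrightarrow> norm (A1 t - A2 t) \<le> \<beta>"
  shows "norm ((U1 1 + integral {0..1} A1) - (U2 1 + integral {0..1} A2)) \<le> 6 * b * \<beta>"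
proof -
  note c1 = solves_ode_continuous[OF A(1) U(1)] and c2 = solves_ode_continuous[OF A(2) U(2)]
  have b0: "0 \<le> b" using b(2)[of 0] norm_ge_zero[of "A1 0"] by (simp add: order_trans del: norm_ge_zero)
  have \<beta>0: "0 \<le> \<beta>" using \<beta>[of 0] norm_ge_zero[of "A1 0 - A2 0"] by (simp add: order_trans del: norm_ge_zero)
  note bl = bounded_bilinear_blinfun_compose
  \<comment> \<open>At the time of largest difference the integral equation bounds that difference
    by \<open>2 \<beta>\<close> plus half of itself, hence by \<open>4 \<beta>\<close>.\<close>
  obtain m where m: "m \<in> {0..1}" "\<And>t. t \<in> {0..1} \<Longrightarrow> norm (U1 t - U2 t) \<le> norm (U1 m - U2 m)"
    using continuous_attains_sup[OF compact_Icc _ continuous_on_norm[OF continuous_on_diff[OF c1(1) c2(1)]]] by auto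
  have AU: "norm ((A1 s o\<^sub>L U1 s) - (A2 s o\<^sub>L U2 s)) \<le> \<beta> * 2 + b * norm (U1 m - U2 m)" if s: "s \<in> {0..1}" for s
  proof -
    have "(A1 s o\<^sub>L U1 s) - (A2 s o\<^sub>L U2 s) = ((A1 s - A2 s) o\<^sub>L U1 s) + (A2 s o\<^sub>L (U1 s - U2 s))"
      by (simp add: bounded_bilinear.diff_right[OF bl] bounded_bilinear.diff_left[OF bl])
    also have "norm \<dots> \<le> \<beta> * 2 + b * norm (U1 m - U2 m)"
      by (intro order_trans[OF norm_triangle_ineq] add_mono order_trans[OF norm_blinfun_compose] mult_mono \<beta> b m s
          solves_ode_norm_le(1)[OF A(1) U(1) b(1,2)] \<beta>0 b0 norm_ge_zero)
    finally show ?thesis .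
  qed
  have "U1 m - U2 m = integral {0..m} (\<lambda>s. (A2 s o\<^sub>L U2 s)) - integral {0..m} (\<lambda>s. (A1 s o\<^sub>L U1 s))"
    using solves_ode_eq[OF A(1) U(1) m(1)] solves_ode_eq[OF A(2) U(2) m(1)] by simp
  also have "\<dots> = - integral {0..m} (\<lambda>s. (A1 s o\<^sub>L U1 s) - (A2 s o\<^sub>L U2 s))"
    using m(1) by (subst integral_diff) (auto intro!: integrable_continuous_interval continuous_on_subset[OF c1(2)] continuous_on_subset[OF c2(2)])
  finally have "norm (U1 m - U2 m) \<le> \<beta> * 2 + b * norm (U1 m - U2 m)"
    using norm_integral_unit_le[OF continuous_on_diff[OF c1(2) c2(2)] AU m(1)] by simp
  also have "\<dots> \<le> \<beta> * 2 + 1/2 * norm (U1 m - U2 m)"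
    by (intro add_left_mono mult_right_mono b norm_ge_zero)
  finally have "norm (U1 m - U2 m) \<le> 4 * \<beta>" by simp
  then have \<Delta>: "norm (U1 t - U2 t) \<le> 4 * \<beta>" if "t \<in> {0..1}" for t using m(2)[OF that] by simp
  \<comment> \<open>The second-order remainder contains \<open>U - id\<close>, of size
    \<open>2 b\<close>. Its variation is at most \<open>2 b \<beta> + 4 b \<beta>\<close>, whence
    the 6.\<close>
  have r: "U 1 + integral {0..1} A = id_blinfun - integral {0..1} (\<lambda>s. A s o\<^sub>L (U s - id_blinfun))"
    if "continuous_on {0..1} A" "solves_ode A U" for A U :: "real \<Rightarrow> 'a \<Rightarrow>\<^sub>L 'a"
  proof -
    note c = solves_ode_continuous[OF that]
    have "integral {0..1} (\<lambda>s. A s o\<^sub>L (U s - id_blinfun)) = integral {0..1} (\<lambda>s. (A s o\<^sub>L U s) - A s)"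
      by (intro integral_cong blinfun_eqI) (simp add: blinfun.diff_left blinfun.diff_right)
    also have "\<dots> = integral {0..1} (\<lambda>s. (A s o\<^sub>L U s)) - integral {0..1} A"
      by (intro integral_diff integrable_continuous_interval c that)
    finally show ?thesis using solves_ode_eq[OF that, of 1] by simp
  qed
  have "norm ((A1 s o\<^sub>L (U1 s - id_blinfun)) - (A2 s o\<^sub>L (U2 s - id_blinfun))) \<le> \<beta> * (2 * b) + b * (4 * \<beta>)"
    if s: "s \<in> {0..1}" for s
  proof -
    have "(A1 s o\<^sub>L (U1 s - id_blinfun)) - (A2 s o\<^sub>L (U2 s - id_blinfun))
        = ((A1 s - A2 s) o\<^sub>L (U1 s - id_blinfun)) + (A2 s o\<^sub>L (U1 s - U2 s))"
      by (simp add: bounded_bilinear.diff_right[OF bl] bounded_bilinear.diff_left[OF bl])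
    also have "norm \<dots> \<le> \<beta> * (2 * b) + b * (4 * \<beta>)"
      by (intro order_trans[OF norm_triangle_ineq] add_mono order_trans[OF norm_blinfun_compose] mult_mono \<beta> b \<Delta> s
          solves_ode_norm_le(2)[OF A(1) U(1) b(1,2)] \<beta>0 b0 norm_ge_zero)
    finally show ?thesis .
  qed
  moreover have ci: "continuous_on {0..1} (\<lambda>s. (A1 s o\<^sub>L (U1 s - id_blinfun)))"
     "continuous_on {0..1} (\<lambda>s. (A2 s o\<^sub>L (U2 s - id_blinfun)))"
    by (intro continuous_intros A c1 c2)+
  ultimately have "norm (integral {0..1} (\<lambda>s. (A1 s o\<^sub>L (U1 s - id_blinfun)) - (A2 s o\<^sub>L (U2 s - id_blinfun))))
      \<le> \<beta> * (2 * b) + b * (4 * \<beta>)"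
    by (intro norm_integral_unit_le continuous_on_diff) auto
  moreover have "integral {0..1} (\<lambda>s. (A1 s o\<^sub>L (U1 s - id_blinfun)) - (A2 s o\<^sub>L (U2 s - id_blinfun)))
      = integral {0..1} (\<lambda>s. (A1 s o\<^sub>L (U1 s - id_blinfun))) - integral {0..1} (\<lambda>s. (A2 s o\<^sub>L (U2 s - id_blinfun)))"
    by (intro integral_diff integrable_continuous_interval ci)
  ultimately show ?thesis
    unfolding r[OF A(1) U(1)] r[OF A(2) U(2)] by (simp add: norm_minus_commute algebra_simps)
qed

section \<open>Trigonometric integrals\<close>

lemma has_integral_cos_int:
  fixes m :: int
  shows "((\<lambda>t. cos (2 * pi * of_int m * t)) has_integral (if m = 0 then 1 else 0)) {0..1}"
proof (cases "m = 0")
  case True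
  then show ?thesis using has_integral_const_real[of "1::real" 0 1] by simp
next
  case False
  have "((\<lambda>t. cos (2 * pi * of_int m * t)) has_integral
      (sin (2 * pi * of_int m * 1) / (2 * pi * of_int m) - sin (2 * pi * of_int m * 0) / (2 * pi * of_int m))) {0..1}"
    using False
    by (intro fundamental_theorem_of_calculus)
       (auto intro!: derivative_eq_intros simp: has_real_derivative_iff_has_vector_derivative[symmetric])
  moreover have "sin (2 * pi * of_int m * 1) = 0"
    using sin_int_2pin[of m] by (simp add: mult_ac)
  ultimately show ?thesis using False by simp
qed

lemma has_integral_sin_int:
  fixes m :: int
  shows "((\<lambda>t. sin (2 * pi * of_int m * t)) has_integral 0) {0..1}"
proof (cases "m = 0")
  case False
  have "((\<lambda>t. sin (2 * pi * of_int m * t)) has_integral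
      (- cos (2 * pi * of_int m * 1) / (2 * pi * of_int m) - - cos (2 * pi * of_int m * 0) / (2 * pi * of_int m))) {0..1}"
    using False
    by (intro fundamental_theorem_of_calculus)
       (auto intro!: derivative_eq_intros simp: has_real_derivative_iff_has_vector_derivative[symmetric])
  moreover have "cos (2 * pi * of_int m * 1) = 1"
    using cos_int_2pin[of m] by (simp add: mult_ac)
  ultimately show ?thesis by simp
qed simp

lemma trig_orthogonality:
  fixes j k :: nat
  defines "c \<equiv> \<lambda>k t. cos (2 * pi * real (Suc k) * t)" and "s \<equiv> \<lambda>k t. sin (2 * pi * real (Suc k) * t)"
  shows "((\<lambda>t. (c k t - 1) * s j t) has_integral 0) {0..1}"
    "((\<lambda>t. (c k t - 1) * c j t) has_integral (if k = j then 1/2 else 0)) {0..1}"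
    "((\<lambda>t. s k t * s j t) has_integral (if k = j then 1/2 else 0)) {0..1}"
    "((\<lambda>t. s k t * c j t) has_integral 0) {0..1}"
proof -
  define p where "p = int (Suc k) + int (Suc j)"
  define d where "d = int (Suc k) - int (Suc j)"
  define q where "q = int (Suc j)"
  have p0: "p \<noteq> 0" "q \<noteq> 0" and d0: "d = 0 \<longleftrightarrow> k = j" by (auto simp: p_def d_def q_def)
  define C where "C m t = cos (2 * pi * of_int m * t)" for m :: int and t :: real
  define Z where "Z m t = sin (2 * pi * of_int m * t)" for m :: int and t :: real
  have C: "(C m has_integral (if m = 0 then 1 else 0)) {0..1}" for m
    unfolding C_def[abs_def] by (rule has_integral_cos_int)
  have Z: "(Z m has_integral 0) {0..1}" for m
    unfolding Z_def[abs_def] by (rule has_integral_sin_int)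
  have arg: "2 * pi * of_int p * t = 2 * pi * real (Suc k) * t + 2 * pi * real (Suc j) * t"
    "2 * pi * of_int d * t = 2 * pi * real (Suc k) * t - 2 * pi * real (Suc j) * t"
    "2 * pi * of_int q * t = 2 * pi * real (Suc j) * t" for t
    by (simp_all add: p_def d_def q_def algebra_simps)
  have e1: "(c k t - 1) * s j t = 1/2 * Z p t - 1/2 * Z d t - Z q t" for t
    unfolding c_def s_def Z_def arg sin_add sin_diff by (simp add: algebra_simps)
  have e2: "(c k t - 1) * c j t = 1/2 * C p t + 1/2 * C d t - C q t" for t
    unfolding c_def s_def C_def arg cos_add cos_diff by (simp add: algebra_simps)
  have e3: "s k t * s j t = 1/2 * C d t - 1/2 * C p t" for t
    unfolding c_def s_def C_def arg cos_add cos_diff by (simp add: algebra_simps)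
  have e4: "s k t * c j t = 1/2 * Z p t + 1/2 * Z d t" for t
    unfolding c_def s_def Z_def arg sin_add sin_diff by (simp add: algebra_simps)
  show "((\<lambda>t. (c k t - 1) * s j t) has_integral 0) {0..1}"
    unfolding e1 using has_integral_diff[OF has_integral_diff[OF has_integral_mult_right[OF Z[of p], of "1/2"] has_integral_mult_right[OF Z[of d], of "1/2"]] Z[of q]]
    by simp
  show "((\<lambda>t. (c k t - 1) * c j t) has_integral (if k = j then 1/2 else 0)) {0..1}"
    unfolding e2 using has_integral_diff[OF has_integral_add[OF has_integral_mult_right[OF C[of p], of "1/2"] has_integral_mult_right[OF C[of d], of "1/2"]] C[of q]]
    by (cases "k = j") (simp_all add: p0 d0)
  show "((\<lambda>t. s k t * s j t) has_integral (if k = j then 1/2 else 0)) {0..1}"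
    unfolding e3 using has_integral_diff[OF has_integral_mult_right[OF C[of d], of "1/2"] has_integral_mult_right[OF C[of p], of "1/2"]]
    by (cases "k = j") (simp_all add: p0 d0)
  show "((\<lambda>t. s k t * c j t) has_integral 0) {0..1}"
    unfolding e4 using has_integral_add[OF has_integral_mult_right[OF Z[of p], of "1/2"] has_integral_mult_right[OF Z[of d], of "1/2"]]
    by simp
qed

text \<open>Subtracting 1 from the cosine makes the loop start and end at 0. Frequencies begin at 1,
  so this constant is orthogonal to every term of the velocity and leaves the area
  unaffected.\<close>

definition trig_loop :: "nat \<Rightarrow> (nat \<Rightarrow> 'a::real_normed_vector) \<Rightarrow> (nat \<Rightarrow> 'a) \<Rightarrow> real \<Rightarrow> 'a" where
  "trig_loop n a b t = (\<Sum>k<n. (cos (2 * pi * real (Suc k) * t) - 1) *\<^sub>R a k + sin (2 * pi * real (Suc k) * t) *\<^sub>R b k)"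

definition trig_loop' :: "nat \<Rightarrow> (nat \<Rightarrow> 'a::real_normed_vector) \<Rightarrow> (nat \<Rightarrow> 'a) \<Rightarrow> real \<Rightarrow> 'a" where
  "trig_loop' n a b t = (\<Sum>k<n. (2 * pi * real (Suc k)) *\<^sub>R
     (cos (2 * pi * real (Suc k) * t) *\<^sub>R b k - sin (2 * pi * real (Suc k) * t) *\<^sub>R a k))"

lemma trig_loop_ends: "trig_loop n a b 0 = 0" "trig_loop n a b 1 = 0"
proof -
  have "cos (2 * pi * real (Suc k)) = 1" "sin (2 * pi * real (Suc k)) = 0" for k
    using cos_int_2pin[of "int (Suc k)"] sin_int_2pin[of "int (Suc k)"] by simp_all
  then show "trig_loop n a b 0 = 0" "trig_loop n a b 1 = 0" by (simp_all add: trig_loop_def)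
qed

lemma trig_loop_derivative:
  "(trig_loop n a b has_vector_derivative trig_loop' n a b t) (at t within A)"
proof -
  have "((\<lambda>t. (cos (2 * pi * real (Suc k) * t) - 1) *\<^sub>R a k + sin (2 * pi * real (Suc k) * t) *\<^sub>R b k)
     has_vector_derivative (2 * pi * real (Suc k)) *\<^sub>R
     (cos (2 * pi * real (Suc k) * t) *\<^sub>R b k - sin (2 * pi * real (Suc k) * t) *\<^sub>R a k)) (at t within A)" for k
  proof -
    have "((\<lambda>t. (cos (2 * pi * real (Suc k) * t) - 1) *\<^sub>R a k + sin (2 * pi * real (Suc k) * t) *\<^sub>R b k)
      has_vector_derivative (- sin (2 * pi * real (Suc k) * t) * (2 * pi * real (Suc k))) *\<^sub>R a k
       + (cos (2 * pi * real (Suc k) * t) * (2 * pi * real (Suc k))) *\<^sub>R b k) (at t within A)"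
      by (intro has_vector_derivative_add bounded_linear.has_vector_derivative[OF bounded_linear_scaleR_left])
         (auto intro!: derivative_eq_intros simp: has_real_derivative_iff_has_vector_derivative[symmetric] simp del: of_nat_Suc)
    then show ?thesis by (simp add: algebra_simps del: of_nat_Suc)
  qed
  then show ?thesis
    unfolding trig_loop_def[abs_def] trig_loop'_def by (intro has_vector_derivative_sum)
qed

lemma continuous_on_trig_loop': "continuous_on A (trig_loop' n a b)"
  unfolding trig_loop'_def[abs_def] by (intro continuous_intros)

lemma continuous_on_trig_loop: "continuous_on A (trig_loop n a b)"
  unfolding trig_loop_def[abs_def] by (intro continuous_intros)

lemma trig_loop_diff:
  "trig_loop n a b t - trig_loop n a' b t = trig_loop n (\<lambda>k. a k - a' k) (\<lambda>_. 0) t"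
  "trig_loop' n a b t - trig_loop' n a' b t = trig_loop' n (\<lambda>k. a k - a' k) (\<lambda>_. 0) t"
  by (simp_all add: trig_loop_def trig_loop'_def sum_subtractf[symmetric] algebra_simps del: of_nat_Suc)

lemma norm_trig_loop_le:
  assumes "\<And>k. k < n \<Longrightarrow> norm (a k) \<le> A" "\<And>k. k < n \<Longrightarrow> norm (b k) \<le> B" "0 \<le> A" "0 \<le> B"
  shows "norm (trig_loop n a b t) \<le> 2 * real n * (A + B)"
    "norm (trig_loop' n a b t) \<le> 2 * pi * real n * real n * (A + B)"
proof -
  have "norm (trig_loop n a b t) \<le> (\<Sum>k<n. 2 * (A + B))"
    unfolding trig_loop_def
  proof (intro sum_norm_le)
    fix k assume "k \<in> {..<n}"
    then have k: "norm (a k) \<le> A" "norm (b k) \<le> B" using assms by auto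
    have c: "\<bar>cos x - 1\<bar> \<le> 2" "\<bar>sin x\<bar> \<le> 2" for x :: real
      using abs_cos_le_one[of x] abs_sin_le_one[of x] by linarith+
    have "norm ((cos x - 1) *\<^sub>R a k + sin x *\<^sub>R b k) \<le> 2 * A + 2 * B" for x :: real
      unfolding norm_scaleR[symmetric]
      by (intro order_trans[OF norm_triangle_ineq] add_mono) (simp_all add: mult_mono c k)
    then show "norm ((cos (2 * pi * real (Suc k) * t) - 1) *\<^sub>R a k + sin (2 * pi * real (Suc k) * t) *\<^sub>R b k) \<le> 2 * (A + B)"
      by (simp add: algebra_simps del: of_nat_Suc)
  qed
  then show "norm (trig_loop n a b t) \<le> 2 * real n * (A + B)" by (simp add: mult_ac)
  have "norm (trig_loop' n a b t) \<le> (\<Sum>k<n. 2 * pi * real n * (A + B))"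
    unfolding trig_loop'_def
  proof (intro sum_norm_le)
    fix k assume "k \<in> {..<n}"
    then have k: "norm (a k) \<le> A" "norm (b k) \<le> B" "real (Suc k) \<le> real n" using assms by auto
    have c: "\<bar>cos x\<bar> \<le> 1" "\<bar>sin x\<bar> \<le> 1" for x :: real by simp_all
    have "norm (cos x *\<^sub>R b k - sin x *\<^sub>R a k) \<le> 1 * B + 1 * A" for x :: real
      by (intro order_trans[OF norm_triangle_ineq4] add_mono; unfold norm_scaleR real_norm_def)
         (intro mult_mono c k; simp)+
    then show "norm ((2 * pi * real (Suc k)) *\<^sub>R
      (cos (2 * pi * real (Suc k) * t) *\<^sub>R b k - sin (2 * pi * real (Suc k) * t) *\<^sub>R a k)) \<le> 2 * pi * real n * (A + B)"
      unfolding norm_scaleR using k(3) assms(3,4)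
      by (intro mult_mono) (simp_all add: add.commute del: of_nat_Suc)
  qed
  then show "norm (trig_loop' n a b t) \<le> 2 * pi * real n * real n * (A + B)" by (simp add: mult_ac)
qed

text \<open>Fourier orthogonality decouples the frequencies, so the enclosed area is linear in \<open>a\<close>.\<close>

lemma trig_loop_area:
  fixes \<Omega> :: "'a::real_normed_vector \<Rightarrow> 'a \<Rightarrow> 'b::banach"
  assumes bil: "bounded_bilinear \<Omega>" and alt: "\<And>x y. \<Omega> x y = - \<Omega> y x"
  shows "((\<lambda>t. \<Omega> (trig_loop n a b t) (trig_loop' n a b t)) has_integral
    (\<Sum>k<n. (2 * pi * real (Suc k)) *\<^sub>R \<Omega> (a k) (b k))) {0..1}"
proof -
  interpret \<Omega>: bounded_bilinear \<Omega> by (rule bil)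
  define c where "c k t = cos (2 * pi * real (Suc k) * t)" for k and t :: real
  define s where "s k t = sin (2 * pi * real (Suc k) * t)" for k and t :: real
  define w where "w k = 2 * pi * real (Suc k)" for k
  have expand: "\<Omega> (trig_loop n a b t) (trig_loop' n a b t) = (\<Sum>k<n. \<Sum>j<n.
      (w j) *\<^sub>R (((c k t - 1) * c j t) *\<^sub>R \<Omega> (a k) (b j) - ((c k t - 1) * s j t) *\<^sub>R \<Omega> (a k) (a j)
       + (s k t * c j t) *\<^sub>R \<Omega> (b k) (b j) - (s k t * s j t) *\<^sub>R \<Omega> (b k) (a j)))" for t
  proof -
    have "\<Omega> (sum x {..<n}) (sum y {..<n}) = (\<Sum>k<n. \<Sum>j<n. \<Omega> (x k) (y j))" for x y
      by (simp only: \<Omega>.sum_left \<Omega>.sum_right) (rule sum.swap)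
    then have "\<Omega> (trig_loop n a b t) (trig_loop' n a b t) = (\<Sum>k<n. \<Sum>j<n.
      \<Omega> ((c k t - 1) *\<^sub>R a k + s k t *\<^sub>R b k) (w j *\<^sub>R (c j t *\<^sub>R b j - s j t *\<^sub>R a j)))"
      unfolding trig_loop_def trig_loop'_def c_def s_def w_def .
    also have "\<dots> = (\<Sum>k<n. \<Sum>j<n.
      (w j) *\<^sub>R (((c k t - 1) * c j t) *\<^sub>R \<Omega> (a k) (b j) - ((c k t - 1) * s j t) *\<^sub>R \<Omega> (a k) (a j)
       + (s k t * c j t) *\<^sub>R \<Omega> (b k) (b j) - (s k t * s j t) *\<^sub>R \<Omega> (b k) (a j)))"
      by (intro sum.cong refl)
         (simp add: \<Omega>.add_left \<Omega>.add_right \<Omega>.scaleR_left \<Omega>.scaleR_right \<Omega>.diff_right \<Omega>.diff_left algebra_simps)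
    finally show ?thesis .
  qed
  have "((\<lambda>t. \<Omega> (trig_loop n a b t) (trig_loop' n a b t)) has_integral (\<Sum>k<n. \<Sum>j<n.
      (w j) *\<^sub>R ((if k = j then 1/2 else 0) *\<^sub>R \<Omega> (a k) (b j) - 0 *\<^sub>R \<Omega> (a k) (a j)
       + 0 *\<^sub>R \<Omega> (b k) (b j) - (if k = j then 1/2 else 0) *\<^sub>R \<Omega> (b k) (a j)))) {0..1}"
    unfolding expand c_def s_def
    by (intro has_integral_sum finite_lessThan has_integral_cmul has_integral_add has_integral_diff
        has_integral_scaleR_left trig_orthogonality)
  also have "(\<Sum>k<n. \<Sum>j<n.
      (w j) *\<^sub>R ((if k = j then 1/2 else 0) *\<^sub>R \<Omega> (a k) (b j) - 0 *\<^sub>R \<Omega> (a k) (a j)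
       + 0 *\<^sub>R \<Omega> (b k) (b j) - (if k = j then 1/2 else 0) *\<^sub>R \<Omega> (b k) (a j)))
     = (\<Sum>k<n. \<Sum>j<n. if k = j then w k *\<^sub>R \<Omega> (a k) (b k) else 0)"
  proof (intro sum.cong refl)
    fix k j
    \<comment> \<open>Both mixed products integrate to 1/2, and alternation of
      \<open>\<Omega>\<close> lets them add up instead of cancelling.\<close>
    have "w k *\<^sub>R ((1/2) *\<^sub>R \<Omega> (a k) (b k) - (1/2) *\<^sub>R \<Omega> (b k) (a k)) = w k *\<^sub>R \<Omega> (a k) (b k)"
      using alt[of "b k" "a k"] by (simp add: scaleR_left_distrib[symmetric])
    then show "(w j) *\<^sub>R ((if k = j then 1/2 else 0) *\<^sub>R \<Omega> (a k) (b j) - 0 *\<^sub>R \<Omega> (a k) (a j)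
       + 0 *\<^sub>R \<Omega> (b k) (b j) - (if k = j then 1/2 else 0) *\<^sub>R \<Omega> (b k) (a j)) = (if k = j then w k *\<^sub>R \<Omega> (a k) (b k) else 0)"
      by (cases "k = j") auto
  qed
  also have "\<dots> = (\<Sum>k<n. w k *\<^sub>R \<Omega> (a k) (b k))" by simp
  finally show ?thesis by (simp add: w_def)
qed


section \<open>Subdivisions\<close>

lemma subdivision_pos: "subdivision n t \<Longrightarrow> n > 0"
  by (cases n) (auto simp: subdivision_def)

lemma subdivision_mono:
  assumes "subdivision n t" "i \<le> j" "j \<le> n"
  shows "t i \<le> t j"
  using assms(2,3)
proof (induction j rule: dec_induct)
  case (step j)
  then have "t j < t (Suc j)" using assms(1) by (auto simp: subdivision_def)
  with step show ?case by simp
qed simp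

lemma subdivision_range:
  assumes "subdivision n t" "i \<le> n"
  shows "0 \<le> t i" "t i \<le> 1"
  using subdivision_mono[OF assms(1), of 0 i] subdivision_mono[OF assms(1), of i n] assms
  by (auto simp: subdivision_def)

lemma subdivision_cover:
  assumes "subdivision n t"
  shows "(\<Union>i<n. {t i..t (Suc i)}) = {0..1}"
proof (intro equalityI subsetI)
  fix s assume "s \<in> (\<Union>i<n. {t i..t (Suc i)})"
  then obtain i where "i < n" "t i \<le> s" "s \<le> t (Suc i)" by auto
  then show "s \<in> {0..1}"
    using subdivision_range[OF assms, of i] subdivision_range[OF assms, of "Suc i"] by auto
next
  fix s :: real assume s: "s \<in> {0..1}"
  define j where "j = (LEAST j. s \<le> t j)"
  have "s \<le> t n" using s assms by (simp add: subdivision_def)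
  then have j: "s \<le> t j" "j \<le> n" "\<And>i. i < j \<Longrightarrow> t i < s"
    unfolding j_def by (auto intro: LeastI Least_le dest: not_less_Least)
  show "s \<in> (\<Union>i<n. {t i..t (Suc i)})"
  proof (cases j)
    case 0
    then have "s = t 0" using j s assms by (auto simp: subdivision_def)
    moreover have "t 0 < t (Suc 0)" "n > 0" using subdivision_pos[OF assms] assms by (auto simp: subdivision_def)
    ultimately show ?thesis by (intro UN_I[of 0]) auto
  next
    case (Suc i)
    then show ?thesis using j(1,2) j(3)[of i] by (intro UN_I[of i]) auto
  qed
qed

lemma subdivision_interior:
  assumes "subdivision n t" "s \<in> {0..1} - t ` {..n}"
  obtains i where "i < n" "s \<in> {t i<..<t (Suc i)}" "at s within {t i..t (Suc i)} = at s"
proof -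
  from assms(2) subdivision_cover[OF assms(1)] obtain i where i: "i < n" "s \<in> {t i..t (Suc i)}" by blast
  moreover have "s \<noteq> t i" "s \<noteq> t (Suc i)" using assms(2) i(1) by auto
  ultimately have "s \<in> {t i<..<t (Suc i)}" by auto
  moreover from this have "at s within {t i..t (Suc i)} = at s"
    by (intro at_within_interior) simp
  ultimately show thesis using that i(1) by blast
qed

lemma subdivision_continuous_on:
  assumes "subdivision n t" "\<And>i. i < n \<Longrightarrow> continuous_on {t i..t (Suc i)} f"
  shows "continuous_on {0..1} f"
  unfolding subdivision_cover[OF assms(1), symmetric]
  by (intro continuous_on_closed_Union) (use assms(2) in auto)

section \<open>The manifold\<close>

context quadratic_metric
begin

definition chart0 :: "('v, 'v) chart" where
  "chart0 = (M, \<lambda>x. x)"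

definition hh :: "'v \<Rightarrow> ('v, 'v) tangent \<Rightarrow> ('v, 'v) tangent \<Rightarrow> real" where
  "hh p \<xi> \<eta> = hm p (\<xi> chart0) (\<eta> chart0)"

text \<open>The atlas has \<open>chart0\<close> as its only chart, and a tangent vector must be 0 at
  every other index.\<close>

definition emb :: "'v \<Rightarrow> ('v, 'v) tangent" where
  "emb v = (\<lambda>c. if c = chart0 then v else 0)"

abbreviation Christoffel :: "('v, 'v) christoffel" where
  "Christoffel \<equiv> \<lambda>c. G"

lemma chart0_simps [simp]: "fst chart0 = M" "snd chart0 = (\<lambda>x. x)"
  by (simp_all add: chart0_def)

lemma emb_simps [simp]: "emb v chart0 = v" "c \<noteq> chart0 \<Longrightarrow> emb v c = 0"
  by (simp_all add: emb_def)

lemma emb_eq_iff: "\<xi> = emb v \<longleftrightarrow> \<xi> chart0 = v \<and> (\<forall>c. c \<noteq> chart0 \<longrightarrow> \<xi> c = 0)"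
  by (auto simp: emb_def fun_eq_iff simp del: split_paired_All)

lemma inj_emb: "inj emb"
  by (rule injI) (metis emb_simps(1))

lemma chart_inv_chart0: "y \<in> M \<Longrightarrow> chart_inv chart0 y = y"
  using inv_into_f_f[of "\<lambda>x. x" M y] by (simp add: chart_inv_def)

lemma transition_chart0: "y \<in> M \<Longrightarrow> transition chart0 chart0 y = y"
  by (simp add: transition_def chart_inv_chart0)

lemma frechet_derivative_transition:
  assumes "y \<in> M"
  shows "frechet_derivative (transition chart0 chart0) (at y) = (\<lambda>v. v)"
proof -
  have "(transition chart0 chart0 has_derivative (\<lambda>v. v)) (at y)"
    by (rule has_derivative_transform_within_open[OF has_derivative_ident open_M assms])
       (simp add: transition_chart0)
  from frechet_derivative_at[OF this] show ?thesis by simp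
qed

lemma charts_at_chart0: "p \<in> M \<Longrightarrow> charts_at {chart0} p = {chart0}"
  by (auto simp: charts_at_def)

lemma tangent_space_eq:
  assumes "p \<in> M"
  shows "tangent_space {chart0} p = range emb"
proof -
  have "tangent_space {chart0} p = {\<xi>. \<forall>c. c \<noteq> chart0 \<longrightarrow> \<xi> c = 0}"
    using assms
    by (auto simp: tangent_space_def charts_at_chart0 coord_change_def frechet_derivative_transition)
  then show ?thesis by (auto simp: emb_eq_iff image_iff)
qed

lemma tangent_vec_eq: "p \<in> M \<Longrightarrow> tangent_vec {chart0} p chart0 u = emb u"
  by (auto simp: tangent_vec_def charts_at_chart0 coord_change_def frechet_derivative_transition emb_def)

lemma metric_in_eq: "y \<in> M \<Longrightarrow> metric_in {chart0} hh chart0 y u v = hm y u v"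
  by (simp add: metric_in_def chart_inv_chart0 tangent_vec_eq hh_def)

lemma smooth_manifold_M: "smooth_manifold (top_of_set M) {chart0}"
proof -
  have "Ck_on k M (transition chart0 chart0)" for k
    by (rule Ck_on_cong[OF open_M _ Ck_on_ident]) (simp add: transition_chart0)
  then show ?thesis
    using homeomorphic_map_id[of "top_of_set M" "top_of_set M"]
    by (auto simp: smooth_manifold_def smooth_on_def second_countable_finite_dim id_def subtopology_subtopology
        intro!: Hausdorff_space_subtopology second_countable_subtopology open_M)
qed

lemma connected_space_M: "connected_space (top_of_set M)"
  by (simp add: connected_space_subtopology M_def)

lemma pseudo_riemannian_metric_M: "pseudo_riemannian_metric (top_of_set M) {chart0} hh"
  unfolding pseudo_riemannian_metric_def
proof (intro conjI ballI impI allI; (elim singletonE)?; simp)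
  fix p \<xi> \<eta>
  show "hh p \<xi> \<eta> = hh p \<eta> \<xi>" by (simp add: hh_def hm_sym)
next
  fix p \<xi> assume p: "p \<in> M" and \<xi>: "\<xi> \<in> tangent_space {chart0} p"
    and 0: "\<forall>\<eta>\<in>tangent_space {chart0} p. hh p \<xi> \<eta> = 0"
  obtain u where u: "\<xi> = emb u" using \<xi> by (auto simp: tangent_space_eq[OF p])
  have "hm p u v = 0" for v using 0 by (auto simp: tangent_space_eq[OF p] hh_def u)
  then have "u = 0" by (rule hm_nondegenerate[OF p])
  then show "\<xi> = (\<lambda>c. 0)" by (simp add: u emb_def)
next
  fix y assume y: "y \<in> M"
  have "metric_in {chart0} hh chart0 y = hm y" by (intro ext) (simp add: metric_in_eq y)
  then show "bilinear (metric_in {chart0} hh chart0 y)" by (simp add: bilinear_hm)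
next
  fix u v
  have "Ck_on k M (\<lambda>y. metric_in {chart0} hh chart0 y u v)" for k
    by (rule Ck_on_cong[OF open_M _ Ck_on_hm]) (simp add: metric_in_eq)
  then show "smooth_on M (\<lambda>y. metric_in {chart0} hh chart0 y u v)" by (simp add: smooth_on_def)
qed

lemma levi_civita_M: "levi_civita {chart0} hh Christoffel"
  unfolding levi_civita_def
proof (intro conjI)
  have "frechet_derivative (\<lambda>z. frechet_derivative (transition chart0 chart0) (at z) v) (at y) u = 0"
    if "y \<in> M" for y u v
  proof -
    have "((\<lambda>z. frechet_derivative (transition chart0 chart0) (at z) v) has_derivative (\<lambda>u. 0)) (at y)"
      by (rule has_derivative_transform_within_open[OF has_derivative_const open_M that])
         (simp add: frechet_derivative_transition)
    from frechet_derivative_at[OF this] show ?thesis by metis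
  qed
  then show "affine_connection {chart0} Christoffel"
    by (simp add: affine_connection_def bilinear_G smooth_on_def Ck_on_G frechet_derivative_transition
        transition_chart0 Let_def)
  show "torsion_free {chart0} Christoffel"
    unfolding torsion_free_def using G_sym by blast
  show "metric_compatible {chart0} hh Christoffel"
    unfolding metric_compatible_def
  proof (intro ballI allI; elim singletonE; simp)
    fix y u v w assume y: "y \<in> M"
    have "((\<lambda>z. metric_in {chart0} hh chart0 z u v) has_derivative
        (\<lambda>w. hm y (G y w u) v + hm y u (G y w v))) (at y)"
      by (rule has_derivative_transform_within_open[OF hm_has_derivative[OF y] open_M y])
         (simp add: metric_in_eq)
    from frechet_derivative_at[OF this]
    show "frechet_derivative (\<lambda>z. metric_in {chart0} hh chart0 z u v) (at y) w =
        metric_in {chart0} hh chart0 y (G y w u) v + metric_in {chart0} hh chart0 y u (G y w v)"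
      by (simp add: metric_in_eq y fun_eq_iff)
  qed
qed

lemma tangent_iso_emb: "tangent_iso {chart0} 0 emb"
proof -
  have "linear (\<lambda>v. emb v c)" for c
    by (cases "c = chart0") (auto simp: linear_zero linear_ident)
  then show ?thesis by (simp add: tangent_iso_def tangent_space_eq zero_M bij_betw_def inj_emb)
qed

lemma C1_arc_iff:
  "C1_arc (top_of_set M) {chart0} \<gamma> a b \<longleftrightarrow> (\<forall>t\<in>{a..b}. \<gamma> t \<in> M) \<and>
     (\<exists>\<gamma>'. (\<forall>t\<in>{a..b}. (\<gamma> has_vector_derivative \<gamma>' t) (at t within {a..b})) \<and> continuous_on {a..b} \<gamma>')"
  (is "?l \<longleftrightarrow> ?r")
proof
  assume l: ?l
  then have M: "\<forall>t\<in>{a..b}. \<gamma> t \<in> M" by (auto simp: C1_arc_def continuous_map_in_subtopology Pi_iff)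
  then have "{t \<in> {a..b}. \<gamma> t \<in> M} = {a..b}" by auto
  with l M show ?r by (auto simp: C1_arc_def o_def)
next
  assume r: ?r
  then obtain \<gamma>' where M: "\<forall>t\<in>{a..b}. \<gamma> t \<in> M" and
    \<gamma>': "\<And>t. t \<in> {a..b} \<Longrightarrow> (\<gamma> has_vector_derivative \<gamma>' t) (at t within {a..b})" "continuous_on {a..b} \<gamma>'" by blast
  have "{t \<in> {a..b}. \<gamma> t \<in> M} = {a..b}" using M by auto
  moreover have "continuous_on {a..b} \<gamma>"
    using \<gamma>'(1) has_vector_derivative_continuous continuous_on_eq_continuous_within by blast
  ultimately show ?l using M \<gamma>' by (auto simp: C1_arc_def o_def continuous_map_in_subtopology)
qed

lemma parallel_on_arc_iff:
  assumes "\<And>t. t \<in> {a..b} \<Longrightarrow> \<gamma> t \<in> M"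
  shows "parallel_on_arc {chart0} Christoffel \<gamma> \<xi> a b \<longleftrightarrow>
    (\<forall>t\<in>{a..b}. \<xi> t = emb (\<xi> t chart0) \<and>
       ((\<lambda>s. \<xi> s chart0) has_vector_derivative
         - G (\<gamma> t) (vector_derivative \<gamma> (at t within {a..b})) (\<xi> t chart0)) (at t within {a..b}))"
proof -
  have "\<eta> \<in> range emb \<longleftrightarrow> \<eta> = emb (\<eta> chart0)" for \<eta> by auto
  then show ?thesis using assms
    by (auto simp: parallel_on_arc_def tangent_space_eq charts_at_chart0 o_def)
qed

section \<open>Parallel transport\<close>

text \<open>Parallel fields along one curve may come with different subdivisions. Here and in
  \<open>transported\<close> only a finite exceptional set is kept, so that two fields can be
  compared by uniting their sets.\<close>

definition regular :: "(real \<Rightarrow> 'v) \<Rightarrow> bool" where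
  "regular \<gamma> \<longleftrightarrow> continuous_on {0..1} \<gamma> \<and> \<gamma> ` {0..1} \<subseteq> M \<and>
     (\<exists>X K. finite X \<and> (\<forall>t\<in>{0..1} - X. (\<gamma> has_vector_derivative vector_derivative \<gamma> (at t)) (at t) \<and>
        norm (vector_derivative \<gamma> (at t)) \<le> K))"

definition transported :: "(real \<Rightarrow> 'v) \<Rightarrow> (real \<Rightarrow> 'v) \<Rightarrow> bool" where
  "transported \<gamma> f \<longleftrightarrow> continuous_on {0..1} f \<and>
     (\<exists>X. finite X \<and> (\<forall>t\<in>{0..1} - X.
        (f has_vector_derivative - G (\<gamma> t) (vector_derivative \<gamma> (at t)) (f t)) (at t)))"

lemma piecewise_C1_regular:
  assumes "subdivision n t" "\<And>i. i < n \<Longrightarrow> C1_arc (top_of_set M) {chart0} \<gamma> (t i) (t (Suc i))"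
  shows "regular \<gamma>"
proof -
  have "\<forall>i\<in>{..<n}. \<exists>\<gamma>'. (\<forall>s\<in>{t i..t (Suc i)}. (\<gamma> has_vector_derivative \<gamma>' s) (at s within {t i..t (Suc i)})) \<and>
      continuous_on {t i..t (Suc i)} \<gamma>'"
    using assms(2) by (auto simp: C1_arc_iff)
  then obtain \<gamma>' where \<gamma>': "\<And>i s. i < n \<Longrightarrow> s \<in> {t i..t (Suc i)} \<Longrightarrow>
      (\<gamma> has_vector_derivative \<gamma>' i s) (at s within {t i..t (Suc i)})"
      "\<And>i. i < n \<Longrightarrow> continuous_on {t i..t (Suc i)} (\<gamma>' i)"
    by (metis lessThan_iff)
  have "bounded (\<Union>i<n. \<gamma>' i ` {t i..t (Suc i)})"
    using \<gamma>'(2) by (auto intro!: compact_imp_bounded compact_continuous_image)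
  then obtain K where K: "\<And>i s. i < n \<Longrightarrow> s \<in> {t i..t (Suc i)} \<Longrightarrow> norm (\<gamma>' i s) \<le> K"
    unfolding bounded_iff by blast
  have "continuous_on {0..1} \<gamma>"
    using \<gamma>'(1) has_vector_derivative_continuous continuous_on_eq_continuous_within
    by (intro subdivision_continuous_on[OF assms(1)]) blast
  moreover have "\<gamma> ` {0..1} \<subseteq> M"
    using assms(2) unfolding subdivision_cover[OF assms(1), symmetric] by (auto simp: C1_arc_iff)
  moreover have "(\<gamma> has_vector_derivative vector_derivative \<gamma> (at s)) (at s) \<and> norm (vector_derivative \<gamma> (at s)) \<le> K"
    if s: "s \<in> {0..1} - t ` {..n}" for s
  proof -
    obtain i where i: "i < n" "s \<in> {t i<..<t (Suc i)}" "at s within {t i..t (Suc i)} = at s"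
      using subdivision_interior[OF assms(1) s] .
    then have "(\<gamma> has_vector_derivative \<gamma>' i s) (at s)" using \<gamma>'(1)[of i s] by simp
    moreover from this have "vector_derivative \<gamma> (at s) = \<gamma>' i s" by (rule vector_derivative_at)
    ultimately show ?thesis using K[of i s] i by simp
  qed
  ultimately show ?thesis unfolding regular_def
    by (intro conjI exI[of _ "t ` {..n}"] exI[of _ K]) auto
qed

lemma parallel_along_transported:
  assumes "parallel_along (top_of_set M) {chart0} Christoffel \<gamma> \<xi>"
  shows "regular \<gamma>" "transported \<gamma> (\<lambda>t. \<xi> t chart0)" "\<And>t. t \<in> {0..1} \<Longrightarrow> \<xi> t = emb (\<xi> t chart0)"
proof -
  obtain n t where nt: "subdivision n t" "\<And>i. i < n \<Longrightarrow> C1_arc (top_of_set M) {chart0} \<gamma> (t i) (t (Suc i))"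
    and par: "\<And>i. i < n \<Longrightarrow> parallel_on_arc {chart0} Christoffel \<gamma> \<xi> (t i) (t (Suc i))"
    using assms by (auto simp: parallel_along_def)
  show "regular \<gamma>" using nt by (rule piecewise_C1_regular)
  have M: "\<gamma> s \<in> M" if "i < n" "s \<in> {t i..t (Suc i)}" for i s
    using nt(2)[OF that(1)] that(2) by (auto simp: C1_arc_iff)
  have par': "\<xi> s = emb (\<xi> s chart0)" "((\<lambda>s. \<xi> s chart0) has_vector_derivative
         - G (\<gamma> s) (vector_derivative \<gamma> (at s within {t i..t (Suc i)})) (\<xi> s chart0)) (at s within {t i..t (Suc i)})"
    if "i < n" "s \<in> {t i..t (Suc i)}" for i s
    using par[OF that(1)] that(2)
    by (subst (asm) parallel_on_arc_iff[OF M[OF that(1)]]; blast)+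
  show "\<xi> s = emb (\<xi> s chart0)" if "s \<in> {0..1}" for s
    using that par'(1) unfolding subdivision_cover[OF nt(1), symmetric] by blast
  have "continuous_on {0..1} (\<lambda>t. \<xi> t chart0)"
    using par'(2) has_vector_derivative_continuous continuous_on_eq_continuous_within
    by (intro subdivision_continuous_on[OF nt(1)]) blast
  moreover have "((\<lambda>t. \<xi> t chart0) has_vector_derivative - G (\<gamma> s) (vector_derivative \<gamma> (at s)) (\<xi> s chart0)) (at s)"
    if s: "s \<in> {0..1} - t ` {..n}" for s
  proof -
    obtain i where i: "i < n" "s \<in> {t i<..<t (Suc i)}" "at s within {t i..t (Suc i)} = at s"
      using subdivision_interior[OF nt(1) s] .
    then show ?thesis using par'(2)[of i s] by simp
  qed
  ultimately show "transported \<gamma> (\<lambda>t. \<xi> t chart0)" unfolding transported_def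
    by (intro conjI exI[of _ "t ` {..n}"]) auto
qed

lemma transported_continuous: "transported \<gamma> f \<Longrightarrow> continuous_on {0..1} f"
  by (simp add: transported_def)

lemma transported_linear_combination:
  assumes "transported \<gamma> f" "transported \<gamma> h"
  shows "transported \<gamma> (\<lambda>t. a *\<^sub>R f t + b *\<^sub>R h t)"
proof -
  obtain X Y where "finite X" "finite Y"
    and d: "\<And>t. t \<in> {0..1} - X \<Longrightarrow> (f has_vector_derivative - G (\<gamma> t) (vector_derivative \<gamma> (at t)) (f t)) (at t)"
      "\<And>t. t \<in> {0..1} - Y \<Longrightarrow> (h has_vector_derivative - G (\<gamma> t) (vector_derivative \<gamma> (at t)) (h t)) (at t)"
    using assms by (auto simp: transported_def)
  have "((\<lambda>t. a *\<^sub>R f t + b *\<^sub>R h t) has_vector_derivative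
      - G (\<gamma> t) (vector_derivative \<gamma> (at t)) (a *\<^sub>R f t + b *\<^sub>R h t)) (at t)" if "t \<in> {0..1} - (X \<union> Y)" for t
  proof -
    have "((\<lambda>t. a *\<^sub>R f t + b *\<^sub>R h t) has_vector_derivative
      a *\<^sub>R (- G (\<gamma> t) (vector_derivative \<gamma> (at t)) (f t)) + b *\<^sub>R (- G (\<gamma> t) (vector_derivative \<gamma> (at t)) (h t))) (at t)"
      using that by (intro has_vector_derivative_add bounded_linear.has_vector_derivative[OF bounded_linear_scaleR_right] d) auto
    then show ?thesis by (simp add: bilinear_radd[OF bilinear_G] bilinear_rmul[OF bilinear_G])
  qed
  moreover have "continuous_on {0..1} (\<lambda>t. a *\<^sub>R f t + b *\<^sub>R h t)"
    using assms[THEN transported_continuous] by (intro continuous_intros)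
  ultimately show ?thesis using \<open>finite X\<close> \<open>finite Y\<close> unfolding transported_def
    by (intro conjI exI[of _ "X \<union> Y"]) auto
qed

lemma transported_L:
  assumes "regular \<gamma>" "transported \<gamma> f"
  shows "transported \<gamma> (\<lambda>t. L (f t))"
proof -
  obtain X where "finite X"
    and d: "\<And>t. t \<in> {0..1} - X \<Longrightarrow> (f has_vector_derivative - G (\<gamma> t) (vector_derivative \<gamma> (at t)) (f t)) (at t)"
    using assms(2) by (auto simp: transported_def)
  have "((\<lambda>t. L (f t)) has_vector_derivative - G (\<gamma> t) (vector_derivative \<gamma> (at t)) (L (f t))) (at t)"
    if "t \<in> {0..1} - X" for t
  proof -
    have "\<gamma> t \<in> M" using assms(1) that by (auto simp: regular_def)
    then show ?thesis
      using bounded_linear.has_vector_derivative[OF bounded_linear_L d[OF that]]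
      by (simp add: G_L linear_neg[OF lin_L])
  qed
  then show ?thesis using \<open>finite X\<close> bounded_linear.continuous_on[OF bounded_linear_L transported_continuous[OF assms(2)]]
    unfolding transported_def by (intro conjI exI[of _ X]) auto
qed

lemma transported_zero:
  assumes "regular \<gamma>" "transported \<gamma> f" "f 0 = 0" "t \<in> {0..1}"
  shows "f t = 0"
proof -
  obtain X where "finite X"
    and d: "\<And>t. t \<in> {0..1} - X \<Longrightarrow> (f has_vector_derivative - G (\<gamma> t) (vector_derivative \<gamma> (at t)) (f t)) (at t)"
    using assms(2) by (auto simp: transported_def)
  obtain Y K where "finite Y" and K: "\<And>t. t \<in> {0..1} - Y \<Longrightarrow> norm (vector_derivative \<gamma> (at t)) \<le> K"
    using assms(1) unfolding regular_def by blast
  have "continuous_on {0..1} (\<lambda>t. GG (\<gamma> t))"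
    using assms(1) by (intro continuous_on_compose2[OF continuous_on_GG]) (auto simp: regular_def)
  then have "bounded ((\<lambda>t. GG (\<gamma> t)) ` {0..1})"
    by (intro compact_imp_bounded compact_continuous_image) auto
  then obtain C where C: "\<And>t. t \<in> {0..1} \<Longrightarrow> norm (GG (\<gamma> t)) \<le> C"
    unfolding bounded_iff by blast
  show ?thesis
  proof (rule ode_zero[OF transported_continuous[OF assms(2)] _ assms(3) d _ assms(4)])
    show "finite (X \<union> Y)" using \<open>finite X\<close> \<open>finite Y\<close> by simp
    fix t assume t: "t \<in> {0..1} - (X \<union> Y)"
    then show "t \<in> {0..1} - X" by blast
    have "norm (GG (\<gamma> t) (vector_derivative \<gamma> (at t)) (f t)) \<le> norm (GG (\<gamma> t)) * norm (vector_derivative \<gamma> (at t)) * norm (f t)"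
      by (meson norm_blinfun order_trans mult_right_mono norm_ge_zero)
    also have "\<dots> \<le> C * K * norm (f t)"
      using t C[of t] K[of t] order_trans[OF norm_ge_zero C[of t]]
      by (intro mult_right_mono mult_mono) auto
    finally show "norm (- G (\<gamma> t) (vector_derivative \<gamma> (at t)) (f t)) \<le> C * K * norm (f t)"
      by (simp add: GG_apply)
  qed
qed

lemma transported_unique:
  assumes "regular \<gamma>" "transported \<gamma> f" "transported \<gamma> h" "f 0 = h 0" "t \<in> {0..1}"
  shows "f t = h t"
  using transported_zero[OF assms(1) transported_linear_combination[OF assms(2,3), of 1 "-1"]] assms(4,5) by simp

text \<open>By \<open>hm_G\<close> the derivative of \<open>hm\<close> along two parallel fields
  vanishes off a finite set, and continuity bridges the exceptional points.\<close>

lemma transported_hm: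
  assumes "regular \<gamma>" "transported \<gamma> f" "transported \<gamma> h" "t \<in> {0..1}"
  shows "hm (\<gamma> t) (f t) (h t) = hm (\<gamma> 0) (f 0) (h 0)"
proof -
  obtain X Y Z where fin: "finite X" "finite Y" "finite Z"
    and d: "\<And>t. t \<in> {0..1} - X \<Longrightarrow> (f has_vector_derivative - G (\<gamma> t) (vector_derivative \<gamma> (at t)) (f t)) (at t)"
      "\<And>t. t \<in> {0..1} - Y \<Longrightarrow> (h has_vector_derivative - G (\<gamma> t) (vector_derivative \<gamma> (at t)) (h t)) (at t)"
      "\<And>t. t \<in> {0..1} - Z \<Longrightarrow> (\<gamma> has_vector_derivative vector_derivative \<gamma> (at t)) (at t)"
    using assms by (auto simp: transported_def regular_def)
  have M: "\<gamma> t \<in> M" if "t \<in> {0..1}" for t using assms(1) that by (auto simp: regular_def)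
  have cont: "continuous_on {0..1} (\<lambda>t. S (\<gamma> t) (k t))" if "continuous_on {0..1} k" for k
  proof (rule bounded_bilinear.continuous_on[OF bounded_bilinear_blinfun_apply _ that])
    have "continuous_on M S" using Ck_on_S[of 0] by simp
    then show "continuous_on {0..1} (\<lambda>t. S (\<gamma> t))"
      using assms(1) by (rule_tac continuous_on_compose2) (auto simp: regular_def)
  qed
  have deriv: "((\<lambda>t. S (\<gamma> t) (k t)) has_vector_derivative
      S (\<gamma> t) k' + 2 *\<^sub>R E (\<gamma> t) (vector_derivative \<gamma> (at t)) (k t)) (at t)"
    if "(k has_vector_derivative k') (at t)" "t \<in> {0..1} - Z" for k k' t
  proof -
    have "((S \<circ> \<gamma>) has_vector_derivative 2 *\<^sub>R E (\<gamma> t) (vector_derivative \<gamma> (at t))) (at t)"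
      by (rule vector_derivative_diff_chain_within[OF d(3)[OF that(2)] S_has_derivative])
    from bounded_bilinear.has_vector_derivative[OF bounded_bilinear_blinfun_apply this that(1)]
    show ?thesis by (simp add: o_def blinfun.scaleR_left)
  qed
  have "((\<lambda>_. 0 :: real) has_integral (hm (\<gamma> t) (f t) (h t) - hm (\<gamma> 0) (f 0) (h 0))) {0..t}"
  proof (rule fundamental_theorem_of_calculus_interior_strong[of "X \<union> Y \<union> Z"])
    show "continuous_on {0..t} (\<lambda>t. hm (\<gamma> t) (f t) (h t))"
      unfolding hm_def using assms(4) transported_continuous[OF assms(2)] transported_continuous[OF assms(3)]
      by (intro bounded_bilinear.continuous_on[OF bounded_bilinear_g] continuous_on_subset[OF cont]) auto
    fix s assume "s \<in> {0<..<t} - (X \<union> Y \<union> Z)"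
    then have s: "s \<in> {0..1} - X" "s \<in> {0..1} - Y" "s \<in> {0..1} - Z" "\<gamma> s \<in> M" using assms(4) M by auto
    have "((\<lambda>t. hm (\<gamma> t) (f t) (h t)) has_vector_derivative
      (g (S (\<gamma> s) (f s)) (S (\<gamma> s) (- G (\<gamma> s) (vector_derivative \<gamma> (at s)) (h s)) + 2 *\<^sub>R E (\<gamma> s) (vector_derivative \<gamma> (at s)) (h s))
      + g (S (\<gamma> s) (- G (\<gamma> s) (vector_derivative \<gamma> (at s)) (f s)) + 2 *\<^sub>R E (\<gamma> s) (vector_derivative \<gamma> (at s)) (f s)) (S (\<gamma> s) (h s)))) (at s)"
      unfolding hm_def
      by (rule bounded_bilinear.has_vector_derivative[OF bounded_bilinear_g deriv deriv]) (rule d s)+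
    also have "(g (S (\<gamma> s) (f s)) (S (\<gamma> s) (- G (\<gamma> s) (vector_derivative \<gamma> (at s)) (h s)) + 2 *\<^sub>R E (\<gamma> s) (vector_derivative \<gamma> (at s)) (h s))
      + g (S (\<gamma> s) (- G (\<gamma> s) (vector_derivative \<gamma> (at s)) (f s)) + 2 *\<^sub>R E (\<gamma> s) (vector_derivative \<gamma> (at s)) (f s)) (S (\<gamma> s) (h s))) = 0"
      using hm_G[OF s(4), of "vector_derivative \<gamma> (at s)" "f s" "h s"]
      by (simp add: hm_def g_simps blinfun.minus_right)
    finally show "((\<lambda>t. hm (\<gamma> t) (f t) (h t)) has_vector_derivative 0) (at s)" .
  qed (use fin assms(4) in auto)
  from has_integral_unique[OF this has_integral_0] show ?thesis by simp
qed

text \<open>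
  In the frame \<open>S\<close> the parallel transport is a path in the centraliser, so no contraction of the loop is needed.
\<close>

lemma transport_in_identity_component:
  assumes \<gamma>: "regular \<gamma>" "\<gamma> 0 = 0" "\<gamma> 1 = 0"
    and Y: "\<And>v. \<exists>f. transported \<gamma> f \<and> f 0 = v \<and> f 1 = Y v"
  obtains A where "A \<in> identity_component (centraliser g L)" "blinfun_apply A = Y"
proof -
  obtain f where f: "\<And>v. transported \<gamma> (f v)" "\<And>v. f v 0 = v" "\<And>v. f v 1 = Y v" using Y by metis
  have lin: "linear (\<lambda>v. f v t)" if t: "t \<in> {0..1}" for t
  proof (rule linearI)
    show "f (u + v) t = f u t + f v t" for u v
      using transported_unique[OF \<gamma>(1) f(1) transported_linear_combination[OF f(1) f(1), of 1 u 1 v] _ t, of "u + v"]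
      by (simp add: f)
    show "f (r *\<^sub>R v) t = r *\<^sub>R f v t" for r v
      using transported_unique[OF \<gamma>(1) f(1) transported_linear_combination[OF f(1) f(1), of r v 0 v] _ t, of "r *\<^sub>R v"]
      by (simp add: f)
  qed
  define U where "U t = Blinfun (\<lambda>v. f v t)" for t
  have U: "U t v = f v t" if "t \<in> {0..1}" for t v
    unfolding U_def by (simp add: bounded_linear_Blinfun_apply bounded_linear_finite_dim lin[OF that])
  \<comment> \<open>\<open>S\<close> carries the metric at \<open>\<gamma> t\<close> to
    \<open>g\<close>, so the transport from \<open>0\<close> followed by \<open>S\<close> preserves
    \<open>g\<close>. Both ends lie at \<open>0\<close>, where \<open>S\<close> is the identity:
    \<open>Q\<close> runs from the identity to the holonomy operator.\<close>
  define Q where "Q t = S (\<gamma> t) o\<^sub>L U t" for t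
  have M: "\<gamma> t \<in> M" if "t \<in> {0..1}" for t using \<gamma>(1) that by (auto simp: regular_def)
  have Q: "Q t \<in> centraliser g L" if t: "t \<in> {0..1}" for t
  proof -
    have "g (Q t u) (Q t v) = g u v" for u v
      using transported_hm[OF \<gamma>(1) f(1) f(1) t, of u v]
      by (simp add: Q_def U[OF t] hm_def[symmetric] f(2) \<gamma>(2) hm_0)
    moreover have "Q t (L v) = L (Q t v)" for v
      using transported_unique[OF \<gamma>(1) f(1) transported_L[OF \<gamma>(1) f(1)] _ t, of "L v" v]
      by (simp add: Q_def U[OF t] S_L f(2))
    ultimately show ?thesis by (rule centraliserI)
  qed
  have contU: "continuous_on {0..1} U"
    by (rule continuous_on_blinfunI)
       (rule continuous_on_eq[OF transported_continuous[OF f(1)]], simp add: U)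
  have "continuous_on M S" using Ck_on_S[of 0] by simp
  then have "continuous_on {0..1} (\<lambda>t. S (\<gamma> t))"
    using \<gamma>(1) by (rule_tac continuous_on_compose2) (auto simp: regular_def)
  then have "continuous_on {0..1} Q" unfolding Q_def[abs_def] using contU by (intro continuous_intros)
  then have "connected (Q ` {0..1})" by (intro connected_continuous_image) auto
  moreover have "Q ` {0..1} \<subseteq> centraliser g L" using Q by auto
  moreover have Q0: "Q 0 = id_blinfun"
    by (rule blinfun_eqI) (simp add: Q_def U f \<gamma> S_0)
  then have "id_blinfun \<in> Q ` {0..1}" by (metis atLeastAtMost_iff image_eqI order_refl zero_le_one)
  moreover have "Q 1 \<in> Q ` {0..1}" by simp
  ultimately have "Q 1 \<in> identity_component (centraliser g L)"
    unfolding identity_component_def connected_component_def by blast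
  moreover have "blinfun_apply (Q 1) = Y"
    by (rule ext) (simp add: Q_def U f \<gamma> S_0)
  ultimately show thesis using that by blast
qed

section \<open>Upper bound for the holonomy group\<close>

abbreviation conj0 :: "('v \<Rightarrow>\<^sub>L 'v) \<Rightarrow> ('v, 'v) tangent \<Rightarrow> ('v, 'v) tangent" where
  "conj0 \<equiv> conjugate_to_tangent {chart0} 0 emb"

abbreviation Hol :: "(('v, 'v) tangent \<Rightarrow> ('v, 'v) tangent) set" where
  "Hol \<equiv> holonomy_group (top_of_set M) {chart0} Christoffel 0"

lemma inv_emb: "inv emb (emb v) = v"
  by (rule inv_f_f[OF inj_emb])

lemma conj0_emb: "conj0 A (emb v) = emb (A v)"
  by (simp add: conjugate_to_tangent_def tangent_space_eq[OF zero_M] inv_emb)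

lemma holonomy_subset: "Hol \<subseteq> conj0 ` identity_component (centraliser g L)"
proof
  fix P assume "P \<in> Hol"
  then obtain \<gamma> where P: "P \<in> extensional (range emb)" and \<gamma>: "\<gamma> 0 = 0" "\<gamma> 1 = 0"
    and "is_parallel_transport (top_of_set M) {chart0} Christoffel \<gamma> P"
    by (auto simp: holonomy_group_def tangent_space_eq[OF zero_M])
  then have "\<exists>\<xi>. parallel_along (top_of_set M) {chart0} Christoffel \<gamma> \<xi> \<and> \<xi> 0 = emb v \<and> \<xi> 1 = P (emb v)" for v
    by (auto simp: is_parallel_transport_def tangent_space_eq[OF zero_M])
  then obtain \<xi> where \<xi>: "\<And>v. parallel_along (top_of_set M) {chart0} Christoffel \<gamma> (\<xi> v)"
    "\<And>v. \<xi> v 0 = emb v" "\<And>v. \<xi> v 1 = P (emb v)" by metis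
  have reg: "regular \<gamma>" using parallel_along_transported(1)[OF \<xi>(1)] .
  have "\<exists>f. transported \<gamma> f \<and> f 0 = v \<and> f 1 = P (emb v) chart0" for v
    using parallel_along_transported(2)[OF \<xi>(1)] \<xi>(2,3) by (intro exI[of _ "\<lambda>t. \<xi> v t chart0"]) simp
  from transport_in_identity_component[OF reg \<gamma> this]
  obtain A where A: "A \<in> identity_component (centraliser g L)" "blinfun_apply A = (\<lambda>v. P (emb v) chart0)" .
  have "P (emb v) = emb (P (emb v) chart0)" for v
    using parallel_along_transported(3)[OF \<xi>(1), of 1 v] \<xi>(3) by simp
  then have "P = conj0 A"
    using P conj0_emb[of A]
    by (intro extensionalityI[of _ "range emb"])
       (auto simp: A(2) conjugate_to_tangent_def tangent_space_eq[OF zero_M])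
  with A(1) show "P \<in> conj0 ` identity_component (centraliser g L)" by blast
qed

end

context quadratic_metric
begin

section \<open>Concatenation of loops\<close>

text \<open>Naming the velocity explicitly lets affine reparametrisation act on it directly; on a
  nondegenerate interval it is the derivative used in \<open>parallel_on_arc\<close>.\<close>

definition parallel_arc :: "(real \<Rightarrow> 'v) \<Rightarrow> (real \<Rightarrow> 'v) \<Rightarrow> real \<Rightarrow> real \<Rightarrow> bool" where
  "parallel_arc \<gamma> f a b \<longleftrightarrow> (\<forall>t\<in>{a..b}. \<gamma> t \<in> M) \<and>
     (\<exists>\<gamma>'. (\<forall>t\<in>{a..b}. (\<gamma> has_vector_derivative \<gamma>' t) (at t within {a..b}) \<and>
        (f has_vector_derivative - G (\<gamma> t) (\<gamma>' t) (f t)) (at t within {a..b})) \<and> continuous_on {a..b} \<gamma>')"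

definition parallel_path :: "(real \<Rightarrow> 'v) \<Rightarrow> (real \<Rightarrow> 'v) \<Rightarrow> bool" where
  "parallel_path \<gamma> f \<longleftrightarrow> (\<exists>n t. subdivision n t \<and> (\<forall>i<n. parallel_arc \<gamma> f (t i) (t (Suc i))))"

lemma parallel_arc_iff:
  assumes "a < b"
  shows "parallel_arc \<gamma> f a b \<longleftrightarrow> C1_arc (top_of_set M) {chart0} \<gamma> a b \<and>
    parallel_on_arc {chart0} Christoffel \<gamma> (\<lambda>t. emb (f t)) a b"
proof -
  have vd: "vector_derivative \<gamma> (at t within {a..b}) = v"
    if "(\<gamma> has_vector_derivative v) (at t within {a..b})" "t \<in> {a..b}" for t v
    using assms that(2) by (intro vector_derivative_within that(1)) (simp add: trivial_limit_within islimpt_Icc)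
  show ?thesis
  proof (cases "\<forall>t\<in>{a..b}. \<gamma> t \<in> M")
    case True
    then have p: "parallel_on_arc {chart0} Christoffel \<gamma> (\<lambda>t. emb (f t)) a b \<longleftrightarrow>
      (\<forall>t\<in>{a..b}. (f has_vector_derivative
         - G (\<gamma> t) (vector_derivative \<gamma> (at t within {a..b})) (f t)) (at t within {a..b}))"
      by (subst parallel_on_arc_iff) auto
    show ?thesis unfolding C1_arc_iff parallel_arc_def p using True vd by (metis (no_types, lifting))
  qed (auto simp: parallel_arc_def C1_arc_iff)
qed

lemma parallel_along_iff:
  "parallel_along (top_of_set M) {chart0} Christoffel \<gamma> (\<lambda>t. emb (f t)) \<longleftrightarrow> parallel_path \<gamma> f"
  unfolding parallel_along_def parallel_path_def
  by (intro ex_cong1 conj_cong refl all_cong1 imp_cong parallel_arc_iff[symmetric]) (simp add: subdivision_def)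

lemma parallel_along_imp_path:
  assumes "parallel_along (top_of_set M) {chart0} Christoffel \<gamma> \<xi>"
  shows "parallel_path \<gamma> (\<lambda>t. \<xi> t chart0)"
proof -
  obtain n t where nt: "subdivision n t"
    and p: "\<And>i. i < n \<Longrightarrow> C1_arc (top_of_set M) {chart0} \<gamma> (t i) (t (Suc i))"
    "\<And>i. i < n \<Longrightarrow> parallel_on_arc {chart0} Christoffel \<gamma> \<xi> (t i) (t (Suc i))"
    using assms by (auto simp: parallel_along_def)
  have "parallel_arc \<gamma> (\<lambda>t. \<xi> t chart0) (t i) (t (Suc i))" if i: "i < n" for i
  proof -
    have M: "\<And>s. s \<in> {t i..t (Suc i)} \<Longrightarrow> \<gamma> s \<in> M" using p(1)[OF i] by (auto simp: C1_arc_iff)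
    have iff: "parallel_on_arc {chart0} Christoffel \<gamma> \<zeta> (t i) (t (Suc i)) \<longleftrightarrow>
      (\<forall>s\<in>{t i..t (Suc i)}. \<zeta> s = emb (\<zeta> s chart0) \<and>
       ((\<lambda>s. \<zeta> s chart0) has_vector_derivative
         - G (\<gamma> s) (vector_derivative \<gamma> (at s within {t i..t (Suc i)})) (\<zeta> s chart0)) (at s within {t i..t (Suc i)}))" for \<zeta>
      by (rule parallel_on_arc_iff) (rule M)
    have "parallel_on_arc {chart0} Christoffel \<gamma> (\<lambda>t. emb (\<xi> t chart0)) (t i) (t (Suc i))"
      using p(2)[OF i] unfolding iff by simp
    with p(1)[OF i] show ?thesis
      using nt i by (subst parallel_arc_iff) (auto simp: subdivision_def)
  qed
  with nt show ?thesis by (auto simp: parallel_path_def)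
qed

lemma parallel_path_piecewise_C1: "parallel_path \<gamma> f \<Longrightarrow> piecewise_C1_path (top_of_set M) {chart0} \<gamma>"
  unfolding parallel_along_iff[symmetric] parallel_along_def piecewise_C1_path_def by blast

lemma Hol_iff:
  "conj0 A \<in> Hol \<longleftrightarrow> (\<exists>\<gamma>. \<gamma> 0 = 0 \<and> \<gamma> 1 = 0 \<and> (\<forall>v. \<exists>f. parallel_path \<gamma> f \<and> f 0 = v \<and> f 1 = A v))"
proof
  assume "conj0 A \<in> Hol"
  then obtain \<gamma> where \<gamma>: "\<gamma> 0 = 0" "\<gamma> 1 = 0"
    "is_parallel_transport (top_of_set M) {chart0} Christoffel \<gamma> (conj0 A)"
    by (auto simp: holonomy_group_def)
  have "\<exists>f. parallel_path \<gamma> f \<and> f 0 = v \<and> f 1 = A v" for v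
  proof -
    obtain \<xi> where "parallel_along (top_of_set M) {chart0} Christoffel \<gamma> \<xi>" "\<xi> 0 = emb v" "\<xi> 1 = conj0 A (emb v)"
      using \<gamma> by (auto simp: is_parallel_transport_def tangent_space_eq[OF zero_M])
    then show ?thesis using parallel_along_imp_path
      by (intro exI[of _ "\<lambda>t. \<xi> t chart0"]) (simp add: conj0_emb)
  qed
  with \<gamma> show "\<exists>\<gamma>. \<gamma> 0 = 0 \<and> \<gamma> 1 = 0 \<and> (\<forall>v. \<exists>f. parallel_path \<gamma> f \<and> f 0 = v \<and> f 1 = A v)" by blast
next
  assume "\<exists>\<gamma>. \<gamma> 0 = 0 \<and> \<gamma> 1 = 0 \<and> (\<forall>v. \<exists>f. parallel_path \<gamma> f \<and> f 0 = v \<and> f 1 = A v)"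
  then obtain \<gamma> where \<gamma>: "\<gamma> 0 = 0" "\<gamma> 1 = 0" "\<And>v. \<exists>f. parallel_path \<gamma> f \<and> f 0 = v \<and> f 1 = A v" by blast
  have "\<exists>\<xi>. parallel_along (top_of_set M) {chart0} Christoffel \<gamma> \<xi> \<and> \<xi> 0 = emb v \<and> \<xi> 1 = conj0 A (emb v)" for v
  proof -
    obtain f where "parallel_path \<gamma> f" "f 0 = v" "f 1 = A v" using \<gamma>(3) by blast
    then show ?thesis by (intro exI[of _ "\<lambda>t. emb (f t)"]) (simp add: parallel_along_iff conj0_emb)
  qed
  then have "is_parallel_transport (top_of_set M) {chart0} Christoffel \<gamma> (conj0 A)"
    using \<gamma>(1) by (auto simp: is_parallel_transport_def tangent_space_eq[OF zero_M])
  moreover have "piecewise_C1_path (top_of_set M) {chart0} \<gamma>" using \<gamma>(3) parallel_path_piecewise_C1 by blast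
  ultimately show "conj0 A \<in> Hol" using \<gamma>(1,2)
    by (auto simp: holonomy_group_def conjugate_to_tangent_def)
qed

lemma parallel_arc_affine:
  assumes "parallel_arc \<gamma> f a b" "0 < m" "m * a' + q = a" "m * b' + q = b"
    and eq: "\<And>t. t \<in> {a'..b'} \<Longrightarrow> \<gamma>2 t = \<gamma> (m * t + q)" "\<And>t. t \<in> {a'..b'} \<Longrightarrow> f2 t = f (m * t + q)"
  shows "parallel_arc \<gamma>2 f2 a' b'"
proof -
  obtain \<gamma>' where M: "\<forall>s\<in>{a..b}. \<gamma> s \<in> M" and
    \<gamma>': "\<And>s. s \<in> {a..b} \<Longrightarrow> (\<gamma> has_vector_derivative \<gamma>' s) (at s within {a..b})"
      "\<And>s. s \<in> {a..b} \<Longrightarrow> (f has_vector_derivative - G (\<gamma> s) (\<gamma>' s) (f s)) (at s within {a..b})"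
    and cont: "continuous_on {a..b} \<gamma>'"
    using assms(1) unfolding parallel_arc_def by blast
  have im: "m * t + q \<in> {a..b}" if "t \<in> {a'..b'}" for t
    using that assms(2) by (auto simp: assms(3,4)[symmetric])
  have chain: "(h2 has_vector_derivative m *\<^sub>R h') (at t within {a'..b'})"
    if t: "t \<in> {a'..b'}" and h: "(h has_vector_derivative h') (at (m * t + q) within {a..b})"
      and h2: "\<And>t. t \<in> {a'..b'} \<Longrightarrow> h2 t = h (m * t + q)" for h h2 :: "real \<Rightarrow> 'v" and h' t
  proof -
    have "((\<lambda>t. m * t + q) has_vector_derivative m) (at t within {a'..b'})"
      by (auto intro!: derivative_eq_intros simp: has_real_derivative_iff_has_vector_derivative[symmetric])
    moreover have "(h has_vector_derivative h') (at (m * t + q) within (\<lambda>t. m * t + q) ` {a'..b'})"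
      by (rule has_vector_derivative_within_subset[OF h]) (use im in blast)
    ultimately have "(h \<circ> (\<lambda>t. m * t + q) has_vector_derivative m *\<^sub>R h') (at t within {a'..b'})"
      by (rule vector_diff_chain_within)
    then show ?thesis by (rule has_vector_derivative_transform[OF t, rotated]) (simp add: h2)
  qed
  have "(\<gamma>2 has_vector_derivative m *\<^sub>R \<gamma>' (m * t + q)) (at t within {a'..b'})"
    "(f2 has_vector_derivative - G (\<gamma>2 t) (m *\<^sub>R \<gamma>' (m * t + q)) (f2 t)) (at t within {a'..b'})"
    if t: "t \<in> {a'..b'}" for t
    using chain[OF t \<gamma>'(1)[OF im[OF t]] eq(1)] chain[OF t \<gamma>'(2)[OF im[OF t]] eq(2)] eq[OF t]
    by (simp_all add: bilinear_lmul[OF bilinear_G])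
  moreover have "continuous_on {a'..b'} (\<lambda>t. m *\<^sub>R \<gamma>' (m * t + q))"
    by (intro continuous_intros continuous_on_compose2[OF cont]) (use im in auto)
  ultimately show ?thesis using M im eq(1) unfolding parallel_arc_def
    by (intro conjI exI[of _ "\<lambda>t. m *\<^sub>R \<gamma>' (m * t + q)"]) auto
qed

lemma parallel_path_join:
  assumes "parallel_path \<gamma>1 f1" "parallel_path \<gamma>2 f2" "\<gamma>1 1 = \<gamma>2 0" "f1 1 = f2 0"
  shows "parallel_path (\<gamma>1 +++ \<gamma>2) (f1 +++ f2)"
proof -
  obtain n t where 1: "subdivision n t" "\<And>i. i < n \<Longrightarrow> parallel_arc \<gamma>1 f1 (t i) (t (Suc i))"
    using assms(1) by (auto simp: parallel_path_def)
  obtain m s where 2: "subdivision m s" "\<And>i. i < m \<Longrightarrow> parallel_arc \<gamma>2 f2 (s i) (s (Suc i))"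
    using assms(2) by (auto simp: parallel_path_def)
  define r where "r i = (if i \<le> n then t i / 2 else (1 + s (i - n)) / 2)" for i
  have r1: "r i = t i / 2" if "i \<le> n" for i using that by (simp add: r_def)
  have r2: "r (n + j) = (1 + s j) / 2" for j
    using 1(1) 2(1) by (cases "j = 0") (auto simp: r_def subdivision_def)
  have ends: "t 0 = 0" "t n = 1" "s 0 = 0" "s m = 1" using 1(1) 2(1) by (auto simp: subdivision_def)
  have "parallel_arc (\<gamma>1 +++ \<gamma>2) (f1 +++ f2) (r i) (r (Suc i)) \<and> r i < r (Suc i)" if i: "i < n + m" for i
  proof (cases "i < n")
    case True
    have le: "t (Suc i) \<le> 1" using True by (intro subdivision_range[OF 1(1)]) simp
    have "parallel_arc (\<gamma>1 +++ \<gamma>2) (f1 +++ f2) (r i) (r (Suc i))"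
      by (rule parallel_arc_affine[OF 1(2)[OF True], of 2 _ 0]) (use True le in \<open>auto simp: r1 joinpaths_def\<close>)
    then show ?thesis using 1(1) True by (simp add: r1 subdivision_def)
  next
    case False
    then obtain j where j: "i = n + j" "j < m" using i by (metis le_Suc_ex linorder_not_less nat_add_left_cancel_less)
    have ge: "s j \<ge> 0" using j by (intro subdivision_range[OF 2(1)]) simp
    \<comment> \<open>At 1/2 the join takes the value of the first path, so the formula of the
      second half includes its left end only because the ends match.\<close>
    have jn: "(h1 +++ h2) x = h2 (2 * x - 1)" if "h1 1 = h2 0" "x \<ge> 1/2" for h1 h2 :: "real \<Rightarrow> 'v" and x
    proof (cases "x = 1/2")
      case True
      show ?thesis unfolding True using that(1) by (simp add: joinpaths_def)
    next
      case False
      then show ?thesis using that(2) by (simp add: joinpaths_def)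
    qed
    have ri: "r i = (1 + s j) / 2" "r (Suc i) = (1 + s (Suc j)) / 2"
      using r2[of j] r2[of "Suc j"] by (simp_all add: j)
    have "parallel_arc (\<gamma>1 +++ \<gamma>2) (f1 +++ f2) (r i) (r (Suc i))"
      by (rule parallel_arc_affine[OF 2(2)[OF j(2)], of 2 _ "-1"])
         (use ge in \<open>auto simp: ri jn[of \<gamma>1 \<gamma>2, OF assms(3)] jn[of f1 f2, OF assms(4)]\<close>)
    then show ?thesis using 2(1) j(2) by (simp add: ri subdivision_def)
  qed
  moreover have "r 0 = 0" "r (n + m) = 1" using r1[of 0] r2[of m] ends by auto
  ultimately show ?thesis unfolding parallel_path_def subdivision_def
    by (intro exI[of _ "n + m"] exI[of _ r]) auto
qed

lemma Hol_compose:
  assumes "conj0 A1 \<in> Hol" "conj0 A2 \<in> Hol"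
  shows "conj0 (A2 o\<^sub>L A1) \<in> Hol"
proof -
  obtain \<gamma>1 where 1: "\<gamma>1 0 = 0" "\<gamma>1 1 = 0" "\<And>v. \<exists>f. parallel_path \<gamma>1 f \<and> f 0 = v \<and> f 1 = A1 v"
    using assms(1) unfolding Hol_iff by blast
  obtain \<gamma>2 where 2: "\<gamma>2 0 = 0" "\<gamma>2 1 = 0" "\<And>v. \<exists>f. parallel_path \<gamma>2 f \<and> f 0 = v \<and> f 1 = A2 v"
    using assms(2) unfolding Hol_iff by blast
  have "\<exists>f. parallel_path (\<gamma>1 +++ \<gamma>2) f \<and> f 0 = v \<and> f 1 = (A2 o\<^sub>L A1) v" for v
  proof -
    obtain f1 where f1: "parallel_path \<gamma>1 f1" "f1 0 = v" "f1 1 = A1 v" using 1(3) by blast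
    obtain f2 where f2: "parallel_path \<gamma>2 f2" "f2 0 = A1 v" "f2 1 = A2 (A1 v)" using 2(3) by blast
    have "parallel_path (\<gamma>1 +++ \<gamma>2) (f1 +++ f2)" using f1 f2 1 2 by (intro parallel_path_join) auto
    then show ?thesis using f1 f2 by (intro exI[of _ "f1 +++ f2"]) (simp add: joinpaths_def)
  qed
  then show ?thesis unfolding Hol_iff using 1 2
    by (intro exI[of _ "\<gamma>1 +++ \<gamma>2"]) (simp add: joinpaths_def)
qed

lemma identity_component_subset: "identity_component C \<subseteq> C"
  unfolding identity_component_def by (rule connected_component_subset)

text \<open>The solution operator applied to a vector is a parallel field with a single arc as
  subdivision. Membership in the centraliser comes for free from
  \<open>holonomy_subset\<close>.\<close>

lemma loop_in_Hol:
  assumes M: "\<And>t. t \<in> {0..1} \<Longrightarrow> \<gamma> t \<in> M" and \<gamma>: "\<gamma> 0 = 0" "\<gamma> 1 = 0"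
    and \<gamma>': "\<And>t. t \<in> {0..1} \<Longrightarrow> (\<gamma> has_vector_derivative \<gamma>' t) (at t within {0..1})"
    and cont: "continuous_on {0..1} \<gamma>'"
    and U: "continuous_on {0..1} A" "solves_ode A U" "\<And>t. t \<in> {0..1} \<Longrightarrow> A t = GG (\<gamma> t) (\<gamma>' t)"
  shows "conj0 (U 1) \<in> Hol" "U 1 \<in> centraliser g L"
proof -
  have "parallel_path \<gamma> (\<lambda>t. U t v)" for v
  proof -
    have "((\<lambda>t. U t v) has_vector_derivative - G (\<gamma> t) (\<gamma>' t) (U t v)) (at t within {0..1})"
      if t: "t \<in> {0..1}" for t
      using bounded_linear.has_vector_derivative[OF blinfun.bounded_linear_left solves_ode_derivative[OF U(1,2) t], of v]
      by (simp add: U(3)[OF t] blinfun.minus_left GG_apply)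
    then have "parallel_arc \<gamma> (\<lambda>t. U t v) 0 1" unfolding parallel_arc_def using M \<gamma>' cont by blast
    then show ?thesis unfolding parallel_path_def
      by (intro exI[of _ 1] exI[of _ real]) (simp add: subdivision_def)
  qed
  then have "\<exists>f. parallel_path \<gamma> f \<and> f 0 = v \<and> f 1 = U 1 v" for v
    by (intro exI[of _ "\<lambda>t. U t v"]) (simp add: solves_ode_0[OF U(1,2)])
  then show *: "conj0 (U 1) \<in> Hol" unfolding Hol_iff using \<gamma> by blast
  then obtain A' where A': "A' \<in> identity_component (centraliser g L)" "conj0 (U 1) = conj0 A'"
    using holonomy_subset by blast
  have "U 1 = A'"
    using A'(2) conj0_emb by (intro blinfun_eqI) (metis emb_simps(1))
  then show "U 1 \<in> centraliser g L" using A'(1) identity_component_subset by blast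
qed

end

section \<open>The holonomy group contains a neighbourhood of the identity\<close>

context quadratic_metric
begin

lemma curv_swap: "curv F a b = - curv F b a"
  by (intro blinfun_eqI g_eqI) (simp add: curv[OF tensor] g_simps blinfun.minus_left)

lemma bounded_bilinear_curv: "bounded_bilinear (curv F)"
proof (rule bounded_bilinear_finite_dim)
  have lin: "linear (curv F a)" for a
    by (intro linearI) (simp_all add: curv_linear[OF tensor])
  then show "bounded_linear (curv F a)" for a by (rule bounded_linear_finite_dim)
  have "linear (\<lambda>a. - curv F b a)" for b
    using lin[of b] by (rule linear_compose_neg)
  then show "linear (\<lambda>a. curv F a b)" for b by (simp only: curv_swap[of _ b])
qed

text \<open>At \<open>0\<close> the derivative of \<open>S\<close> vanishes, so only the explicit
  \<open>E\<close> factors contribute. The result splits into \<open>E\<close>, symmetric in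
  \<open>x\<close> and \<open>u\<close>, and \<open>curv F\<close>, alternating in them;
  antisymmetrising gives \<open>4 * curv F\<close> as the curvature there.\<close>

lemma N_has_derivative_0:
  "((\<lambda>x. N x u v) has_derivative (\<lambda>x. 2 *\<^sub>R E x u v + 2 *\<^sub>R curv F x u v)) (at 0)"
proof -
  note ap = bounded_bilinear.FDERIV[OF bounded_bilinear_blinfun_apply]
  have dS: "((\<lambda>x. S x w) has_derivative (\<lambda>x. 0)) (at 0)" for w
    using bounded_linear.has_derivative[OF blinfun.bounded_linear_left S_has_derivative[of 0]]
    by (simp add: E_simps blinfun.zero_left)
  have dS': "(S has_derivative (\<lambda>x. 0)) (at 0)"
    using S_has_derivative[of 0] by (simp add: E_simps)
  have dE: "((\<lambda>x. E x w) has_derivative (\<lambda>x. E x w)) (at 0)" for w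
    by (rule bounded_linear_imp_has_derivative[OF bounded_bilinear.bounded_linear_left[OF bounded_bilinear_E]])
  have dE': "((\<lambda>x. E x w z) has_derivative (\<lambda>x. E x w z)) (at 0)" for w z
    by (rule bounded_linear.has_derivative[OF blinfun.bounded_linear_left dE])
  have dES: "((\<lambda>x. E w (S x z)) has_derivative (\<lambda>x. 0)) (at 0)" for w z
    using bounded_linear.has_derivative[OF bounded_bilinear.bounded_linear_right[OF bounded_bilinear_E] dS, of w z]
    by (simp add: E_simps)
  have dES': "((\<lambda>x. E (S x z) w) has_derivative (\<lambda>x. 0)) (at 0)" for w z
    using dES[of w z] by (simp add: E_sym[of w])
  have dESx: "((\<lambda>x. E w (S x z) x) has_derivative (\<lambda>x. E w (S 0 z) x + blinfun_apply 0 (0 :: 'v))) (at 0)"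
    "((\<lambda>x. E (S x z) w x) has_derivative (\<lambda>x. E (S 0 z) w x + blinfun_apply 0 (0 :: 'v))) (at 0)" for w z
    by (rule ap[OF dES has_derivative_ident], rule ap[OF dES' has_derivative_ident])
  have "((\<lambda>x. N x u v) has_derivative (\<lambda>x.
     (E 0 u 0 + E x u (S 0 v)) + (S 0 (E x u v) + blinfun_apply 0 (E 0 u v)) + (E 0 v 0 + E x v (S 0 u))
      + (S 0 (E x v u) + blinfun_apply 0 (E 0 v u)) - (E u (S 0 v) x + blinfun_apply 0 (0 :: 'v)) - (E (S 0 u) v x + blinfun_apply 0 (0 :: 'v)))) (at 0)"
    unfolding N_def
    by (intro has_derivative_add has_derivative_diff dESx ap dS dS' dE dE')
  moreover have "(E 0 u 0 + E x u (S 0 v)) + (S 0 (E x u v) + blinfun_apply 0 (E 0 u v)) + (E 0 v 0 + E x v (S 0 u))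
      + (S 0 (E x v u) + blinfun_apply 0 (E 0 v u)) - (E u (S 0 v) x + blinfun_apply 0 (0 :: 'v)) - (E (S 0 u) v x + blinfun_apply 0 (0 :: 'v))
      = 2 *\<^sub>R E x u v + 2 *\<^sub>R curv F x u v" for x
  proof -
    have "E x v u = curv F x u v + E u v x"
      by (rule g_eqI) (simp add: curv[OF tensor] g_simps g_E)
    then show ?thesis by (simp add: S_0 blinfun.zero_right blinfun.zero_left scaleR_2 algebra_simps)
  qed
  ultimately show ?thesis by simp
qed

lemma G_has_derivative_0:
  "((\<lambda>x. G x u v) has_derivative (\<lambda>x. 2 *\<^sub>R E x u v + 2 *\<^sub>R curv F x u v)) (at 0)"
proof -
  note ap = bounded_bilinear.FDERIV[OF bounded_bilinear_blinfun_apply Sinv_has_derivative[OF zero_M]]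
  have N0: "N 0 u v = 0" for u v
    by (simp add: N_def E_simps blinfun.zero_left blinfun.zero_right)
  from ap[OF ap[OF N_has_derivative_0]] show ?thesis
    unfolding G_def by (simp add: N0 Sinv_0 blinfun.zero_right)
qed

text \<open>Beyond differentiability at \<open>0\<close>, the remainder is Lipschitz with an
  arbitrarily small constant near \<open>0\<close>, by continuity of the derivative. This allows the
  transports along two different loops to be compared.\<close>

lemma GG_expansion:
  obtains Nf where "bounded_linear Nf" "\<And>a b. blinfun_apply (Nf a) b = 2 *\<^sub>R E a b + 2 *\<^sub>R curv F a b"
    "\<And>\<delta>. \<delta> > 0 \<Longrightarrow> \<exists>r>0. ball 0 r \<subseteq> M \<and>
      (\<forall>x\<in>ball 0 r. \<forall>y\<in>ball 0 r. norm ((GG x - Nf x) - (GG y - Nf y)) \<le> \<delta> * norm (x - y))"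
proof -
  obtain D where D: "\<And>x. x \<in> M \<Longrightarrow> (GG has_derivative D x) (at x)" "\<And>v. continuous_on M (\<lambda>x. D x v)"
    using Ck_on_SucE[OF Ck_on_GG[of "Suc 0"]] by (metis Ck_on.simps(1))
  show thesis
  proof (rule that[of "D 0"])
    show bl: "bounded_linear (D 0)" using D(1)[OF zero_M] by (rule has_derivative_bounded_linear)
    have D0: "D 0 a b v = 2 *\<^sub>R E a b v + 2 *\<^sub>R curv F a b v" for a b v
    proof -
      have "((\<lambda>x. GG x b v) has_derivative (\<lambda>a. D 0 a b v)) (at 0)"
        by (intro bounded_linear.has_derivative[OF blinfun.bounded_linear_left] D zero_M)
      then have "((\<lambda>x. G x b v) has_derivative (\<lambda>a. D 0 a b v)) (at 0)" by (simp add: GG_apply)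
      from has_derivative_unique[OF this G_has_derivative_0] show ?thesis by (rule fun_cong)
    qed
    show "D 0 a b = 2 *\<^sub>R E a b + 2 *\<^sub>R curv F a b" for a b
      by (rule blinfun_eqI) (simp add: D0 blinfun.add_left blinfun.scaleR_left)
    fix \<delta> :: real assume \<delta>: "\<delta> > 0"
    obtain C where C: "\<And>b x. norm (crd b x) \<le> norm x * C b" "\<And>b. C b \<ge> 0"
      using bounded_linear.nonneg_bounded[OF bounded_linear_crd] by metis
    \<comment> \<open>The derivative is known to be continuous in one direction at a time. Smallness
      \<open>\<delta> / c\<close> in the finitely many basis directions gives
      \<open>\<delta>\<close> for all, as \<open>c\<close> dominates the sum of the coordinate
      bounds.\<close>
    define c where "c = (\<Sum>b\<in>B. C b) + 1"
    have c: "c > 0" using sum_nonneg[of B C] C(2) by (simp add: c_def add_nonneg_pos)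
    have "\<forall>\<^sub>F x in nhds 0. x \<in> M" using open_M zero_M by (rule eventually_nhds_in_open)
    moreover have "\<forall>\<^sub>F x in nhds 0. \<forall>b\<in>B. norm (D x b - D 0 b) < \<delta> / c"
    proof (rule eventually_ball_finite[OF finite_B], rule ballI)
      fix b
      have "isCont (\<lambda>x. D x b) 0" using D(2) open_M zero_M by (simp add: continuous_on_eq_continuous_at)
      then have "((\<lambda>x. D x b) \<longlongrightarrow> D 0 b) (nhds 0)"
        unfolding isCont_def by (rule tendsto_at_iff_tendsto_nhds[THEN iffD1])
      then show "\<forall>\<^sub>F x in nhds 0. norm (D x b - D 0 b) < \<delta> / c"
        using \<delta> c by (auto simp: tendsto_iff dist_norm)
    qed
    ultimately have "\<forall>\<^sub>F x in nhds 0. x \<in> M \<and> (\<forall>b\<in>B. norm (D x b - D 0 b) < \<delta> / c)"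
      by (rule eventually_conj)
    then obtain r where r: "r > 0" "\<And>x. dist x 0 < r \<Longrightarrow> x \<in> M \<and> (\<forall>b\<in>B. norm (D x b - D 0 b) < \<delta> / c)"
      unfolding eventually_nhds_metric by blast
    have der: "((\<lambda>x. GG x - D 0 x) has_derivative (\<lambda>h. D x h - D 0 h)) (at x within ball 0 r)"
      and on: "onorm (\<lambda>h. D x h - D 0 h) \<le> \<delta>" if x: "x \<in> ball 0 r" for x
    proof -
      have xM: "x \<in> M" "\<And>b. b \<in> B \<Longrightarrow> norm (D x b - D 0 b) \<le> \<delta> / c" using r(2)[of x] x by (auto simp: less_imp_le)
      show "((\<lambda>x. GG x - D 0 x) has_derivative (\<lambda>h. D x h - D 0 h)) (at x within ball 0 r)"
        by (intro has_derivative_diff has_derivative_at_withinI[OF D(1)[OF xM(1)]] bounded_linear_imp_has_derivative bl)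
      have lin: "linear (\<lambda>h. D x h - D 0 h)"
        using D(1)[OF xM(1)] bl by (intro linear_compose_sub) (simp_all add: has_derivative_linear bounded_linear.linear)
      show "onorm (\<lambda>h. D x h - D 0 h) \<le> \<delta>"
      proof (rule onorm_bound)
        fix h
        have "D x h - D 0 h = (\<lambda>h. D x h - D 0 h) (\<Sum>b\<in>B. crd b h *\<^sub>R b)" by (simp only: sum_crd)
        also have "\<dots> = (\<Sum>b\<in>B. crd b h *\<^sub>R (D x b - D 0 b))"
          by (simp only: linear_sum[OF lin] linear_scale[OF lin])
        also have "norm \<dots> \<le> (\<Sum>b\<in>B. (norm h * C b) * (\<delta> / c))"
          by (intro sum_norm_le) (unfold norm_scaleR real_norm_def[symmetric], intro mult_mono C xM; simp add: C)
        also have "\<dots> = \<delta> / c * norm h * (\<Sum>b\<in>B. C b)"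
          by (simp add: sum_distrib_left sum_divide_distrib mult_ac)
        also have "\<dots> \<le> \<delta> / c * norm h * c"
          using \<delta> c by (intro mult_left_mono) (auto simp: c_def)
        finally show "norm (D x h - D 0 h) \<le> \<delta> * norm h" using c by simp
      qed (use \<delta> in simp)
    qed
    have "norm ((GG x - D 0 x) - (GG y - D 0 y)) \<le> \<delta> * norm (x - y)" if "x \<in> ball 0 r" "y \<in> ball 0 r" for x y
      by (rule differentiable_bound[OF convex_ball der on that])
    moreover have "ball 0 r \<subseteq> M" using r(2) by (auto simp: dist_commute)
    ultimately show "\<exists>r>0. ball 0 r \<subseteq> M \<and>
      (\<forall>x\<in>ball 0 r. \<forall>y\<in>ball 0 r. norm ((GG x - D 0 x) - (GG y - D 0 y)) \<le> \<delta> * norm (x - y))"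
      using r(1) by blast
  qed
qed

end

section \<open>Loops whose curvature area is a prescribed Lie algebra element\<close>

locale spanning_metric = quadratic_metric B g L F
  for B :: "'v::banach set" and g L F +
  fixes n :: nat and w :: "nat \<Rightarrow> 'v" and T :: "nat \<Rightarrow> ('v \<Rightarrow>\<^sub>L 'v) \<Rightarrow> 'v"
  assumes linear_T: "linear (T k)"
    and span_T: "X \<in> skew_centraliser \<Longrightarrow> X = (\<Sum>k<n. curv F (w k) (T k X))"
begin

text \<open>The factor cancels the weight \<open>2 pi (k+1)\<close> in the area formula and the 2 in
  front of \<open>curv F\<close>; the minus sign turns \<open>curv F (T k X) (w k)\<close> into
  \<open>curv F (w k) (T k X)\<close>.\<close>

definition w' :: "nat \<Rightarrow> 'v" where
  "w' k = - (1 / (4 * pi * real (Suc k))) *\<^sub>R w k"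

definition loop :: "('v \<Rightarrow>\<^sub>L 'v) \<Rightarrow> real \<Rightarrow> 'v" where
  "loop X = trig_loop n (\<lambda>k. T k X) w'"

definition loop' :: "('v \<Rightarrow>\<^sub>L 'v) \<Rightarrow> real \<Rightarrow> 'v" where
  "loop' X = trig_loop' n (\<lambda>k. T k X) w'"

lemma loop_derivative: "(loop X has_vector_derivative loop' X t) (at t within A)"
  unfolding loop_def loop'_def by (rule trig_loop_derivative)

lemma loop_area:
  assumes "X \<in> skew_centraliser"
  shows "((\<lambda>t. 2 *\<^sub>R E (loop X t) (loop' X t) + 2 *\<^sub>R curv F (loop X t) (loop' X t)) has_integral X) {0..1}"
proof -
  \<comment> \<open>The symmetric part is the derivative of \<open>E\<close> along the loop and
    integrates to 0 because the loop closes.\<close>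
  have "((\<lambda>t. E (loop X t) (loop' X t) + E (loop' X t) (loop X t)) has_integral
      (E (loop X 1) (loop X 1) - E (loop X 0) (loop X 0))) {0..1}"
    by (rule fundamental_theorem_of_calculus)
       (auto intro: bounded_bilinear.has_vector_derivative[OF bounded_bilinear_E loop_derivative loop_derivative])
  then have 1: "((\<lambda>t. 2 *\<^sub>R E (loop X t) (loop' X t)) has_integral 0) {0..1}"
    by (simp add: loop_def trig_loop_ends E_simps E_sym[of "loop' X _"] scaleR_2)
  have "((\<lambda>t. 2 *\<^sub>R curv F (loop X t) (loop' X t)) has_integral
     2 *\<^sub>R (\<Sum>k<n. (2 * pi * real (Suc k)) *\<^sub>R curv F (T k X) (w' k))) {0..1}"
    unfolding loop_def loop'_def
    by (intro has_integral_cmul trig_loop_area bounded_bilinear_curv curv_swap)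
  also have "2 *\<^sub>R (\<Sum>k<n. (2 * pi * real (Suc k)) *\<^sub>R curv F (T k X) (w' k)) = (\<Sum>k<n. curv F (w k) (T k X))"
    unfolding scaleR_sum_right
  proof (intro sum.cong refl)
    fix k
    show "2 *\<^sub>R (2 * pi * real (Suc k)) *\<^sub>R curv F (T k X) (w' k) = curv F (w k) (T k X)"
      using curv_swap[of "T k X" "w k"]
      by (simp add: w'_def bounded_bilinear.scaleR_right[OF bounded_bilinear_curv] bounded_bilinear.minus_right[OF bounded_bilinear_curv]
          del: of_nat_Suc)
  qed
  also have "\<dots> = X" by (rule span_T[OF assms, symmetric])
  finally show ?thesis using has_integral_add[OF 1] by fastforce
qed

lemma loop_bounds:
  obtains C where "C \<ge> 1"
    "\<And>X t. norm X \<le> 1 \<Longrightarrow> norm (loop X t) \<le> C" "\<And>X t. norm X \<le> 1 \<Longrightarrow> norm (loop' X t) \<le> C"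
    "\<And>X Y t. norm (loop X t - loop Y t) \<le> C * norm (X - Y)"
    "\<And>X Y t. norm (loop' X t - loop' Y t) \<le> C * norm (X - Y)"
proof -
  obtain K where K: "\<And>k X. norm (T k X) \<le> norm X * K k" "\<And>k. K k \<ge> 0"
    using bounded_linear.nonneg_bounded[OF bounded_linear_of_blinfun[OF linear_T]] by metis
  define A where "A = sum K {..<n}"
  define B' where "B' = (\<Sum>k<n. norm (w' k))"
  have A0: "A \<ge> 0" "B' \<ge> 0" by (auto simp: A_def B'_def intro!: sum_nonneg K)
  have T: "norm (T k X) \<le> A * norm X" if "k < n" for k X
  proof -
    have "K k \<le> A" unfolding A_def using that K(2) by (intro member_le_sum) auto
    then show ?thesis using K(1)[of k X] mult_right_mono[of "K k" A "norm X"] by (simp add: mult.commute)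
  qed
  have w': "norm (w' k) \<le> B'" if "k < n" for k
    unfolding B'_def using that by (intro member_le_sum) auto
  define c1 where "c1 = 2 * real n"
  define c2 where "c2 = 2 * pi * real n * real n"
  have c: "c1 \<ge> 0" "c2 \<ge> 0" by (auto simp: c1_def c2_def)
  define C where "C = 1 + (c1 + c2) * (A + B')"
  have C: "c1 * (A + B') \<le> C" "c2 * (A + B') \<le> C" "c1 * A \<le> C" "c2 * A \<le> C" "C \<ge> 1"
    using A0 c by (auto simp: C_def algebra_simps add_nonneg_nonneg)
  show thesis
  proof (rule that[OF C(5)])
    fix X :: "'v \<Rightarrow>\<^sub>L 'v" and t :: real assume X: "norm X \<le> 1"
    have TX: "norm (T k X) \<le> A" if "k < n" for k
      using T[OF that, of X] mult_left_mono[OF X A0(1)] by simp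
    show "norm (loop X t) \<le> C" "norm (loop' X t) \<le> C"
      unfolding loop_def loop'_def
      using norm_trig_loop_le[of n "\<lambda>k. T k X" A w' B' t, OF TX w' A0] C(1,2) unfolding c1_def c2_def by linarith+
  next
    fix X Y :: "'v \<Rightarrow>\<^sub>L 'v" and t :: real
    have TXY: "norm (T k X - T k Y) \<le> A * norm (X - Y)" if "k < n" for k
      using T[OF that, of "X - Y"] by (simp add: linear_diff[OF linear_T])
    have "norm (loop X t - loop Y t) \<le> c1 * A * norm (X - Y)" "norm (loop' X t - loop' Y t) \<le> c2 * A * norm (X - Y)"
      unfolding loop_def loop'_def trig_loop_diff c1_def c2_def
      using norm_trig_loop_le[of n "\<lambda>k. T k X - T k Y" "A * norm (X - Y)" "\<lambda>_. 0" 0 t, OF TXY] A0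
      by (auto simp: mult_ac)
    then show "norm (loop X t - loop Y t) \<le> C * norm (X - Y)" "norm (loop' X t - loop' Y t) \<le> C * norm (X - Y)"
      using mult_right_mono[OF C(3), of "norm (X - Y)"] mult_right_mono[OF C(4), of "norm (X - Y)"] by auto
  qed
qed

end

context spanning_metric
begin

text \<open>
  To first order the transport along \<open>\<epsilon> loop X\<close> is \<open>id - \<epsilon>\<^sup>2 X\<close>, so correcting \<open>X\<close> by the skew part of
  the defect is a contraction.
\<close>

lemma Hol_near_identity:
  obtains \<delta> where "\<delta> > 0" "\<And>Y. Y \<in> centraliser g L \<Longrightarrow> norm (Y - id_blinfun) < \<delta> \<Longrightarrow> conj0 Y \<in> Hol"
proof -
  obtain Nf where Nf: "bounded_linear Nf" "\<And>a b. blinfun_apply (Nf a) b = 2 *\<^sub>R E a b + 2 *\<^sub>R curv F a b"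
    and expansion: "\<And>\<delta>. \<delta> > 0 \<Longrightarrow> \<exists>r>0. ball 0 r \<subseteq> M \<and>
      (\<forall>x\<in>ball 0 r. \<forall>y\<in>ball 0 r. norm ((GG x - Nf x) - (GG y - Nf y)) \<le> \<delta> * norm (x - y))"
    by (rule GG_expansion) blast
  obtain K where K: "K \<ge> 0" "\<And>a. norm (Nf a) \<le> norm a * K"
    using bounded_linear.nonneg_bounded[OF Nf(1)] by blast
  obtain C where C: "C \<ge> 1"
    and loop: "\<And>X t. norm X \<le> 1 \<Longrightarrow> norm (loop X t) \<le> C" "\<And>X t. norm X \<le> 1 \<Longrightarrow> norm (loop' X t) \<le> C"
      "\<And>X Y t. norm (loop X t - loop Y t) \<le> C * norm (X - Y)"
      "\<And>X Y t. norm (loop' X t - loop' Y t) \<le> C * norm (X - Y)"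
    by (rule loop_bounds) blast
  obtain p where p: "p > 0" "\<And>Z. norm (skew_part Z) \<le> norm Z * p"
    using bounded_linear.pos_bounded[OF bounded_linear_skew_part] by blast
  obtain \<eta> where \<eta>: "\<eta> > 0" and inj: "\<And>A C. A \<in> centraliser g L \<Longrightarrow> C \<in> centraliser g L \<Longrightarrow>
    norm (A - id_blinfun) \<le> \<eta> \<Longrightarrow> norm (C - id_blinfun) \<le> \<eta> \<Longrightarrow> skew_part A = skew_part C \<Longrightarrow> A = C"
    using skew_part_inj by metis

  \<comment> \<open>Chosen so that the nonlinear remainder of the Christoffel symbols contributes at
    most 1/8 to the contraction constant; \<open>p\<close> bounds the projection to skew
    parts.\<close>
  define \<delta> where "\<delta> = min 1 (1 / (16 * p * C\<^sup>2))"
  have \<delta>: "\<delta> > 0" "\<delta> \<le> 1" "p * (2 * \<delta> * C\<^sup>2) \<le> 1/8"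
  proof -
    show "\<delta> > 0" "\<delta> \<le> 1" using p(1) C by (auto simp: \<delta>_def)
    have "p * (2 * \<delta> * C\<^sup>2) \<le> p * (2 * (1 / (16 * p * C\<^sup>2)) * C\<^sup>2)"
      using p(1) C by (intro mult_left_mono mult_right_mono) (auto simp: \<delta>_def)
    also have "\<dots> = 1/8" using p(1) C by (simp add: field_simps)
    finally show "p * (2 * \<delta> * C\<^sup>2) \<le> 1/8" .
  qed
  obtain r where r: "r > 0" "ball 0 r \<subseteq> M" and
    lip: "\<And>x y. x \<in> ball 0 r \<Longrightarrow> y \<in> ball 0 r \<Longrightarrow> norm ((GG x - Nf x) - (GG y - Nf y)) \<le> \<delta> * norm (x - y)"
    using expansion[OF \<delta>(1)] by blast
  define D where "D x = GG x - Nf x" for x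
  have GG0: "GG 0 = 0" by (intro blinfun_eqI) (simp add: GG_apply G_0)
  have D0: "D 0 = 0" using Nf(1) by (simp add: D_def GG0 bounded_linear.linear linear_0)
  have D_lip: "norm (D x - D y) \<le> \<delta> * norm (x - y)" if "x \<in> ball 0 r" "y \<in> ball 0 r" for x y
    using lip[OF that] by (simp add: D_def)
  have D_le: "norm (D x) \<le> \<delta> * norm x" if "x \<in> ball 0 r" for x
    using D_lip[OF that, of 0] r(1) by (simp add: D0)

  \<comment> \<open>\<open>K * C^2\<close> bounds the quadratic part \<open>Q\<close> and
    \<open>\<delta> * C^2\<close> bounds \<open>R\<close> after division by the square of
    \<open>\<epsilon>\<close>. So \<open>b\<close> below bounds the coefficient
    \<open>A\<close>.\<close>
  define \<kappa> where "\<kappa> = (K + 1) * C\<^sup>2"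
  have \<kappa>: "\<kappa> \<ge> 1" "K * C\<^sup>2 + \<delta> * C\<^sup>2 \<le> \<kappa>"
  proof -
    have "1 * 1 \<le> (K + 1) * C\<^sup>2" using K C by (intro mult_mono) auto
    then show "\<kappa> \<ge> 1" by (simp add: \<kappa>_def)
    have "\<delta> * C\<^sup>2 \<le> 1 * C\<^sup>2" using \<delta> by (intro mult_right_mono) auto
    then show "K * C\<^sup>2 + \<delta> * C\<^sup>2 \<le> \<kappa>" by (simp add: \<kappa>_def algebra_simps)
  qed
  \<comment> \<open>In turn these give \<open>b \<le> 1/2\<close> for solving the equation, a
    contribution of at most 1/8 from its second-order terms, and \<open>2 * b \<le> \<eta>\<close>
    to stay where the skew part is injective.\<close>
  define q where "q = min (1 / (2 * \<kappa>)) (min (1 / (96 * \<kappa>\<^sup>2 * p)) (\<eta> / (2 * \<kappa>)))"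
  have q: "q > 0" using \<kappa> p \<eta> by (auto simp: q_def)
  define \<epsilon> where "\<epsilon> = min (r / (2 * C)) (min 1 q)"
  have \<epsilon>: "\<epsilon> > 0" "\<epsilon> * C < r" "\<epsilon>\<^sup>2 \<le> q"
  proof -
    show e0: "\<epsilon> > 0" using r(1) C q by (auto simp: \<epsilon>_def)
    have "\<epsilon> * C \<le> r / (2 * C) * C" using C by (intro mult_right_mono) (auto simp: \<epsilon>_def)
    also have "\<dots> < r" using r(1) C by simp
    finally show "\<epsilon> * C < r" .
    have "\<epsilon> * \<epsilon> \<le> 1 * q" using e0 q by (intro mult_mono) (auto simp: \<epsilon>_def)
    then show "\<epsilon>\<^sup>2 \<le> q" by (simp add: power2_eq_square)
  qed
  have \<epsilon>2: "\<epsilon>\<^sup>2 > 0" using \<epsilon>(1) by simp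
  define b where "b = \<epsilon>\<^sup>2 * \<kappa>"
  have b: "b \<ge> 0" "b \<le> 1/2" "2 * b \<le> \<eta>" "p * (12 * b * \<kappa>) \<le> 1/8"
  proof -
    show "b \<ge> 0" using \<kappa> by (simp add: b_def)
    have bq: "b \<le> q * \<kappa>" unfolding b_def using \<epsilon>(3) \<kappa> by (intro mult_right_mono) auto
    also have "q * \<kappa> \<le> 1 / (2 * \<kappa>) * \<kappa>" using \<kappa> by (intro mult_right_mono) (auto simp: q_def)
    also have "\<dots> = 1/2" using \<kappa> by simp
    finally show "b \<le> 1/2" .
    have "q * \<kappa> \<le> \<eta> / (2 * \<kappa>) * \<kappa>" using \<kappa> by (intro mult_right_mono) (auto simp: q_def)
    also have "\<dots> = \<eta> / 2" using \<kappa> by simp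
    finally show "2 * b \<le> \<eta>" using bq by simp
    have "q * \<kappa> \<le> 1 / (96 * \<kappa>\<^sup>2 * p) * \<kappa>" using \<kappa> by (intro mult_right_mono) (auto simp: q_def)
    then have "p * (12 * b * \<kappa>) \<le> p * (12 * (1 / (96 * \<kappa>\<^sup>2 * p) * \<kappa>) * \<kappa>)"
      using bq p \<kappa> by (intro mult_left_mono mult_right_mono) auto
    also have "\<dots> = 1/8" using p \<kappa> by (simp add: field_simps power2_eq_square)
    finally show "p * (12 * b * \<kappa>) \<le> 1/8" .
  qed

  define \<gamma> where "\<gamma> X t = \<epsilon> *\<^sub>R loop X t" for X t
  define \<gamma>' where "\<gamma>' X t = \<epsilon> *\<^sub>R loop' X t" for X t
  define A where "A X t = blinfun_apply (GG (\<gamma> X t)) (\<gamma>' X t)" for X t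
  define R where "R X t = blinfun_apply (D (\<gamma> X t)) (\<gamma>' X t)" for X t
  define Q where "Q X t = blinfun_apply (Nf (loop X t)) (loop' X t)" for X t
  have A_eq: "A X t = \<epsilon>\<^sup>2 *\<^sub>R Q X t + R X t" for X t
  proof -
    have "Nf (\<gamma> X t) (\<gamma>' X t) = \<epsilon>\<^sup>2 *\<^sub>R Q X t"
      by (simp add: \<gamma>_def \<gamma>'_def Q_def linear_scale[OF bounded_linear.linear[OF Nf(1)]]
          blinfun.scaleR_left blinfun.scaleR_right power2_eq_square)
    then show ?thesis by (simp add: A_def R_def D_def blinfun.diff_left)
  qed
  have \<gamma>_norm: "norm (\<gamma> X t) \<le> \<epsilon> * C" "norm (\<gamma>' X t) \<le> \<epsilon> * C" if "norm X \<le> 1" for X t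
    using loop(1,2)[OF that] \<epsilon>(1) by (auto simp: \<gamma>_def \<gamma>'_def)
  have \<gamma>_ball: "\<gamma> X t \<in> ball 0 r" if "norm X \<le> 1" for X t
    using \<gamma>_norm(1)[OF that, of t] \<epsilon>(2) by simp
  have \<gamma>_diff: "norm (\<gamma> X t - \<gamma> Y t) \<le> \<epsilon> * (C * norm (X - Y))" "norm (\<gamma>' X t - \<gamma>' Y t) \<le> \<epsilon> * (C * norm (X - Y))" for X Y t
    using loop(3,4)[of X t Y] \<epsilon>(1) by (auto simp: \<gamma>_def \<gamma>'_def scaleR_diff_right[symmetric])
  have R_norm: "norm (R X t) \<le> \<epsilon>\<^sup>2 * (\<delta> * C\<^sup>2)" if "norm X \<le> 1" for X t
  proof -
    have "norm (D (\<gamma> X t)) \<le> \<delta> * (\<epsilon> * C)"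
      using D_le[OF \<gamma>_ball[OF that]] \<gamma>_norm(1)[OF that, of t] \<delta>(1) by (meson mult_left_mono order_trans less_imp_le)
    then have "norm (D (\<gamma> X t)) * norm (\<gamma>' X t) \<le> (\<delta> * (\<epsilon> * C)) * (\<epsilon> * C)"
      using \<delta>(1) \<epsilon>(1) C by (intro mult_mono \<gamma>_norm(2)[OF that]) auto
    then show ?thesis unfolding R_def
      using norm_blinfun[of "D (\<gamma> X t)" "\<gamma>' X t"] by (simp add: power2_eq_square mult_ac)
  qed
  have R_diff: "norm (R X t - R Y t) \<le> \<epsilon>\<^sup>2 * (2 * \<delta> * C\<^sup>2) * norm (X - Y)" if XY: "norm X \<le> 1" "norm Y \<le> 1" for X Y t
  proof -
    have "R X t - R Y t = (D (\<gamma> X t) - D (\<gamma> Y t)) (\<gamma>' X t) + D (\<gamma> Y t) (\<gamma>' X t - \<gamma>' Y t)"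
      by (simp add: R_def blinfun.diff_left blinfun.diff_right)
    also have "norm \<dots> \<le> (\<delta> * (\<epsilon> * (C * norm (X - Y)))) * (\<epsilon> * C) + (\<delta> * (\<epsilon> * C)) * (\<epsilon> * (C * norm (X - Y)))"
    proof (intro order_trans[OF norm_triangle_ineq] add_mono order_trans[OF norm_blinfun] mult_mono)
      show "norm (D (\<gamma> X t) - D (\<gamma> Y t)) \<le> \<delta> * (\<epsilon> * (C * norm (X - Y)))"
        using D_lip[OF \<gamma>_ball[OF XY(1)] \<gamma>_ball[OF XY(2)]] \<gamma>_diff(1)[of X t Y] \<delta>(1)
        by (meson mult_left_mono order_trans less_imp_le)
      show "norm (D (\<gamma> Y t)) \<le> \<delta> * (\<epsilon> * C)"
        using D_le[OF \<gamma>_ball[OF XY(2)]] \<gamma>_norm(1)[OF XY(2), of t] \<delta>(1) by (meson mult_left_mono order_trans less_imp_le)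
    qed (use \<gamma>_norm(2)[OF XY(1)] \<gamma>_diff(2) \<delta>(1) \<epsilon>(1) C in auto)
    also have "\<dots> = \<epsilon>\<^sup>2 * (2 * \<delta> * C\<^sup>2) * norm (X - Y)" by (simp add: power2_eq_square)
    finally show ?thesis .
  qed
  have Q_norm: "norm (Q X t) \<le> K * C\<^sup>2" if "norm X \<le> 1" for X t
  proof -
    have "norm (Q X t) \<le> norm (Nf (loop X t)) * norm (loop' X t)" unfolding Q_def by (rule norm_blinfun)
    also have "\<dots> \<le> (norm (loop X t) * K) * norm (loop' X t)" by (intro mult_right_mono K) auto
    also have "\<dots> \<le> (C * K) * C" using K(1) C by (intro mult_mono loop(1,2)[OF that]) auto
    finally show ?thesis by (simp add: power2_eq_square mult_ac)
  qed
  have Q_diff: "norm (Q X t - Q Y t) \<le> 2 * (K * C\<^sup>2) * norm (X - Y)" if XY: "norm X \<le> 1" "norm Y \<le> 1" for X Y t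
  proof -
    have "Q X t - Q Y t = (Nf (loop X t - loop Y t)) (loop' X t) + Nf (loop Y t) (loop' X t - loop' Y t)"
      by (simp add: Q_def blinfun.diff_left blinfun.diff_right linear_diff[OF bounded_linear.linear[OF Nf(1)]])
    also have "norm \<dots> \<le> ((C * norm (X - Y)) * K) * C + (C * K) * (C * norm (X - Y))"
    proof (intro order_trans[OF norm_triangle_ineq] add_mono order_trans[OF norm_blinfun] mult_mono)
      show "norm (Nf (loop X t - loop Y t)) \<le> (C * norm (X - Y)) * K"
        using K(2)[of "loop X t - loop Y t"] loop(3)[of X t Y] K(1) by (meson mult_right_mono order_trans)
      show "norm (Nf (loop Y t)) \<le> C * K"
        using K(2)[of "loop Y t"] loop(1)[OF XY(2), of t] K(1) by (meson mult_right_mono order_trans)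
    qed (use loop XY K(1) C in auto)
    also have "\<dots> = 2 * (K * C\<^sup>2) * norm (X - Y)" by (simp add: power2_eq_square)
    finally show ?thesis .
  qed
  have A_norm: "norm (A X t) \<le> b" if "norm X \<le> 1" for X t
  proof -
    have "norm (A X t) \<le> \<epsilon>\<^sup>2 * norm (Q X t) + norm (R X t)"
      unfolding A_eq using norm_triangle_ineq[of "\<epsilon>\<^sup>2 *\<^sub>R Q X t" "R X t"] by simp
    also have "\<dots> \<le> \<epsilon>\<^sup>2 * (K * C\<^sup>2) + \<epsilon>\<^sup>2 * (\<delta> * C\<^sup>2)"
      by (intro add_mono mult_left_mono Q_norm R_norm that) simp
    also have "\<dots> = \<epsilon>\<^sup>2 * (K * C\<^sup>2 + \<delta> * C\<^sup>2)" by (simp add: algebra_simps)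
    also have "\<dots> \<le> b" unfolding b_def by (intro mult_left_mono \<kappa>) simp
    finally show ?thesis .
  qed
  have A_diff: "norm (A X t - A Y t) \<le> 2 * b * norm (X - Y)" if XY: "norm X \<le> 1" "norm Y \<le> 1" for X Y t
  proof -
    have "A X t - A Y t = \<epsilon>\<^sup>2 *\<^sub>R (Q X t - Q Y t) + (R X t - R Y t)"
      by (simp add: A_eq algebra_simps)
    then have "norm (A X t - A Y t) \<le> \<epsilon>\<^sup>2 * norm (Q X t - Q Y t) + norm (R X t - R Y t)"
      using norm_triangle_ineq[of "\<epsilon>\<^sup>2 *\<^sub>R (Q X t - Q Y t)" "R X t - R Y t"] by simp
    also have "\<dots> \<le> \<epsilon>\<^sup>2 * (2 * (K * C\<^sup>2) * norm (X - Y)) + \<epsilon>\<^sup>2 * (2 * \<delta> * C\<^sup>2) * norm (X - Y)"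
      by (intro add_mono mult_left_mono Q_diff R_diff XY) simp
    also have "\<dots> = 2 * (\<epsilon>\<^sup>2 * (K * C\<^sup>2 + \<delta> * C\<^sup>2)) * norm (X - Y)" by (simp add: algebra_simps)
    also have "\<dots> \<le> 2 * b * norm (X - Y)"
      unfolding b_def using \<kappa> by (intro mult_right_mono mult_left_mono) auto
    finally show ?thesis .
  qed
  have cont_loop: "continuous_on S' (loop X)" "continuous_on S' (loop' X)" for X S'
    unfolding loop_def loop'_def by (rule continuous_on_trig_loop, rule continuous_on_trig_loop')
  have A_cont: "continuous_on {0..1} (A X)" if "norm X \<le> 1" for X
  proof -
    have "continuous_on {0..1} (\<gamma> X)" unfolding \<gamma>_def by (intro continuous_intros cont_loop)
    then have "continuous_on {0..1} (\<lambda>t. GG (\<gamma> X t))"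
      using \<gamma>_ball[OF that] r(2) by (intro continuous_on_compose2[OF continuous_on_GG]) auto
    moreover have "continuous_on {0..1} (\<gamma>' X)" unfolding \<gamma>'_def by (intro continuous_intros cont_loop)
    ultimately show ?thesis unfolding A_def
      by (intro bounded_bilinear.continuous_on[OF bounded_bilinear_blinfun_apply])
  qed
  have "\<exists>U. solves_ode (A X) U" if "norm X \<le> 1" for X
    using ex_solves_ode[OF A_cont[OF that]] A_norm[OF that] b(2) by (meson order_trans)
  then obtain U where U: "\<And>X. norm X \<le> 1 \<Longrightarrow> solves_ode (A X) (U X)" by metis
  define \<Phi> where "\<Phi> X = U X 1" for X
  have \<Phi>: "conj0 (\<Phi> X) \<in> Hol" "\<Phi> X \<in> centraliser g L" if X: "norm X \<le> 1" for X
  proof -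
    have l: "\<gamma> X 0 = 0" "\<gamma> X 1 = 0" by (simp_all add: \<gamma>_def loop_def trig_loop_ends)
    have d: "(\<gamma> X has_vector_derivative \<gamma>' X t) (at t within {0..1})" for t
      unfolding \<gamma>_def \<gamma>'_def
      by (rule bounded_linear.has_vector_derivative[OF bounded_linear_scaleR_right loop_derivative])
    have m: "\<gamma> X t \<in> M" for t using \<gamma>_ball[OF X] r(2) by blast
    have c: "continuous_on {0..1} (\<gamma>' X)" unfolding \<gamma>'_def by (intro continuous_intros cont_loop)
    show "conj0 (\<Phi> X) \<in> Hol" "\<Phi> X \<in> centraliser g L"
      unfolding \<Phi>_def using loop_in_Hol[OF m l d c A_cont[OF X] U[OF X]] by (simp_all add: A_def)
  qed
  have \<Phi>_near: "norm (\<Phi> X - id_blinfun) \<le> \<eta>" if "norm X \<le> 1" for X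
    using solves_ode_norm_le(2)[OF A_cont[OF that] U[OF that] b(2) A_norm[OF that], of 1] b(3) by (simp add: \<Phi>_def)
  have Q_int: "(Q X has_integral X) {0..1}" if "X \<in> skew_centraliser" for X
    using loop_area[OF that] by (simp add: Q_def[abs_def] Nf(2))
  have R_integrable: "R X integrable_on {0..1}" and
    A_int: "integral {0..1} (A X) = \<epsilon>\<^sup>2 *\<^sub>R X + integral {0..1} (R X)" if X: "norm X \<le> 1" "X \<in> skew_centraliser" for X
  proof -
    have "A X integrable_on {0..1}" by (rule integrable_continuous_interval[OF A_cont[OF X(1)]])
    moreover have Qi: "((\<lambda>t. \<epsilon>\<^sup>2 *\<^sub>R Q X t) has_integral \<epsilon>\<^sup>2 *\<^sub>R X) {0..1}" by (rule has_integral_cmul[OF Q_int[OF X(2)]])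
    moreover have "R X = (\<lambda>t. A X t - \<epsilon>\<^sup>2 *\<^sub>R Q X t)" by (simp add: A_eq fun_eq_iff)
    ultimately show R: "R X integrable_on {0..1}" by (metis integrable_diff has_integral_integrable)
    have "(A X has_integral \<epsilon>\<^sup>2 *\<^sub>R X + integral {0..1} (R X)) {0..1}"
      unfolding A_eq[abs_def] by (rule has_integral_add[OF Qi integrable_integral[OF R]])
    then show "integral {0..1} (A X) = \<epsilon>\<^sup>2 *\<^sub>R X + integral {0..1} (R X)" by (rule integral_unique)
  qed
  have \<Phi>_lip: "norm (\<epsilon>\<^sup>2 *\<^sub>R (X - Y) + (\<Phi> X - \<Phi> Y)) \<le> \<epsilon>\<^sup>2 * (12 * b * \<kappa> + 2 * \<delta> * C\<^sup>2) * norm (X - Y)"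
    if X: "norm X \<le> 1" "X \<in> skew_centraliser" and Y: "norm Y \<le> 1" "Y \<in> skew_centraliser" for X Y
  proof -
    have 1: "norm ((\<Phi> X + integral {0..1} (A X)) - (\<Phi> Y + integral {0..1} (A Y))) \<le> 6 * b * (2 * b * norm (X - Y))"
      unfolding \<Phi>_def
      by (rule solves_ode_lipschitz[OF A_cont[OF X(1)] A_cont[OF Y(1)] U[OF X(1)] U[OF Y(1)] b(2) A_norm[OF X(1)] A_norm[OF Y(1)] A_diff[OF X(1) Y(1)]])
    have "norm (integral {0..1} (\<lambda>t. R X t - R Y t)) \<le> integral {0..1} (\<lambda>t::real. \<epsilon>\<^sup>2 * (2 * \<delta> * C\<^sup>2) * norm (X - Y))"
      by (intro integral_norm_bound_integral integrable_diff R_integrable X Y R_diff) auto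
    then have 2: "norm (integral {0..1} (R X) - integral {0..1} (R Y)) \<le> \<epsilon>\<^sup>2 * (2 * \<delta> * C\<^sup>2) * norm (X - Y)"
      by (simp add: integral_diff R_integrable X Y)
    have "\<epsilon>\<^sup>2 *\<^sub>R (X - Y) + (\<Phi> X - \<Phi> Y) = ((\<Phi> X + integral {0..1} (A X)) - (\<Phi> Y + integral {0..1} (A Y)))
        - (integral {0..1} (R X) - integral {0..1} (R Y))"
      by (simp add: A_int X Y algebra_simps)
    then have "norm (\<epsilon>\<^sup>2 *\<^sub>R (X - Y) + (\<Phi> X - \<Phi> Y)) \<le> 6 * b * (2 * b * norm (X - Y)) + \<epsilon>\<^sup>2 * (2 * \<delta> * C\<^sup>2) * norm (X - Y)"
      using order_trans[OF norm_triangle_ineq4 add_mono[OF 1 2]] by (simp only:)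
    also have "\<dots> = \<epsilon>\<^sup>2 * (12 * b * \<kappa> + 2 * \<delta> * C\<^sup>2) * norm (X - Y)"
      by (simp add: b_def power2_eq_square algebra_simps)
    finally show ?thesis .
  qed
  \<comment> \<open>\<open>loop 0\<close> still has the sine coefficients \<open>w'\<close>, so its
    transport need not be the identity. It is compared with the constant solution for coefficient
    0.\<close>
  have \<Phi>0: "norm (\<Phi> 0 - id_blinfun) \<le> \<epsilon>\<^sup>2 * (6 * b * \<kappa> + \<delta> * C\<^sup>2)"
  proof -
    have z: "norm (0 :: 'v \<Rightarrow>\<^sub>L 'v) \<le> 1" by simp
    have s0: "solves_ode (\<lambda>_. 0 :: 'v \<Rightarrow>\<^sub>L 'v) (\<lambda>_. id_blinfun)" by (simp add: solves_ode_def)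
    have "norm ((\<Phi> 0 + integral {0..1} (A 0)) - (id_blinfun + integral {0..1} (\<lambda>_::real. 0))) \<le> 6 * b * b"
      unfolding \<Phi>_def
      by (rule solves_ode_lipschitz[OF A_cont[OF z] continuous_on_const U[OF z] s0 b(2)]) (use A_norm[OF z] b in auto)
    then have 1: "norm (\<Phi> 0 - id_blinfun + integral {0..1} (R 0)) \<le> 6 * b * b"
      using A_int[OF z skew_centraliser_closed(2)] by (simp add: algebra_simps)
    have "norm (integral {0..1} (R 0)) \<le> integral {0..1} (\<lambda>t::real. \<epsilon>\<^sup>2 * (\<delta> * C\<^sup>2))"
      by (intro integral_norm_bound_integral R_integrable z skew_centraliser_closed R_norm) auto
    then have 2: "norm (integral {0..1} (R 0)) \<le> \<epsilon>\<^sup>2 * (\<delta> * C\<^sup>2)" by simp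
    have "norm (\<Phi> 0 - id_blinfun) \<le> norm (\<Phi> 0 - id_blinfun + integral {0..1} (R 0)) + norm (integral {0..1} (R 0))"
      using norm_triangle_ineq4[of "\<Phi> 0 - id_blinfun + integral {0..1} (R 0)" "integral {0..1} (R 0)"] by simp
    also have "\<dots> \<le> 6 * b * b + \<epsilon>\<^sup>2 * (\<delta> * C\<^sup>2)" using 1 2 by simp
    also have "\<dots> = \<epsilon>\<^sup>2 * (6 * b * \<kappa> + \<delta> * C\<^sup>2)" by (simp add: b_def power2_eq_square algebra_simps)
    finally show ?thesis .
  qed

  have "conj0 Y \<in> Hol" if Y: "Y \<in> centraliser g L" "norm (Y - id_blinfun) < min \<eta> (\<epsilon>\<^sup>2 / (4 * p))" for Y
  proof -
    define W where "W = skew_centraliser \<inter> cball 0 1"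
    define \<Psi> where "\<Psi> X = X + (1 / \<epsilon>\<^sup>2) *\<^sub>R skew_part (\<Phi> X - Y)" for X
    have sp: "linear skew_part" by (rule bounded_linear.linear[OF bounded_linear_skew_part])
    have W: "X \<in> skew_centraliser" "norm X \<le> 1" if "X \<in> W" for X using that by (auto simp: W_def)
    have scale: "norm ((1 / \<epsilon>\<^sup>2) *\<^sub>R skew_part Z) \<le> p * c" if "norm Z \<le> \<epsilon>\<^sup>2 * c" for Z c
    proof -
      have "norm (skew_part Z) \<le> \<epsilon>\<^sup>2 * c * p" using p(2)[of Z] mult_right_mono[OF that, of p] p(1) by linarith
      then show ?thesis using \<epsilon>2 by (simp add: field_simps)
    qed
    have lip\<Psi>: "norm (\<Psi> X - \<Psi> Z) \<le> 1/4 * norm (X - Z)" if "X \<in> W" "Z \<in> W" for X Z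
    proof -
      have XZ: "skew_part (X - Z) = X - Z"
        using skew_part_skew W(1) that by (simp add: linear_diff[OF sp])
      have "\<Psi> X - \<Psi> Z = (1 / \<epsilon>\<^sup>2) *\<^sub>R skew_part (\<epsilon>\<^sup>2 *\<^sub>R (X - Z) + (\<Phi> X - \<Phi> Z))"
        unfolding linear_add[OF sp] linear_scale[OF sp] XZ \<Psi>_def using \<epsilon>2
        by (simp add: linear_diff[OF sp] algebra_simps)
      then have "norm (\<Psi> X - \<Psi> Z) \<le> p * ((12 * b * \<kappa> + 2 * \<delta> * C\<^sup>2) * norm (X - Z))"
        using scale[of "\<epsilon>\<^sup>2 *\<^sub>R (X - Z) + (\<Phi> X - \<Phi> Z)"] \<Phi>_lip[OF W(2,1) W(2,1), OF that(1,1,2,2)] by (simp add: mult.assoc)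
      also have "\<dots> = (p * (12 * b * \<kappa>) + p * (2 * \<delta> * C\<^sup>2)) * norm (X - Z)" by (simp add: algebra_simps)
      also have "\<dots> \<le> 1/4 * norm (X - Z)" using b(4) \<delta>(3) by (intro mult_right_mono) auto
      finally show ?thesis .
    qed
    have W0: "0 \<in> W" using skew_centraliser_closed by (simp add: W_def)
    have \<Psi>0: "norm (\<Psi> 0) \<le> 1/2"
    proof -
      have "norm (\<Phi> 0 - Y) \<le> norm (\<Phi> 0 - id_blinfun) + norm (Y - id_blinfun)"
        using norm_triangle_ineq4[of "\<Phi> 0 - id_blinfun" "Y - id_blinfun"] by simp
      also have "\<dots> \<le> \<epsilon>\<^sup>2 * (6 * b * \<kappa> + \<delta> * C\<^sup>2) + \<epsilon>\<^sup>2 * (1 / (4 * p))"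
        using \<Phi>0 Y(2) by simp
      finally have "norm (\<Phi> 0 - Y) \<le> \<epsilon>\<^sup>2 * (6 * b * \<kappa> + \<delta> * C\<^sup>2 + 1 / (4 * p))" by (simp add: algebra_simps)
      from scale[OF this] have "norm (\<Psi> 0) \<le> p * (6 * b * \<kappa> + \<delta> * C\<^sup>2 + 1 / (4 * p))" by (simp add: \<Psi>_def)
      also have "\<dots> = 1/2 * (p * (12 * b * \<kappa>)) + 1/2 * (p * (2 * \<delta> * C\<^sup>2)) + 1/4"
        using p(1) by (simp add: field_simps)
      also have "\<dots> \<le> 1/2" using b(4) \<delta>(3) by linarith
      finally show ?thesis .
    qed
    \<comment> \<open>The two contributions of 1/8 give the constant 1/4. With
      \<open>norm (\<Psi> 0) \<le> 1/2\<close> the unit ball of the Lie algebra is mapped into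
      itself.\<close>
    have "\<exists>!X\<in>W. \<Psi> X = X"
    proof (rule Banach_fix[where c = "1/4"])
      have "closed W" unfolding W_def by (intro closed_Int skew_centraliser_closed closed_cball)
      then show "complete W" by (simp add: complete_eq_closed)
      show "W \<noteq> {}" using W0 by blast
      show "\<Psi> ` W \<subseteq> W"
      proof
        fix Z assume "Z \<in> \<Psi> ` W"
        then obtain X where X: "X \<in> W" "Z = \<Psi> X" by blast
        have "skew_part (\<Phi> X) + (- 1) *\<^sub>R skew_part Y \<in> skew_centraliser"
          by (intro skew_centraliser_closed skew_part_centraliser \<Phi>(2) W(2) X(1) Y(1))
        then have "skew_part (\<Phi> X - Y) \<in> skew_centraliser" by (simp add: linear_diff[OF sp])
        then have "Z \<in> skew_centraliser"
          unfolding X(2) \<Psi>_def using W(1)[OF X(1)] by (intro skew_centraliser_closed)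
        moreover have "norm (\<Psi> X) \<le> norm (\<Psi> X - \<Psi> 0) + norm (\<Psi> 0)"
          using norm_triangle_ineq[of "\<Psi> X - \<Psi> 0" "\<Psi> 0"] by simp
        then have "norm Z \<le> 1"
          using lip\<Psi>[OF X(1) W0] W(2)[OF X(1)] \<Psi>0 X(2) by simp
        ultimately show "Z \<in> W" by (simp add: W_def)
      qed
      show "dist (\<Psi> X) (\<Psi> Z) \<le> 1/4 * dist X Z" if "X \<in> W" "Z \<in> W" for X Z
        using lip\<Psi>[OF that] by (simp add: dist_norm)
    qed auto
    then obtain X where X: "X \<in> W" "\<Psi> X = X" by blast
    have "skew_part (\<Phi> X - Y) = 0" using X(2) \<epsilon>2 by (simp add: \<Psi>_def)
    then have eq: "skew_part (\<Phi> X) = skew_part Y" by (simp add: linear_diff[OF sp])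
    have "norm (Y - id_blinfun) \<le> \<eta>" using Y(2) by simp
    \<comment> \<open>The fixed point only matches skew parts; both operators are in the centraliser
      within \<open>\<eta>\<close> of the identity, where the skew part determines the
      operator.\<close>
    then have "\<Phi> X = Y"
      using inj[OF \<Phi>(2)[OF W(2)[OF X(1)]] Y(1) \<Phi>_near[OF W(2)[OF X(1)]] _ eq] by blast
    then show ?thesis using \<Phi>(1)[OF W(2)[OF X(1)]] by simp
  qed
  moreover have "min \<eta> (\<epsilon>\<^sup>2 / (4 * p)) > 0" using \<eta> \<epsilon>2 p(1) by simp
  ultimately show thesis using that by blast
qed

text \<open>A subgroup that contains a neighbourhood of the identity is locally constant on cosets, hence contains every
  connected set through the identity.\<close>

lemma holonomy_supset: "conj0 ` identity_component (centraliser g L) \<subseteq> Hol"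
proof
  fix P assume "P \<in> conj0 ` identity_component (centraliser g L)"
  then obtain A V where A: "P = conj0 A" "connected V" "V \<subseteq> centraliser g L" "id_blinfun \<in> V" "A \<in> V"
    by (auto simp: identity_component_def connected_component_def)
  obtain \<delta> where \<delta>: "\<delta> > 0" "\<And>Y. Y \<in> centraliser g L \<Longrightarrow> norm (Y - id_blinfun) < \<delta> \<Longrightarrow> conj0 Y \<in> Hol"
    by (rule Hol_near_identity) blast
  obtain K where K: "K > 0" "\<And>A. norm (adj A) \<le> norm A * K"
    using bounded_linear.pos_bounded[OF bounded_linear_adj] by blast
  \<comment> \<open>Write \<open>C\<close> as \<open>Z\<close> times \<open>Z^-1 C\<close>, with
    \<open>adj Z\<close> as the inverse. The second factor is near the identity, and the holonomy
    group is closed under composition.\<close>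
  have step: "conj0 C \<in> Hol"
    if "Z \<in> centraliser g L" "C \<in> centraliser g L" "norm Z * K * norm (C - Z) < \<delta>" "conj0 Z \<in> Hol" for Z C
  proof -
    have "(adj Z o\<^sub>L C) - id_blinfun = adj Z o\<^sub>L (C - Z)"
      by (rule blinfun_eqI) (simp add: blinfun.diff_left blinfun.diff_right adj_inverse that)
    then have "norm ((adj Z o\<^sub>L C) - id_blinfun) \<le> norm (adj Z) * norm (C - Z)"
      by (simp add: norm_blinfun_compose)
    also have "\<dots> \<le> norm Z * K * norm (C - Z)" by (intro mult_right_mono K) auto
    finally have "conj0 (adj Z o\<^sub>L C) \<in> Hol"
      using that by (intro \<delta>(2) compose_centraliser adj_centraliser) auto
    moreover have "Z o\<^sub>L (adj Z o\<^sub>L C) = C" by (rule blinfun_eqI) (simp add: adj_inverse that)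
    ultimately show ?thesis using Hol_compose[OF _ that(4)] by metis
  qed
  have "conj0 A \<in> Hol"
  proof (rule connected_induction_simple[OF A(2,4,5), of "\<lambda>Z. conj0 Z \<in> Hol"])
    show "conj0 id_blinfun \<in> Hol"
      using A(3,4) \<delta> by (intro \<delta>(2)) auto
    fix Z assume Z: "Z \<in> V"
    \<comment> \<open>Two points of the ball are at most \<open>2 * e\<close> apart and have norm at
      most \<open>norm Z + 1\<close>; the \<open>+ 1\<close> in the denominator keeps it positive
      and yields the strict inequality that \<open>step\<close> needs.\<close>
    define e where "e = min 1 (\<delta> / (2 * (norm Z + 1) * K + 1))"
    have e: "e > 0" "(norm Z + 1) * K * (2 * e) < \<delta>"
    proof -
      have pos: "2 * (norm Z + 1) * K + 1 > 0" using K(1) by (intro add_nonneg_pos) auto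
      then show "e > 0" using \<delta>(1) by (simp add: e_def)
      have "e \<le> \<delta> / (2 * (norm Z + 1) * K + 1)" by (simp add: e_def)
      then have "e * (2 * (norm Z + 1) * K + 1) \<le> \<delta>" using pos by (simp add: pos_le_divide_eq)
      then show "(norm Z + 1) * K * (2 * e) < \<delta>" using \<open>e > 0\<close> by (simp add: algebra_simps)
    qed
    show "\<exists>N. openin (top_of_set V) N \<and> Z \<in> N \<and> (\<forall>x\<in>N. \<forall>y\<in>N. conj0 x \<in> Hol \<longrightarrow> conj0 y \<in> Hol)"
    proof (intro exI[of _ "V \<inter> ball Z e"] conjI ballI impI)
      show "openin (top_of_set V) (V \<inter> ball Z e)" by (simp add: openin_open_Int)
      show "Z \<in> V \<inter> ball Z e" using Z e by simp
      fix x y assume x: "x \<in> V \<inter> ball Z e" and y: "y \<in> V \<inter> ball Z e" and Hx: "conj0 x \<in> Hol"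
      have "norm (x - Z) < e" "norm (y - Z) < e" using x y by (auto simp: dist_norm norm_minus_commute)
      moreover have "e \<le> 1" by (simp add: e_def)
      ultimately have "norm x \<le> norm Z + 1" "norm (y - x) \<le> 2 * e"
        using norm_triangle_ineq2[of x Z] norm_triangle_ineq4[of "y - Z" "x - Z"] by auto
      then have "norm x * K * norm (y - x) \<le> (norm Z + 1) * K * (2 * e)"
        using K(1) by (intro mult_mono) auto
      then show "conj0 y \<in> Hol" using x y A(3) e(2) Hx by (intro step[of x y]) auto
    qed
  qed
  then show "P \<in> Hol" by (simp add: A(1))
qed

lemma holonomy_eq: "Hol = conj0 ` identity_component (centraliser g L)"
  using holonomy_subset holonomy_supset by blast

end

theorem theorem1:
  fixes g :: "'v::banach \<Rightarrow> 'v \<Rightarrow> real" and L :: "'v \<Rightarrow> 'v"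
  assumes "\<exists>B :: 'v set. finite B \<and> span B = UNIV"
    and "bilinear g" and "\<forall>u v. g u v = g v u" and "nondegenerate g"
    and "linear L" and "form_symmetric g L"
  shows "\<exists>(X :: 'v topology) (\<A> :: ('v, 'v) chart set) h \<Gamma> x (\<phi> :: 'v \<Rightarrow> ('v, 'v) tangent).
           smooth_manifold X \<A> \<and> connected_space X \<and>
           pseudo_riemannian_metric X \<A> h \<and> levi_civita \<A> h \<Gamma> \<and>
           x \<in> topspace X \<and> tangent_iso \<A> x \<phi> \<and>
           holonomy_group X \<A> \<Gamma> x =
             conjugate_to_tangent \<A> x \<phi> ` identity_component (centraliser g L)"
proof -
  obtain B0 :: "'v set" where B0: "finite B0" "span B0 = UNIV" using assms(1) by blast
  obtain B where B: "B \<subseteq> B0" "independent B" "B0 \<subseteq> span B"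
    using maximal_independent_subset[of B0] by blast
  have "span B = UNIV" using B(3) B0(2) by (metis span_mono span_span top.extremum_uniqueI)
  then interpret self_adjoint B g L
    using B(2) finite_subset[OF B(1) B0(1)] assms(2-)
    by (intro self_adjoint.intro finite_dim.intro self_adjoint_axioms.intro)
       (simp_all add: nondegenerate_def form_symmetric_def)
  obtain F n w T where F: "curv_tensor F" "\<And>k::nat. linear (T k :: ('v \<Rightarrow>\<^sub>L 'v) \<Rightarrow> 'v)"
    "\<And>X. X \<in> skew_centraliser \<Longrightarrow> X = (\<Sum>k<(n::nat). curv F (w k) (T k X))"
    by (rule ex_curv_tensor) blast
  interpret spanning_metric B g L F n w T
    by (intro spanning_metric.intro quadratic_metric.intro quadratic_metric_axioms.intro
        spanning_metric_axioms.intro self_adjoint_axioms F)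
  show ?thesis
    using smooth_manifold_M connected_space_M pseudo_riemannian_metric_M levi_civita_M tangent_iso_emb
      holonomy_eq zero_M
    by (intro exI[of _ "top_of_set M"] exI[of _ "{chart0}"] exI[of _ hh] exI[of _ Christoffel] exI[of _ 0]
        exI[of _ emb]) simp
qed

end
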